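(* Let $N\ge 1$ and $m\ge 1$ be integers, let $1<p<\infty$, and let $K\subset\mathbb{R}^N$ be a bounded, convex, symmetric set containing the origin and with nonempty interior. Let $(\rho_\varepsilon)_{\varepsilon>0}$ be a family of (measurable) functions $\rho_\varepsilon:[0,\infty)\to[0,\infty)$ such that $$\int_0^\infty r^{N-1}\rho_\varepsilon(r)\,dr=1\ \text{ for all }\varepsilon,\qquad \lim_{\varepsilon\to0}\int_\delta^\infty r^{N-1}\rho_\varepsilon(r)\,dr=0\ \text{ for all }\delta>0.$$ Let $f\in W^{m,p}(\mathbb{R}^N)$. Then $$\lim_{\varepsilon\to0}\int_{\mathbb{R}^N}\int_{\mathbb{R}^N}\frac{|R^m f(x,y)|^p}{\|x-y\|_K^{mp}}\,\rho_\varepsilon(\|x-y\|_K)\,dx\,dy=\frac{N+mp}{m^{mp}}\int_{\mathbb{R}^N}\int_K|D^m f(x)(y,\dots,y)|^p\,dy\,dx.$$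
   Context: Symmetric means $K=-K$. $\|\cdot\|_K$ is the norm on $\mathbb{R}^N$ with unit ball $K$: $\|x\|_K=\inf\{\lambda>0: x/\lambda\in K\}$. $W^{m,p}(\mathbb{R}^N)$ is the usual Sobolev space. For $\sigma=(\sigma_1,\dots,\sigma_N)\in\mathbb{R}^N$ and a.e. $x$, $$D^m f(x)(\sigma,\dots,\sigma)=\sum_{1\le i_1,\dots,i_m\le N}\sigma_{i_1}\cdots\sigma_{i_m}\frac{\partial^m f}{\partial x_{i_1}\cdots\partial x_{i_m}}(x)$$ (weak derivatives). Finally, $$R^m f(x,y)=\sum_{j=0}^m(-1)^j\binom{m}{j}f\left(\frac{m-j}{m}x+\frac{j}{m}y\right).$$ *)

theory Defs
  imports "HOL-Analysis.Analysis"
begin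

text \<open>The infimum ranges over \<open>{l > 0. x / l \<in> K}\<close>, which is nonempty as soon as \<open>0\<close> is an
  interior point of \<open>K\<close>.\<close>

definition norm_of_body :: "(real ^ 'n) set \<Rightarrow> real ^ 'n \<Rightarrow> real" where
  "norm_of_body K x = Inf {l. 0 < l \<and> x /\<^sub>R l \<in> K}"

definition partial :: "'n::finite \<Rightarrow> (real ^ 'n \<Rightarrow> real) \<Rightarrow> real ^ 'n \<Rightarrow> real" where
  "partial i f x = frechet_derivative f (at x) (axis i 1)"

text \<open>A list of coordinate indices of length \<open>k\<close> stands for a partial derivative of order \<open>k\<close>,
  the last entry being applied first.\<close>

definition partials :: "'n::finite list \<Rightarrow> (real ^ 'n \<Rightarrow> real) \<Rightarrow> real ^ 'n \<Rightarrow> real" where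
  "partials js f = foldr partial js f"

definition test_function :: "(real ^ 'n::finite \<Rightarrow> real) \<Rightarrow> bool" where
  "test_function \<phi> \<longleftrightarrow>
     (\<forall>js x. partials js \<phi> differentiable (at x)) \<and> compact (closure {x. \<phi> x \<noteq> 0})"

definition locally_integrable :: "(real ^ 'n::finite \<Rightarrow> real) \<Rightarrow> bool" where
  "locally_integrable f \<longleftrightarrow> (\<forall>C. compact C \<longrightarrow> set_integrable lebesgue C f)"

definition has_weak_partials ::
    "'n::finite list \<Rightarrow> (real ^ 'n \<Rightarrow> real) \<Rightarrow> (real ^ 'n \<Rightarrow> real) \<Rightarrow> bool" where
  "has_weak_partials js f g \<longleftrightarrow>
     locally_integrable f \<and> locally_integrable g \<and>
     (\<forall>\<phi>. test_function \<phi> \<longrightarrow>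
        integral\<^sup>L lebesgue (\<lambda>x. f x * partials js \<phi> x) =
        (-1) ^ length js * integral\<^sup>L lebesgue (\<lambda>x. g x * \<phi> x))"

text \<open>Weak derivatives are determined only almost everywhere; this picks a representative.\<close>

definition weak_partials ::
    "'n::finite list \<Rightarrow> (real ^ 'n \<Rightarrow> real) \<Rightarrow> real ^ 'n \<Rightarrow> real" where
  "weak_partials js f = (SOME g. has_weak_partials js f g)"

text \<open>\<open>L\<^sup>p\<close> and \<open>W\<^sup>m\<^sup>,\<^sup>p\<close> as sets of functions, not of classes modulo a.e. equality.\<close>

definition Lp :: "real \<Rightarrow> (real ^ 'n::finite \<Rightarrow> real) set" where
  "Lp p = {f \<in> borel_measurable lebesgue. integrable lebesgue (\<lambda>x. \<bar>f x\<bar> powr p)}"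

definition Sobolev :: "nat \<Rightarrow> real \<Rightarrow> (real ^ 'n::finite \<Rightarrow> real) set" where
  "Sobolev m p =
     {f \<in> Lp p. \<forall>js. length js \<le> m \<longrightarrow> (\<exists>g \<in> Lp p. has_weak_partials js f g)}"

definition weak_D :: "nat \<Rightarrow> (real ^ 'n::finite \<Rightarrow> real) \<Rightarrow> real ^ 'n \<Rightarrow> real ^ 'n \<Rightarrow> real" where
  "weak_D m f x \<sigma> =
     (\<Sum>js | length js = m. prod_list (map (\<lambda>i. \<sigma> $ i) js) * weak_partials js f x)"

definition R_diff ::
    "nat \<Rightarrow> (real ^ 'n \<Rightarrow> real) \<Rightarrow> real ^ 'n \<Rightarrow> real ^ 'n \<Rightarrow> real" where
  "R_diff m f x y =
     (\<Sum>j=0..m. (-1) ^ j * real (m choose j) *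
        f (((real m - real j) / real m) *\<^sub>R x + (real j / real m) *\<^sub>R y))"

end

theory Submission
  imports Defs "HOL-Probability.Probability"
begin

text \<open>
  Put \<open>w = x - y\<close> and \<open>h = w / m\<close>. Then \<open>R\<^sup>m f(x, y)\<close> is the iterated forward difference
  \<open>\<Delta>\<^sub>h\<^sup>m f(y)\<close>, so by Tonelli's theorem the double integral is
  \<open>\<integral> \<parallel>\<Delta>\<^sub>h\<^sup>m f\<parallel>\<^sub>p\<^sup>p |w|\<^sup>-\<^sup>m\<^sup>p \<rho>\<^sub>\<epsilon>(|w|) dw\<close>, where \<open>|w|\<close> is the norm of the body \<open>K\<close>
  (\<open>nn_integral_R_diff_radial\<close>).

  If \<open>\<Delta>\<^sub>h\<^sup>m f\<close> is replaced by the \<open>m\<close>-th derivative \<open>D\<^sup>m f(y)(h, \<dots>, h)\<close>, nothing is left of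
  \<open>\<epsilon>\<close>: the function \<open>H(w) = \<parallel>D\<^sup>m f(h, \<dots>, h)\<parallel>\<^sub>p\<^sup>p\<close> is homogeneous of degree \<open>mp\<close>, so in polar
  coordinates adapted to \<open>K\<close> the radial integral is that of \<open>r\<^sup>N\<^sup>-\<^sup>1 \<rho>\<^sub>\<epsilon>(r)\<close>, which is \<open>1\<close>, and
  the angular one is \<open>N + mp\<close> times the integral of \<open>H\<close> over the unit ball of the norm
  (\<open>nn_integral_homogeneous_radial\<close>). The factor \<open>m\<^sup>-\<^sup>m\<^sup>p\<close> of the limit comes from \<open>h = w / m\<close>.
  The polar formula itself follows from scaling: for a function \<open>g\<close> that is homogeneous of
  degree \<open>0\<close>, the image of the measure \<open>g dx\<close> under the norm is determined by its values on
  \<open>(-\<infinity>, r]\<close>, and those are given by scaling (\<open>nn_integral_polar\<close>).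

  It remains to compare differences with derivatives. For a smooth function \<open>\<Delta>\<^sub>h\<^sup>m\<close> is the average
  of \<open>D\<^sup>m(h, \<dots>, h)\<close> over the points \<open>y + s h\<close>, where \<open>s\<close> has the law of the sum of \<open>m\<close>
  independent uniform variables on \<open>[0, 1]\<close> (\<open>average_weight_exists\<close>). Moving differences and derivatives
  to a test function and back transfers this identity to weak derivatives, for almost every \<open>y\<close>
  (\<open>forward_diff_eq_average_of_weak_derivatives\<close>). Jensen's inequality then bounds
  \<open>\<parallel>\<Delta>\<^sub>h\<^sup>m f - D\<^sup>m f(h, \<dots>, h)\<parallel>\<^sub>p\<^sup>p\<close> by a multiple of \<open>|h|\<^sup>m\<^sup>p\<close> times the \<open>L\<^sup>p\<close> modulus of continuity of the
  derivatives (\<open>pth_moment_forward_diff_minus_dir_form_le\<close>). As translations are continuous in \<open>L\<^sup>p\<close>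
  (\<open>translation_continuous_in_Lp\<close>) and the mass of \<open>\<rho>\<^sub>\<epsilon>\<close> concentrates at \<open>0\<close>, the error integral tends
  to \<open>0\<close>. Finally \<open>|a + b|\<^sup>p \<le> A |a|\<^sup>p + B |b|\<^sup>p\<close> holds with \<open>A\<close> as close to \<open>1\<close> as one likes, so an
  error that vanishes in this sense does not change the limit (\<open>tendsto_if_mutually_dominated\<close>).

  Since the given functions are only Lebesgue measurable, Tonelli's theorem is applied to
  Borel representatives. The derivatives in the limit are arbitrarily chosen weak derivatives; by
  the fundamental lemma of the calculus of variations (\<open>AE_zero_if_test_integrals_zero\<close>) they agree
  almost everywhere with derivatives in \<open>L\<^sup>p\<close>.
\<close>

section \<open>Test functions and the fundamental lemma of the calculus of variations\<close>

text \<open>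
  The whole sequence of derivatives is part of the definition, so that the derivatives of
  products and rescalings can be given by formulas.
\<close>

definition smooth_real :: "(real \<Rightarrow> real) \<Rightarrow> bool" where
  "smooth_real u \<longleftrightarrow> (\<exists>U. U 0 = u \<and> (\<forall>n t. (U n has_real_derivative U (Suc n) t) (at t)))"

lemma smooth_real_coinduct:
  assumes "u \<in> C"
    and "\<And>v. v \<in> C \<Longrightarrow> \<exists>w \<in> C. \<forall>t. (v has_real_derivative w t) (at t)"
  shows "smooth_real u"
proof -
  obtain D where D: "\<And>v. v \<in> C \<Longrightarrow> D v \<in> C"
      "\<And>v t. v \<in> C \<Longrightarrow> (v has_real_derivative D v t) (at t)"
    using assms(2) by metis
  have "(D ^^ n) u \<in> C" for n
    by (induction n) (auto simp: assms(1) D)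
  then show ?thesis
    unfolding smooth_real_def by (intro exI[of _ "\<lambda>n. (D ^^ n) u"]) (simp add: D)
qed

text \<open>
  The sums of products \<open>U\<^sub>a V\<^sub>b\<close> of derivatives of the two factors form a class that is closed
  under differentiation.
\<close>

lemma smooth_real_mult:
  assumes "smooth_real u" "smooth_real v"
  shows "smooth_real (\<lambda>t. u t * v t)"
proof -
  obtain U V where U: "U 0 = u" "\<And>n t. (U n has_real_derivative U (Suc n) t) (at t)"
    and V: "V 0 = v" "\<And>n t. (V n has_real_derivative V (Suc n) t) (at t)"
    using assms unfolding smooth_real_def by metis
  define S :: "(nat \<times> nat) list \<Rightarrow> real \<Rightarrow> real"
    where "S xs t = (\<Sum>(a, b)\<leftarrow>xs. U a t * V b t)" for xs t
  have "\<exists>ys. \<forall>t. (S xs has_real_derivative S ys t) (at t)" for xs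
  proof (induction xs)
    case Nil
    show ?case by (rule exI[of _ "[]"]) (simp add: S_def[abs_def])
  next
    case (Cons ab xs)
    obtain a b where ab: "ab = (a, b)" by force
    obtain ys where ys: "\<And>t. (S xs has_real_derivative S ys t) (at t)"
      using Cons by blast
    have S_Cons: "S ((a, b) # xs) = (\<lambda>t. U a t * V b t + S xs t)" for a b xs
      by (simp add: S_def[abs_def])
    have "(S (ab # xs) has_real_derivative S ((Suc a, b) # (a, Suc b) # ys) t) (at t)" for t
      unfolding ab S_Cons by (rule derivative_eq_intros U V ys refl | simp)+
    then show ?case by blast
  qed
  moreover have "(\<lambda>t. u t * v t) = S [(0, 0)]"
    by (simp add: S_def[abs_def] U V)
  ultimately show ?thesis
    by (intro smooth_real_coinduct[where C = "range S"]) auto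
qed

lemma smooth_real_affine:
  assumes "smooth_real u"
  shows "smooth_real (\<lambda>t. u (c * t + d))"
proof -
  obtain U where U: "U 0 = u" "\<And>n t. (U n has_real_derivative U (Suc n) t) (at t)"
    using assms unfolding smooth_real_def by metis
  have "((\<lambda>t. U n (c * t + d)) has_real_derivative (U (Suc n) (c * t + d) * c)) (at t)" for n t
    by (rule DERIV_chain2[OF U(2)]) (auto intro!: derivative_eq_intros)
  then have "((\<lambda>t. c ^ n * U n (c * t + d)) has_real_derivative
      c ^ Suc n * U (Suc n) (c * t + d)) (at t)" for n t
    by (auto intro!: derivative_eq_intros)
  then show ?thesis
    unfolding smooth_real_def
    by (intro exI[of _ "\<lambda>n t. c ^ n * U n (c * t + d)"]) (simp add: U(1))
qed

text \<open>
  The standard smooth function all of whose derivatives vanish at \<open>0\<close>.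
\<close>

definition flat_exp :: "real \<Rightarrow> real" where
  "flat_exp t = (if 0 < t then exp (- (1 / t)) else 0)"

lemma tendsto_poly_div_exp: "((\<lambda>x. poly P x / exp x) \<longlongrightarrow> (0::real)) at_top"
proof -
  have eq: "(\<lambda>x. poly P x / exp x) = (\<lambda>x. \<Sum>i\<le>degree P. coeff P i * (x ^ i / exp x))"
    by (auto simp: poly_altdef sum_divide_distrib)
  show ?thesis
    unfolding eq
    by (intro tendsto_null_sum tendsto_mult_right_zero tendsto_power_div_exp_0)
qed

text \<open>
  Every derivative has the form \<open>P(1/t) exp(-1/t)\<close> on the positive axis, with a polynomial \<open>P\<close>:
  differentiation replaces \<open>P\<close> by \<open>X\<^sup>2 (P - P')\<close>. At \<open>0\<close> the exponential beats the polynomial.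
\<close>

lemma smooth_real_flat_exp: "smooth_real flat_exp"
proof -
  define E :: "real poly \<Rightarrow> real \<Rightarrow> real"
    where "E P t = (if 0 < t then poly P (1 / t) * exp (- (1 / t)) else 0)" for P t
  have "(E P has_real_derivative E (monom 1 2 * (P - pderiv P)) t) (at t)" for P t
  proof (cases t "0 :: real" rule: linorder_cases)
    case less
    have "((\<lambda>_. 0) has_real_derivative 0) (at t)" by simp
    then have "(E P has_real_derivative 0) (at t)"
      by (rule has_field_derivative_transform_within_open[of _ _ _ "{..<0}"])
        (use less in \<open>auto simp: E_def\<close>)
    then show ?thesis using less by (simp add: E_def)
  next
    case greater
    have inv: "((\<lambda>t. 1 / t) has_real_derivative - ((1 / t)\<^sup>2)) (at t)"
      using greater by (auto intro!: derivative_eq_intros simp: power2_eq_square)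
    have "((\<lambda>t. poly P (1 / t) * exp (- (1 / t))) has_real_derivative
        poly P (1 / t) * (exp (- (1 / t)) * - (- ((1 / t)\<^sup>2)))
        + poly (pderiv P) (1 / t) * - ((1 / t)\<^sup>2) * exp (- (1 / t))) (at t)"
      by (intro DERIV_mult' DERIV_chain2[OF poly_DERIV] DERIV_chain2[OF DERIV_exp]
          DERIV_minus inv)
    also have "poly P (1 / t) * (exp (- (1 / t)) * - (- ((1 / t)\<^sup>2)))
        + poly (pderiv P) (1 / t) * - ((1 / t)\<^sup>2) * exp (- (1 / t))
        = poly (monom 1 2 * (P - pderiv P)) (1 / t) * exp (- (1 / t))"
      by (simp add: poly_monom algebra_simps)
    finally have "(E P has_real_derivative
        poly (monom 1 2 * (P - pderiv P)) (1 / t) * exp (- (1 / t))) (at t)"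
      by (rule has_field_derivative_transform_within_open[of _ _ _ "{0<..}"])
        (use greater in \<open>auto simp: E_def\<close>)
    then show ?thesis using greater by (simp add: E_def)
  next
    case equal
    have r: "((\<lambda>h. poly (pCons 0 P) (inverse h) / exp (inverse h)) \<longlongrightarrow> 0) (at_right 0)"
      by (rule filterlim_compose[OF tendsto_poly_div_exp filterlim_inverse_at_top_right])
    have "((\<lambda>h. (E P (0 + h) - E P 0) / h) \<longlongrightarrow> 0) (at_right 0)"
      by (rule Lim_transform_eventually[OF r])
        (auto simp: eventually_at_filter E_def exp_minus field_simps)
    moreover have "((\<lambda>h. (E P (0 + h) - E P 0) / h) \<longlongrightarrow> 0) (at_left 0)"
      by (rule Lim_transform_eventually[OF tendsto_const])
        (auto simp: eventually_at_filter E_def)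
    ultimately have "((\<lambda>h. (E P (0 + h) - E P 0) / h) \<longlongrightarrow> 0) (at 0)"
      by (simp add: filterlim_at_split)
    then show ?thesis
      unfolding equal by (simp add: DERIV_def E_def)
  qed
  moreover have "flat_exp = E 1"
    by (auto simp: flat_exp_def E_def)
  ultimately show ?thesis
    by (intro smooth_real_coinduct[where C = "range E"]) auto
qed

lemma partial_eqI:
  assumes "(f has_derivative f') (at x)"
  shows "partial i f x = f' (axis i 1)"
  using frechet_derivative_at[OF assms] by (simp add: partial_def)

lemma partials_Cons [simp]: "partials (i # js) f = partial i (partials js f)"
  and partials_Nil [simp]: "partials [] f = f"
  by (simp_all add: partials_def)

lemma has_derivative_prod_coords:
  fixes x :: "real ^ 'n::finite"
  assumes "\<And>i. (v i has_real_derivative v' i) (at (x $ i))"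
  shows "((\<lambda>x. \<Prod>i\<in>UNIV. v i (x $ i)) has_derivative
     (\<lambda>h. \<Sum>i\<in>UNIV. v' i * h $ i * (\<Prod>j\<in>UNIV - {i}. v j (x $ j)))) (at x)"
proof -
  have "((\<lambda>x. v i (x $ i)) has_derivative (\<lambda>h. v' i * h $ i)) (at x)" for i
  proof -
    have c: "((\<lambda>x. x $ i) has_derivative (\<lambda>h. h $ i)) (at x)"
      by (rule bounded_linear_imp_has_derivative[OF bounded_linear_vec_nth])
    show ?thesis
      using has_derivative_compose[OF c assms[of i, unfolded has_field_derivative_def]]
      by (simp add: o_def)
  qed
  then show ?thesis
    by (rule has_derivative_prod)
qed

text \<open>
  A partial derivative of a product of functions of the single coordinates differentiates exactly one
  factor, so these products, with arbitrary orders of differentiation in the factors, are closed under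
  partial derivatives.
\<close>

lemma test_function_prod_coords:
  fixes u :: "'n::finite \<Rightarrow> real \<Rightarrow> real"
  assumes u: "\<And>i. smooth_real (u i)" and supp: "\<And>i t. u i t \<noteq> 0 \<Longrightarrow> a $ i \<le> t \<and> t \<le> b $ i"
  shows "test_function (\<lambda>x::real^'n. \<Prod>i\<in>UNIV. u i (x $ i))"
proof -
  obtain U where U: "\<And>i. U i 0 = u i"
      "\<And>i n t. (U i n has_real_derivative U i (Suc n) t) (at t)"
    using u unfolding smooth_real_def by metis
  define P :: "('n \<Rightarrow> nat) \<Rightarrow> real ^ 'n \<Rightarrow> real"
    where "P k x = (\<Prod>i\<in>UNIV. U i (k i) (x $ i))" for k x
  have D: "(P k has_derivative (\<lambda>h. \<Sum>i\<in>UNIV. U i (Suc (k i)) (x $ i) * h $ i *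
      (\<Prod>j\<in>UNIV - {i}. U j (k j) (x $ j)))) (at x)" for k x
    unfolding P_def[abs_def] by (rule has_derivative_prod_coords) (rule U)
  have pP: "partial l (P k) = P (k(l := Suc (k l)))" for l k
  proof
    fix x
    have "partial l (P k) x = (\<Sum>i\<in>UNIV. if i = l then U l (Suc (k l)) (x $ l) *
      (\<Prod>j\<in>UNIV - {l}. U j (k j) (x $ j)) else 0)"
      by (subst partial_eqI[OF D], rule sum.cong) (auto simp: axis_def)
    also have "\<dots> = U l (Suc (k l)) (x $ l) * (\<Prod>j\<in>UNIV - {l}. U j (k j) (x $ j))"
      by simp
    also have "\<dots> = P (k(l := Suc (k l))) x"
      by (subst P_def, subst prod.remove[of _ l]) auto
    finally show "partial l (P k) x = P (k(l := Suc (k l))) x" .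
  qed
  have "\<exists>k. partials js (P (\<lambda>_. 0)) = P k" for js
    by (induction js) (auto simp: pP)
  moreover have P0: "(\<lambda>x::real^'n. \<Prod>i\<in>UNIV. u i (x $ i)) = P (\<lambda>_. 0)"
    by (simp add: P_def[abs_def] U)
  ultimately have "\<exists>k. partials js (\<lambda>x::real^'n. \<Prod>i\<in>UNIV. u i (x $ i)) = P k" for js
    by simp
  moreover have "P k differentiable (at x)" for k x
    using D by (rule differentiableI)
  ultimately have "partials js (\<lambda>x::real^'n. \<Prod>i\<in>UNIV. u i (x $ i)) differentiable (at x)" for js x
    by metis
  moreover have "{x::real^'n. (\<Prod>i\<in>UNIV. u i (x $ i)) \<noteq> 0} \<subseteq> cbox a b"
  proof
    fix x :: "real ^ 'n"
    assume "x \<in> {x. (\<Prod>i\<in>UNIV. u i (x $ i)) \<noteq> 0}"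
    then have "u i (x $ i) \<noteq> 0" for i
      by simp
    from supp[OF this] show "x \<in> cbox a b"
      by (simp add: mem_box_cart)
  qed
  then have "bounded {x::real^'n. (\<Prod>i\<in>UNIV. u i (x $ i)) \<noteq> 0}"
    using bounded_cbox bounded_subset by blast
  then have "compact (closure {x::real^'n. (\<Prod>i\<in>UNIV. u i (x $ i)) \<noteq> 0})"
    by simp
  ultimately show ?thesis
    unfolding test_function_def by blast
qed

text \<open>
  Integrals over boxes determine a function almost everywhere, so boxes are the right sets to
  approximate. In each coordinate, the product of \<open>flat_exp (k (t - a))\<close> and
  \<open>flat_exp (k (b - t))\<close> vanishes outside the interval \<open>(a, b)\<close> and tends to \<open>1\<close> inside, as \<open>k\<close> grows.
\<close>

lemma box_indicator_limit_of_test_functions: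
  fixes a b :: "real ^ 'n::finite"
  obtains \<phi> :: "nat \<Rightarrow> real ^ 'n \<Rightarrow> real"
  where "\<And>k. test_function (\<phi> k)" "\<And>k x. \<bar>\<phi> k x\<bar> \<le> indicator (box a b) x"
    "\<And>x. (\<lambda>k. \<phi> k x) \<longlonglongrightarrow> indicator (box a b) x"
proof
  define u where "u k i t = flat_exp (real k * t + - (real k * a $ i)) *
      flat_exp (- real k * t + real k * b $ i)" for k i t
  have u0: "u k i t = 0" if "\<not> (a $ i < t \<and> t < b $ i)" for k i t
  proof -
    have "real k * t + - (real k * a $ i) \<le> 0 \<or> - real k * t + real k * b $ i \<le> 0"
      using that mult_left_mono[of t "a $ i" "real k"] mult_left_mono[of "b $ i" t "real k"] by auto
    then show ?thesis by (auto simp: u_def flat_exp_def)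
  qed
  have u1: "0 \<le> u k i t" "u k i t \<le> 1" for k i t
    by (auto simp: u_def flat_exp_def intro!: mult_le_one)
  define \<phi> where "\<phi> k x = (\<Prod>i\<in>UNIV. u k i (x $ i))" for k and x :: "real ^ 'n"
  show "test_function (\<phi> k)" for k
    unfolding \<phi>_def[abs_def]
  proof (rule test_function_prod_coords)
    show "smooth_real (u k i)" for i
      unfolding u_def[abs_def]
      by (intro smooth_real_mult smooth_real_affine smooth_real_flat_exp)
    show "a $ i \<le> t \<and> t \<le> b $ i" if "u k i t \<noteq> 0" for i t
      using u0[of i t k] that by force
  qed
  have out: "\<phi> k x = 0" if "x \<notin> box a b" for k x
    using that u0 unfolding \<phi>_def by (auto simp: mem_box_cart)
  show "\<bar>\<phi> k x\<bar> \<le> indicator (box a b) x" for k x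
  proof (cases "x \<in> box a b")
    case True
    then show ?thesis
      using u1 by (simp add: \<phi>_def abs_prod prod_le_1)
  qed (simp add: out)
  show "(\<lambda>k. \<phi> k x) \<longlonglongrightarrow> indicator (box a b) x" for x
  proof (cases "x \<in> box a b")
    case False
    then show ?thesis by (simp add: out)
  next
    case True
    have "(\<lambda>k. u k i (x $ i)) \<longlonglongrightarrow> 1" for i
    proof -
      have lim: "(\<lambda>k. flat_exp (real k * c)) \<longlonglongrightarrow> 1" if "0 < c" for c
      proof -
        have "(\<lambda>k. exp (- (1 / c * inverse (real k)))) \<longlonglongrightarrow> exp (- (1 / c * 0))"
          by (intro tendsto_intros LIMSEQ_inverse_real_of_nat lim_inverse_n)
        then have "(\<lambda>k. exp (- (1 / c * inverse (real k)))) \<longlonglongrightarrow> 1" by simp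
        then show ?thesis
          by (rule Lim_transform_eventually)
            (use that in \<open>auto intro!: eventually_mono[OF eventually_gt_at_top[of 0]]
              simp: flat_exp_def field_simps\<close>)
      qed
      have "(\<lambda>k. u k i (x $ i)) = (\<lambda>k. flat_exp (real k * (x $ i - a $ i)) *
          flat_exp (real k * (b $ i - x $ i)))"
        by (simp add: u_def algebra_simps)
      moreover have "0 < x $ i - a $ i" "0 < b $ i - x $ i"
        using True by (auto simp: mem_box_cart)
      ultimately show ?thesis
        using tendsto_mult[OF lim lim] by simp
    qed
    then have "(\<lambda>k. \<phi> k x) \<longlonglongrightarrow> (\<Prod>i\<in>(UNIV::'n set). 1)"
      unfolding \<phi>_def by (intro tendsto_prod)
    then show ?thesis using True by simp
  qed
qed

text \<open>
  The densities given by the positive and the negative part of \<open>g\<close> define measures that agree on boxes,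
  hence everywhere.
\<close>

lemma AE_zero_if_box_integrals_zero:
  fixes g :: "'a::euclidean_space \<Rightarrow> real"
  assumes g: "integrable lborel g" and zero: "\<And>a b. (\<integral>x\<in>box a b. g x \<partial>lborel) = 0"
  shows "AE x in lborel. g x = 0"
proof -
  note [measurable] = borel_measurable_integrable[OF g]
  define P where "P x = ennreal (max 0 (g x))" for x
  define N where "N x = ennreal (max 0 (- g x))" for x
  have [measurable]: "P \<in> borel_measurable borel" "N \<in> borel_measurable borel"
    unfolding P_def[abs_def] N_def[abs_def] by measurable
  have fin: "(\<integral>\<^sup>+x\<in>A. P x \<partial>lborel) < \<infinity>" for A
  proof -
    have "(\<integral>\<^sup>+x\<in>A. P x \<partial>lborel) \<le> (\<integral>\<^sup>+x. ennreal (norm (g x)) \<partial>lborel)"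
      by (intro nn_integral_mono) (auto simp: P_def indicator_def intro!: ennreal_leI)
    also have "\<dots> < \<infinity>" using g by (simp add: integrable_iff_bounded)
    finally show ?thesis .
  qed
  have PN: "(\<integral>\<^sup>+x\<in>box a b. P x \<partial>lborel) = (\<integral>\<^sup>+x\<in>box a b. N x \<partial>lborel)" for a b :: 'a
  proof -
    have iP: "integrable lborel (\<lambda>x. max 0 (g x) * indicator (box a b) x)"
      by (rule Bochner_Integration.integrable_bound[OF g]) (auto simp: indicator_def)
    have iN: "integrable lborel (\<lambda>x. max 0 (- g x) * indicator (box a b) x)"
      by (rule Bochner_Integration.integrable_bound[OF g]) (auto simp: indicator_def)
    have "(\<integral>x. max 0 (g x) * indicator (box a b) x \<partial>lborel)
        - (\<integral>x. max 0 (- g x) * indicator (box a b) x \<partial>lborel) = (\<integral>x\<in>box a b. g x \<partial>lborel)"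
      by (subst Bochner_Integration.integral_diff[OF iP iN, symmetric])
        (auto simp: set_lebesgue_integral_def indicator_def intro!: Bochner_Integration.integral_cong)
    then have "(\<integral>x. max 0 (g x) * indicator (box a b) x \<partial>lborel)
        = (\<integral>x. max 0 (- g x) * indicator (box a b) x \<partial>lborel)"
      by (simp add: zero)
    moreover have "(\<integral>\<^sup>+x\<in>box a b. P x \<partial>lborel)
        = ennreal (\<integral>x. max 0 (g x) * indicator (box a b) x \<partial>lborel)"
      by (subst nn_integral_eq_integral[OF iP, symmetric])
        (auto simp: P_def indicator_def intro!: nn_integral_cong)
    moreover have "(\<integral>\<^sup>+x\<in>box a b. N x \<partial>lborel)
        = ennreal (\<integral>x. max 0 (- g x) * indicator (box a b) x \<partial>lborel)"
      by (subst nn_integral_eq_integral[OF iN, symmetric])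
        (auto simp: N_def indicator_def intro!: nn_integral_cong)
    ultimately show ?thesis by simp
  qed
  have "density lborel P = density lborel N"
  proof (rule measure_eqI_generator_eq)
    let ?E = "range (\<lambda>(a, b). box a b::'a set)"
    show "Int_stable ?E"
      by (auto simp: Int_stable_def box_Int_box)
    show "?E \<subseteq> Pow UNIV" "sets (density lborel P) = sigma_sets UNIV ?E"
      "sets (density lborel N) = sigma_sets UNIV ?E"
      by (simp_all add: borel_eq_box)
    let ?A = "\<lambda>n::nat. box (- (real n *\<^sub>R One)) (real n *\<^sub>R One) :: 'a set"
    show "range ?A \<subseteq> ?E" "(\<Union>i. ?A i) = UNIV"
      unfolding UN_box_eq_UNIV by auto
    show "emeasure (density lborel P) X = emeasure (density lborel N) X" if "X \<in> ?E" for X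
      using that PN by (auto simp: emeasure_density)
    show "emeasure (density lborel P) (?A i) \<noteq> \<infinity>" for i
      using fin by (auto simp: emeasure_density less_top[symmetric])
  qed
  then have "AE x in lborel. P x = N x"
    by (subst (asm) sigma_finite_measure.density_unique_iff[OF sigma_finite_lborel]) auto
  then show ?thesis
    by eventually_elim (auto simp: P_def N_def max_def ennreal_eq_0_iff split: if_splits)
qed


text \<open>
  The fundamental lemma of the calculus of variations: bounded approximation of the indicators of boxes
  by test functions gives vanishing integrals over boxes.
\<close>

lemma AE_zero_if_test_integrals_zero:
  fixes g :: "real ^ 'n::finite \<Rightarrow> real"
  assumes g: "locally_integrable g"
    and zero: "\<And>\<phi>. test_function \<phi> \<Longrightarrow> (\<integral>x. g x * \<phi> x \<partial>lebesgue) = 0"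
  shows "AE x in lebesgue. g x = 0"
proof -
  have gi: "integrable lebesgue (\<lambda>x. indicator (box a b) x * g x)" for a b
  proof -
    have "set_integrable lebesgue (cbox a b) g"
      using g by (simp add: locally_integrable_def)
    then have "set_integrable lebesgue (box a b) g"
      by (rule set_integrable_subset) (auto simp: box_subset_cbox)
    then show ?thesis
      by (simp add: set_integrable_def)
  qed
  have box0: "(\<integral>x. indicator (box a b) x * g x \<partial>lebesgue) = 0" for a b
  proof -
    obtain \<phi> where \<phi>: "\<And>k. test_function (\<phi> k)" "\<And>k x. \<bar>\<phi> k x\<bar> \<le> indicator (box a b) x"
      "\<And>x. (\<lambda>k. \<phi> k x) \<longlonglongrightarrow> indicator (box a b) x"
      by (rule box_indicator_limit_of_test_functions[of a b]) blast
    have meas [measurable]: "\<phi> k \<in> borel_measurable lebesgue" for k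
    proof -
      have "\<phi> k differentiable (at x)" for x
        using \<phi>(1)[of k, unfolded test_function_def, THEN conjunct1, THEN spec, of "[]"] by simp
      then have "continuous_on UNIV (\<phi> k)"
        by (simp add: continuous_at_imp_continuous_on differentiable_imp_continuous_within)
      then have "\<phi> k \<in> borel_measurable borel"
        by (rule borel_measurable_continuous_onI)
      then show ?thesis
        by (intro measurable_completion) simp
    qed
    have eq: "g x * \<phi> k x = indicator (box a b) x * g x * \<phi> k x" for k x
      using \<phi>(2)[of k x] by (auto simp: indicator_def split: if_splits)
    have "(\<lambda>k. \<integral>x. g x * \<phi> k x \<partial>lebesgue)
        \<longlonglongrightarrow> (\<integral>x. indicator (box a b) x * g x * indicator (box a b) x \<partial>lebesgue)"
      unfolding eq
    proof (rule integral_dominated_convergence[where w = "\<lambda>x. \<bar>indicator (box a b) x * g x\<bar>"])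
      show "integrable lebesgue (\<lambda>x. \<bar>indicator (box a b) x * g x\<bar>)"
        by (intro integrable_abs gi)
      show "(\<lambda>x. indicator (box a b) x * g x * \<phi> k x) \<in> borel_measurable lebesgue" for k
        by (rule borel_measurable_times[OF borel_measurable_integrable[OF gi] meas])
      show "(\<lambda>x. indicator (box a b) x * g x * indicator (box a b) x) \<in> borel_measurable lebesgue"
        by (rule borel_measurable_times[OF borel_measurable_integrable[OF gi]],
            rule measurable_completion) simp
      show "AE x in lebesgue. (\<lambda>k. indicator (box a b) x * g x * \<phi> k x)
          \<longlonglongrightarrow> indicator (box a b) x * g x * indicator (box a b) x"
        by (intro AE_I2 tendsto_intros \<phi>)
      show "AE x in lebesgue. norm (indicator (box a b) x * g x * \<phi> k x)
          \<le> \<bar>indicator (box a b) x * g x\<bar>" for k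
      proof (rule AE_I2)
        fix x
        have "\<bar>\<phi> k x\<bar> \<le> 1"
          using order_trans[OF \<phi>(2)[of k x] indicator_le_1] .
        then have "\<bar>indicator (box a b) x * g x\<bar> * \<bar>\<phi> k x\<bar> \<le> \<bar>indicator (box a b) x * g x\<bar> * 1"
          by (intro mult_left_mono) auto
        then show "norm (indicator (box a b) x * g x * \<phi> k x) \<le> \<bar>indicator (box a b) x * g x\<bar>"
          by (simp add: abs_mult)
      qed
    qed
    then have "(\<lambda>k. 0) \<longlonglongrightarrow> (\<integral>x. indicator (box a b) x * g x * indicator (box a b) x \<partial>lebesgue)"
      using zero[OF \<phi>(1)] by simp
    then have "(\<integral>x. indicator (box a b) x * g x * indicator (box a b) x \<partial>lebesgue) = 0"
      using LIMSEQ_unique tendsto_const by blast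
    moreover have "(\<integral>x. indicator (box a b) x * g x * indicator (box a b) x \<partial>lebesgue)
        = (\<integral>x. indicator (box a b) x * g x \<partial>lebesgue)"
      by (rule Bochner_Integration.integral_cong) (auto simp: indicator_def)
    ultimately show ?thesis by simp
  qed
  have "AE x in lebesgue. indicator (box a b) x * g x = 0" for a b
  proof -
    obtain h where h: "h \<in> borel_measurable lborel"
        "AE x in lborel. indicator (box a b) x * g x = h x"
      using completion_ex_borel_measurable_real[OF borel_measurable_integrable[OF gi]] by blast
    have h': "AE x in lebesgue. indicator (box a b) x * g x = h x"
      using h(2) by (rule AE_completion)
    have hL: "h \<in> borel_measurable lebesgue"
      using h(1) by (rule measurable_completion)
    have "integrable lebesgue h"
      using integrable_cong_AE_imp[OF gi hL] h' by (simp add: eq_commute)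
    then have hi: "integrable lborel h"
      using integrable_completion[OF h(1)] by simp
    have "AE x in lborel. h x = 0"
    proof (rule AE_zero_if_box_integrals_zero[OF hi])
      fix c d :: "real ^ 'n"
      have m: "(\<lambda>x. indicator (box c d) x * h x) \<in> borel_measurable lborel"
        using h(1) by simp
      obtain c' d' where cd: "box c d \<inter> box a b = box c' d'"
        using box_Int_box by blast
      have "(\<integral>x\<in>box c d. h x \<partial>lborel) = (\<integral>x. indicator (box c d) x * h x \<partial>lebesgue)"
        by (simp add: set_lebesgue_integral_def integral_completion[OF m])
      also have "\<dots> = (\<integral>x. indicator (box c' d') x * g x \<partial>lebesgue)"
      proof (rule integral_cong_AE)
        show "(\<lambda>x. indicator (box c d) x * h x) \<in> borel_measurable lebesgue"
          using m by (rule measurable_completion)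
        show "(\<lambda>x. indicator (box c' d') x * g x) \<in> borel_measurable lebesgue"
          by (rule borel_measurable_integrable[OF gi])
        show "AE x in lebesgue. indicator (box c d) x * h x = indicator (box c' d') x * g x"
          using h' by eventually_elim (auto simp: indicator_def simp flip: cd)
      qed
      finally show "(\<integral>x\<in>box c d. h x \<partial>lborel) = 0"
        by (simp add: box0)
    qed
    then have "AE x in lebesgue. h x = 0"
      by (rule AE_completion)
    with h' show ?thesis
      by eventually_elim auto
  qed
  then have "AE x in lebesgue. \<forall>n. indicator (box (- (real n *\<^sub>R One)) (real n *\<^sub>R One)) x * g x = 0"
    by (subst AE_all_countable) simp
  then show ?thesis
  proof eventually_elim
    case (elim x)
    obtain n where "x \<in> box (- (real n *\<^sub>R One)) (real n *\<^sub>R One)"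
      using UN_box_eq_UNIV by blast
    then show ?case
      using elim[rule_format, of n] by simp
  qed
qed

section \<open>Iterated differences as averages of derivatives\<close>

text \<open>
  This form of Tonelli's criterion suits averages of translates: their sections have a common bound in
  \<open>L\<^sup>1\<close>, although there is no common integrable majorant.
\<close>

lemma integrable_pair_if_sections_bounded:
  fixes F :: "'a \<times> 'b \<Rightarrow> real"
  assumes "prob_space M" "sigma_finite_measure N"
    and F [measurable]: "F \<in> borel_measurable (M \<Otimes>\<^sub>M N)"
    and bound: "AE s in M. (\<integral>\<^sup>+y. ennreal \<bar>F (s, y)\<bar> \<partial>N) \<le> C" and C: "C < \<infinity>"
  shows "integrable (M \<Otimes>\<^sub>M N) F"
proof -
  interpret M: prob_space M by fact
  interpret N: sigma_finite_measure N by fact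
  have "(\<integral>\<^sup>+z. ennreal (norm (F z)) \<partial>(M \<Otimes>\<^sub>M N)) = (\<integral>\<^sup>+s. \<integral>\<^sup>+y. ennreal \<bar>F (s, y)\<bar> \<partial>N \<partial>M)"
    by (subst N.nn_integral_fst[symmetric]) simp_all
  also have "\<dots> \<le> (\<integral>\<^sup>+s. C \<partial>M)"
    using bound by (rule nn_integral_mono_AE)
  also have "\<dots> < \<infinity>"
    using C by (simp add: M.emeasure_space_1)
  finally show ?thesis
    by (simp add: integrable_iff_bounded)
qed

text \<open>
  The \<open>m\<close>-th forward difference with step \<open>1\<close>. The evaluation points run downwards from \<open>t + m\<close>, in the
  order in which \<^const>\<open>R_diff\<close> lists them. Differences with step \<open>h\<close> at \<open>y\<close> are obtained by applying it
  to \<open>s \<mapsto> f(y + s h)\<close> at \<open>0\<close>.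
\<close>

definition forward_diff :: "nat \<Rightarrow> (real \<Rightarrow> real) \<Rightarrow> real \<Rightarrow> real" where
  "forward_diff m u t = (\<Sum>j=0..m. (-1) ^ j * real (m choose j) * u (t + (real m - real j)))"

text \<open>
  Pascal's rule.
\<close>

lemma forward_diff_Suc: "forward_diff (Suc m) u t = forward_diff m u (t + 1) - forward_diff m u t"
proof -
  have "forward_diff (Suc m) u t = (\<Sum>j\<le>Suc m. (-1) ^ j * real (m choose j) * u (t + (1 + real m - real j)))
      + (\<Sum>j\<le>Suc m. (-1) ^ j * real (if j = 0 then 0 else m choose (j - 1)) * u (t + (1 + real m - real j)))"
    unfolding forward_diff_def atLeast0AtMost sum.distrib[symmetric]
  proof (rule sum.cong)
    fix j assume "j \<in> {..Suc m}"
    then show "(-1) ^ j * real (Suc m choose j) * u (t + (real (Suc m) - real j)) =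
        (-1) ^ j * real (m choose j) * u (t + (1 + real m - real j))
        + (-1) ^ j * real (if j = 0 then 0 else m choose (j - 1)) * u (t + (1 + real m - real j))"
      by (cases j) (simp_all add: algebra_simps)
  qed simp
  also have "(\<Sum>j\<le>Suc m. (-1) ^ j * real (m choose j) * u (t + (1 + real m - real j))) = forward_diff m u (t + 1)"
    unfolding forward_diff_def atLeast0AtMost by (simp add: algebra_simps)
  also have "(\<Sum>j\<le>Suc m. (-1) ^ j * real (if j = 0 then 0 else m choose (j - 1)) * u (t + (1 + real m - real j)))
      = - forward_diff m u t"
    unfolding forward_diff_def atLeast0AtMost sum_negf[symmetric]
    by (subst sum.atMost_Suc_shift) simp
  finally show ?thesis by simp
qed

lemma forward_diff_shift: "forward_diff m (\<lambda>t. u (c + t)) t = forward_diff m u (c + t)"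
  by (simp add: forward_diff_def add.assoc)

lemma has_derivative_forward_diff:
  assumes "\<And>t. (u has_real_derivative u' t) (at t)"
  shows "(forward_diff m u has_real_derivative forward_diff m u' t) (at t)"
proof -
  have "((\<lambda>t. u (t + c)) has_real_derivative u' (t + c)) (at t)" for c t
    using DERIV_shift[of u "u' (t + c)" t c] assms by blast
  then show ?thesis
    unfolding forward_diff_def[abs_def] by (intro DERIV_sum DERIV_cmult)
qed

text \<open>
  The law of the sum of \<open>m\<close> independent uniform variables on \<open>[0, 1]\<close> (its density, for \<open>m \<ge> 1\<close>, is a
  B-spline), described by the two properties that matter here.
\<close>

definition average_weight :: "nat \<Rightarrow> real measure \<Rightarrow> bool" where
  "average_weight m \<mu> \<longleftrightarrow> prob_space \<mu> \<and> sets \<mu> = sets borel \<and>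
     (AE s in \<mu>. 0 \<le> s \<and> s \<le> real m) \<and>
     (\<forall>q. (\<forall>k t. (q k has_real_derivative q (Suc k) t) (at t)) \<longrightarrow>
          (\<forall>x. forward_diff m (q 0) x = (\<integral>s. q m (x + s) \<partial>\<mu>)))"

text \<open>
  One more difference is one more integration over \<open>[0, 1]\<close>, by the fundamental theorem of calculus;
  so the weight of order \<open>m + 1\<close> is the convolution of the one of order \<open>m\<close> with the uniform
  distribution.
\<close>

lemma average_weight_exists: "\<exists>\<mu>. average_weight m \<mu>"
proof (induction m)
  case 0
  have "q 0 x = (\<integral>s. q 0 (x + s) \<partial>return borel 0)"
    if q: "\<forall>k t. (q k has_real_derivative q (Suc k) t) (at t)" for q x
  proof -
    have "isCont (q 0) t" for t
      by (rule DERIV_isCont[OF q[rule_format]])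
    then have "continuous_on UNIV (q 0)"
      by (simp add: continuous_at_imp_continuous_on)
    then have "continuous_on UNIV (\<lambda>s. q 0 (x + s))"
      by (rule continuous_on_compose2) (auto intro: continuous_intros)
    then show ?thesis
      by (subst integral_return) (auto intro: borel_measurable_continuous_onI)
  qed
  then have "average_weight 0 (return borel 0)"
    by (auto simp: average_weight_def forward_diff_def prob_space_return AE_return)
  then show ?case by blast
next
  case (Suc m)
  obtain \<mu> where \<mu>: "prob_space \<mu>" "sets \<mu> = sets borel" "AE s in \<mu>. 0 \<le> s \<and> s \<le> real m"
    and av: "\<And>q x. (\<And>k t. (q k has_real_derivative q (Suc k) t) (at t)) \<Longrightarrow>
          forward_diff m (q 0) x = (\<integral>s. q m (x + s) \<partial>\<mu>)"
    using Suc by (auto simp: average_weight_def)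
  interpret \<mu>: prob_space \<mu> by fact
  note [measurable_cong] = \<mu>(2)
  define U where "U = density lborel (\<lambda>t::real. ennreal (indicator {0..1} t))"
  have sU [measurable_cong, simp]: "sets U = sets borel"
    by (simp add: U_def)
  interpret U: prob_space U
    by (rule prob_spaceI) (simp add: U_def emeasure_density ennreal_indicator)
  have AEU: "AE t in U. 0 \<le> t \<and> t \<le> 1"
    unfolding U_def by (subst AE_density) (auto simp: indicator_def)
  interpret P: pair_prob_space U \<mu> ..
  define \<nu> where "\<nu> = distr (U \<Otimes>\<^sub>M \<mu>) borel (\<lambda>(t, s). t + s)"
  have "prob_space \<nu>"
    unfolding \<nu>_def by (rule P.prob_space_distr) measurable
  moreover have "sets \<nu> = sets borel" by (simp add: \<nu>_def)
  moreover have "AE s in \<nu>. 0 \<le> s \<and> s \<le> real (Suc m)"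
  proof -
    have sum_meas: "(\<lambda>z. fst z + snd z) \<in> borel_measurable (U \<Otimes>\<^sub>M \<mu>)"
      by measurable
    have "AE z in U \<Otimes>\<^sub>M \<mu>. fst z + snd z \<in> {0..real (Suc m)}"
    proof (rule P.AE_pair_measure)
      show "{z \<in> space (U \<Otimes>\<^sub>M \<mu>). fst z + snd z \<in> {0..real (Suc m)}} \<in> sets (U \<Otimes>\<^sub>M \<mu>)"
        using measurable_sets[OF sum_meas, of "{0..real (Suc m)}"]
        by (simp add: vimage_def Int_def conj_commute)
      show "AE t in U. AE s in \<mu>. fst (t, s) + snd (t, s) \<in> {0..real (Suc m)}"
        using AEU
      proof eventually_elim
        case (elim t)
        show ?case using \<mu>(3) by eventually_elim (use elim in auto)
      qed
    qed
    then show ?thesis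
      unfolding \<nu>_def by (subst AE_distr_iff) (auto simp: case_prod_beta)
  qed
  moreover have "forward_diff (Suc m) (q 0) x = (\<integral>s. q (Suc m) (x + s) \<partial>\<nu>)"
    if q: "\<And>k t. (q k has_real_derivative q (Suc k) t) (at t)" for q x
  proof -
    have cont: "continuous_on A (q k)" for A k
      using q by (meson DERIV_isCont continuous_at_imp_continuous_on)
    have [measurable]: "q k \<in> borel_measurable borel" for k
      by (rule borel_measurable_continuous_onI[OF cont])
    have "\<exists>B. \<forall>r\<in>{x..x + real (Suc m)}. \<bar>q (Suc m) r\<bar> \<le> B"
      using compact_imp_bounded[OF compact_continuous_image[OF cont compact_Icc],
          of "Suc m" x "x + real (Suc m)"]
      by (auto simp: bounded_iff)
    then obtain B where B: "\<And>r. r \<in> {x..x + real (Suc m)} \<Longrightarrow> \<bar>q (Suc m) r\<bar> \<le> B"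
      by blast
    let ?q = "\<lambda>z. q (Suc m) (x + (fst z + snd z))"
    have int: "integrable (U \<Otimes>\<^sub>M \<mu>) ?q"
    proof (rule integrable_pair_if_sections_bounded[where C = "ennreal B"])
      show "AE t in U. (\<integral>\<^sup>+s. ennreal \<bar>?q (t, s)\<bar> \<partial>\<mu>) \<le> ennreal B"
        using AEU
      proof eventually_elim
        case (elim t)
        have "AE s in \<mu>. ennreal \<bar>?q (t, s)\<bar> \<le> ennreal B"
          using \<mu>(3) by eventually_elim (use elim in \<open>auto intro!: ennreal_leI B\<close>)
        then have "(\<integral>\<^sup>+s. ennreal \<bar>?q (t, s)\<bar> \<partial>\<mu>) \<le> (\<integral>\<^sup>+s. ennreal B \<partial>\<mu>)"
          by (rule nn_integral_mono_AE)
        then show ?case by (simp add: \<mu>.emeasure_space_1)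
      qed
    qed (auto intro: U.prob_space_axioms \<mu>.sigma_finite_measure_axioms)
    have "(\<integral>s. q (Suc m) (x + s) \<partial>\<nu>) = (\<integral>z. ?q z \<partial>(U \<Otimes>\<^sub>M \<mu>))"
      unfolding \<nu>_def by (subst integral_distr) (simp_all add: case_prod_beta)
    also have "\<dots> = (\<integral>t. (\<integral>s. q (Suc m) (x + (t + s)) \<partial>\<mu>) \<partial>U)"
      using P.integral_fst'[OF int] by simp
    also have "\<dots> = (\<integral>t. forward_diff m (q (Suc 0)) (x + t) \<partial>U)"
      by (subst av[of "\<lambda>k. q (Suc k)"]) (auto simp: q add.assoc)
    also have "\<dots> = (\<integral>t. forward_diff m (q (Suc 0)) (x + t) * indicator {0..1} t \<partial>lborel)"
      unfolding U_def by (subst integral_density) (auto simp: forward_diff_def[abs_def] mult.commute)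
    also have "\<dots> = forward_diff m (q 0) (x + 1) - forward_diff m (q 0) (x + 0)"
    proof (rule integral_FTC_Icc_real)
      fix t :: real
      have "((\<lambda>t. forward_diff m (\<lambda>t. q 0 (x + t)) t) has_real_derivative forward_diff m (\<lambda>t. q (Suc 0) (x + t)) t) (at t)"
        by (rule has_derivative_forward_diff) (auto simp: DERIV_shift[symmetric] add.commute q)
      then show "((\<lambda>t. forward_diff m (q 0) (x + t)) has_real_derivative forward_diff m (q (Suc 0)) (x + t)) (at t)"
        by (simp add: forward_diff_shift)
      have "isCont (forward_diff m (q (Suc 0))) r" for r
        by (rule DERIV_isCont[OF has_derivative_forward_diff[OF q]])
      then show "isCont (\<lambda>t. forward_diff m (q (Suc 0)) (x + t)) t"
        by (rule isCont_o2[where g = "forward_diff m (q (Suc 0))" and f = "\<lambda>t. x + t", rotated]) simp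
    qed simp
    finally show ?thesis by (simp add: forward_diff_Suc)
  qed
  ultimately have "average_weight (Suc m) \<nu>"
    by (simp add: average_weight_def)
  then show ?case by blast
qed

text \<open>
  The form of degree \<open>m\<close> in \<open>h\<close> with the family of coefficients \<open>c\<close>. The coefficients are indexed by
  lists, without any symmetry, because weak derivatives for different orders of the same indices are
  chosen independently.
\<close>

definition dir_form :: "nat \<Rightarrow> ('n::finite list \<Rightarrow> real) \<Rightarrow> real ^ 'n \<Rightarrow> real" where
  "dir_form m c h = (\<Sum>js | length js = m. prod_list (map (\<lambda>i. h $ i) js) * c js)"

lemma finite_length_lists [simp]: "finite {js :: 'n::finite list. length js = m}"
  using finite_lists_length_eq[of "UNIV :: 'n set" m] by simp

lemma weak_D_eq_dir_form: "weak_D m f x h = dir_form m (\<lambda>js. weak_partials js f x) h"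
  by (simp add: weak_D_def dir_form_def)

lemma dir_form_0 [simp]: "dir_form 0 c h = c []"
  by (simp add: dir_form_def)

lemma dir_form_Suc:
  "dir_form (Suc m) c h = (\<Sum>i\<in>UNIV. h $ i * dir_form m (\<lambda>js. c (i # js)) h)"
proof -
  have "{js :: 'a list. length js = Suc m} = (\<lambda>(i, js). i # js) ` (UNIV \<times> {js. length js = m})"
    by (auto simp: length_Suc_conv image_iff)
  then have "dir_form (Suc m) c h =
      (\<Sum>(i, js)\<in>UNIV \<times> {js. length js = m}. prod_list (map (\<lambda>i. h $ i) (i # js)) * c (i # js))"
    unfolding dir_form_def by (simp add: sum.reindex inj_on_def case_prod_beta)
  then show ?thesis
    by (simp add: sum.cartesian_product[symmetric] dir_form_def sum_distrib_left mult.assoc)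
qed

lemma prod_list_scale: "prod_list (map (\<lambda>i. (t *\<^sub>R h) $ i) js) = t ^ length js * prod_list (map (\<lambda>i. h $ i) js)"
  for h :: "real ^ 'n::finite"
  by (induction js) simp_all

lemma dir_form_scale: "dir_form m c (t *\<^sub>R h) = t ^ m * dir_form m c h"
  unfolding dir_form_def sum_distrib_left prod_list_scale
  by (rule sum.cong) auto

lemma dir_form_minus: "dir_form m c (- h) = (-1) ^ m * dir_form m c h"
  using dir_form_scale[of m c "-1" h] by simp

lemma abs_prod_list_le: "\<bar>prod_list (map (\<lambda>i. h $ i) js)\<bar> \<le> norm h ^ length js"
  for h :: "real ^ 'n::finite"
  by (induction js) (auto simp: abs_mult intro!: mult_mono component_le_norm_cart)

lemma borel_measurable_dir_form [measurable]:
  assumes "\<And>js. length js = m \<Longrightarrow> (\<lambda>z. c z js) \<in> borel_measurable M" "h \<in> M \<rightarrow>\<^sub>M borel"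
  shows "(\<lambda>z. dir_form m (c z) (h z)) \<in> borel_measurable M"
proof -
  have "(\<lambda>x::real^'n. x $ i) \<in> borel_measurable borel" for i
    by (intro borel_measurable_continuous_onI continuous_intros)
  then have [measurable]: "(\<lambda>z. h z $ i) \<in> borel_measurable M" for i
    by (rule measurable_compose[OF assms(2)])
  have "(\<lambda>z. prod_list (map (\<lambda>i. h z $ i) js)) \<in> borel_measurable M" for js
    by (induction js) simp_all
  then show ?thesis
    unfolding dir_form_def using assms(1)
    by (intro borel_measurable_sum borel_measurable_times) auto
qed

section \<open>Iterated differences of functions with weak derivatives\<close>

lemma test_function_differentiable: "test_function \<phi> \<Longrightarrow> partials js \<phi> differentiable (at x)"
  by (simp add: test_function_def)

lemma partials_zero_outside_support:
  assumes "x \<notin> closure {x. \<phi> x \<noteq> 0}"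
  shows "partials js \<phi> x = 0"
  using assms
proof (induction js arbitrary: x)
  case Nil
  then show ?case using closure_subset[of "{x. \<phi> x \<noteq> 0}"] by auto
next
  case (Cons i js)
  have "((\<lambda>_. 0) has_derivative (\<lambda>_. 0)) (at x)" by simp
  then have "(partials js \<phi> has_derivative (\<lambda>_. 0)) (at x)"
    by (rule has_derivative_transform_within_open[where s = "- closure {x. \<phi> x \<noteq> 0}"])
      (use Cons in auto)
  then show ?case
    by (simp add: partial_eqI)
qed

lemma continuous_partials: "test_function \<phi> \<Longrightarrow> continuous_on A (partials js \<phi>)"
  by (intro continuous_at_imp_continuous_on ballI differentiable_imp_continuous_within
      test_function_differentiable)

lemma borel_measurable_partials: "test_function \<phi> \<Longrightarrow> partials js \<phi> \<in> borel_measurable borel"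
  by (intro borel_measurable_continuous_onI continuous_partials)

text \<open>
  Continuity and compact support, in the form in which they give integrable majorants.
\<close>

lemma partials_bounded:
  assumes \<phi>: "test_function \<phi>"
  obtains C R where "\<And>x. \<bar>partials js \<phi> x\<bar> \<le> C * indicator (cball 0 R) x"
proof -
  let ?S = "closure {x. \<phi> x \<noteq> 0}"
  have S: "compact ?S" using \<phi> by (simp add: test_function_def)
  have "\<exists>C. \<forall>x\<in>?S. \<bar>partials js \<phi> x\<bar> \<le> C"
    using compact_imp_bounded[OF compact_continuous_image[OF continuous_partials[OF \<phi>] S], of js]
    by (auto simp: bounded_iff)
  then obtain C where C: "\<And>x. x \<in> ?S \<Longrightarrow> \<bar>partials js \<phi> x\<bar> \<le> C"
    by blast
  obtain R where R: "?S \<subseteq> cball 0 R"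
    using bounded_subset_ballD[OF compact_imp_bounded[OF S], of 0] ball_subset_cball by blast
  show thesis
  proof (rule that[of "max C 0" R])
    fix x
    show "\<bar>partials js \<phi> x\<bar> \<le> max C 0 * indicator (cball 0 R) x"
    proof (cases "x \<in> ?S")
      case True
      then have "x \<in> cball 0 R" using R by blast
      then show ?thesis using C[OF True] by (simp add: indicator_def)
    next
      case False
      then show ?thesis
        by (simp add: partials_zero_outside_support)
    qed
  qed
qed

lemma partials_translate:
  assumes "test_function \<phi>"
  shows "partials js (\<lambda>x. \<phi> (x + v)) = (\<lambda>x. partials js \<phi> (x + v))"
proof (induction js)
  case (Cons i js)
  have "partial i (\<lambda>x. partials js \<phi> (x + v)) x = partial i (partials js \<phi>) (x + v)" for x
  proof -
    obtain D where D: "(partials js \<phi> has_derivative D) (at (x + v))"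
      using test_function_differentiable[OF assms] by (auto simp: differentiable_def)
    have "((\<lambda>x. x + v) has_derivative (\<lambda>h. h)) (at x)"
      by (auto intro!: derivative_eq_intros)
    from has_derivative_compose[OF this D]
    have "((\<lambda>x. partials js \<phi> (x + v)) has_derivative D) (at x)" .
    then show ?thesis using D by (simp add: partial_eqI)
  qed
  then show ?case using Cons by auto
qed simp

lemma test_function_translate:
  assumes "test_function \<phi>"
  shows "test_function (\<lambda>x. \<phi> (x + v))"
proof -
  have "(\<lambda>x. partials js \<phi> (x + v)) differentiable (at x)" for js x
    by (rule differentiable_compose[of "partials js \<phi>"])
      (use test_function_differentiable[OF assms] in auto)
  moreover have "{x. \<phi> (x + v) \<noteq> 0} = (\<lambda>x. - v + x) ` {x. \<phi> x \<noteq> 0}"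
    by (force simp: image_iff intro: exI[of _ "_ + v"])
  then have "bounded {x. \<phi> (x + v) \<noteq> 0}"
    using assms by (simp only: test_function_def compact_closure bounded_translation)
  ultimately show ?thesis
    by (simp add: test_function_def partials_translate[OF assms])
qed

text \<open>
  The chain rule, read as a recursion: the derivatives of \<open>s \<mapsto> \<phi>(x + s h)\<close> are the forms
  \<open>D\<^sup>k \<phi>(x + s h)(h, \<dots>, h)\<close>.
\<close>

lemma has_derivative_along_line:
  fixes x h :: "real ^ 'n::finite"
  assumes \<phi>: "test_function \<phi>"
  shows "((\<lambda>s. dir_form k (\<lambda>js. partials js \<phi> (x + s *\<^sub>R h)) h) has_real_derivative
      dir_form (Suc k) (\<lambda>js. partials js \<phi> (x + s *\<^sub>R h)) h) (at s)"
proof -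
  have D: "((\<lambda>s. partials js \<phi> (x + s *\<^sub>R h)) has_real_derivative
      (\<Sum>i\<in>UNIV. h $ i * partials (i # js) \<phi> (x + s *\<^sub>R h))) (at s)" for js
  proof -
    obtain D where D: "(partials js \<phi> has_derivative D) (at (x + s *\<^sub>R h))"
      using test_function_differentiable[OF \<phi>] by (auto simp: differentiable_def)
    then have lin: "linear D" by (rule has_derivative_linear)
    have "D h = D (\<Sum>i\<in>UNIV. h $ i *\<^sub>R axis i 1)"
      using basis_expansion[of h] by (simp add: scalar_mult_eq_scaleR)
    also have "\<dots> = (\<Sum>i\<in>UNIV. h $ i * D (axis i 1))"
      by (simp add: linear_sum[OF lin] linear_scale[OF lin])
    finally have Dh: "D h = (\<Sum>i\<in>UNIV. h $ i * partials (i # js) \<phi> (x + s *\<^sub>R h))"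
      by (simp add: partial_eqI[OF D])
    have "((\<lambda>s. x + s *\<^sub>R h) has_derivative (\<lambda>t. t *\<^sub>R h)) (at s)"
      by (auto intro!: derivative_eq_intros)
    from has_derivative_compose[OF this D]
    have "((\<lambda>s. partials js \<phi> (x + s *\<^sub>R h)) has_derivative (\<lambda>t. t * D h)) (at s)"
      by (simp add: linear_scale[OF lin])
    then show ?thesis
      unfolding has_field_derivative_def Dh mult_commute_abs .
  qed
  have eq: "dir_form (Suc k) (\<lambda>js. partials js \<phi> (x + s *\<^sub>R h)) h =
      (\<Sum>js | length js = k. prod_list (map (\<lambda>i. h $ i) js) *
         (\<Sum>i\<in>UNIV. h $ i * partials (i # js) \<phi> (x + s *\<^sub>R h)))"
    unfolding dir_form_Suc unfolding dir_form_def sum_distrib_left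
    by (subst sum.swap) (simp add: mult.left_commute)
  show ?thesis
    unfolding eq by (subst dir_form_def) (intro DERIV_sum DERIV_cmult D)
qed

lemma forward_diff_test_function:
  assumes \<mu>: "average_weight m \<mu>" and \<phi>: "test_function \<phi>"
  shows "forward_diff m (\<lambda>s. \<phi> (x + s *\<^sub>R h)) 0 =
    (\<integral>s. dir_form m (\<lambda>js. partials js \<phi> (x + s *\<^sub>R h)) h \<partial>\<mu>)"
proof -
  have "forward_diff m (\<lambda>s. dir_form 0 (\<lambda>js. partials js \<phi> (x + s *\<^sub>R h)) h) 0 =
      (\<integral>s. dir_form m (\<lambda>js. partials js \<phi> (x + (0 + s) *\<^sub>R h)) h \<partial>\<mu>)"
    using \<mu>[unfolded average_weight_def, THEN conjunct2, THEN conjunct2, THEN conjunct2, rule_format,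
        of "\<lambda>k s. dir_form k (\<lambda>js. partials js \<phi> (x + s *\<^sub>R h)) h", OF has_derivative_along_line[OF \<phi>]]
    by simp
  then show ?thesis by simp
qed

lemma nn_integral_translate:
  fixes c :: "'a::euclidean_space"
  assumes "f \<in> borel_measurable borel"
  shows "(\<integral>\<^sup>+x. f (x + c) \<partial>lborel) = (\<integral>\<^sup>+x. f x \<partial>lborel)"
proof -
  have "(\<integral>\<^sup>+x. f x \<partial>lborel) = (\<integral>\<^sup>+x. f x \<partial>distr lborel borel ((+) c))"
    by (simp add: lborel_distr_plus)
  then show ?thesis
    using assms by (simp add: nn_integral_distr add.commute)
qed

lemma integral_translate:
  fixes c :: "'a::euclidean_space" and f :: "'a \<Rightarrow> real"
  assumes "f \<in> borel_measurable borel"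
  shows "(\<integral>x. f (x + c) \<partial>lborel) = (\<integral>x. f x \<partial>lborel)"
proof -
  have "(\<integral>x. f x \<partial>lborel) = (\<integral>x. f x \<partial>distr lborel borel ((+) c))"
    by (simp add: lborel_distr_plus)
  then show ?thesis
    using assms by (simp add: integral_distr add.commute)
qed

lemma cball_borel [measurable]: "cball x r \<in> sets borel"
  by (rule borel_closed) simp

lemma locally_integrable_nn_integral:
  assumes "locally_integrable f" and [measurable]: "f \<in> borel_measurable borel"
  shows "(\<integral>\<^sup>+x. ennreal (indicator (cball 0 R) x * \<bar>f x\<bar>) \<partial>lborel) < \<infinity>"
proof -
  have "integrable lebesgue (\<lambda>x. indicator (cball 0 R) x * f x)"
    using assms(1) unfolding locally_integrable_def set_integrable_def by simp
  then have "integrable lborel (\<lambda>x. indicator (cball 0 R) x * f x)"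
    by (subst (asm) integrable_completion) simp_all
  then show ?thesis
    by (simp add: integrable_iff_bounded abs_mult)
qed

text \<open>
  For \<open>|v| \<le> r\<close> the product lives where \<open>x + v\<close> is in the ball of radius \<open>R + r\<close>, whatever \<open>v\<close> is.
\<close>

lemma shifted_product_bound:
  fixes g :: "real ^ 'n::finite \<Rightarrow> real"
  assumes g: "locally_integrable g" and [measurable]: "g \<in> borel_measurable borel"
    and \<psi>: "\<And>x. \<bar>\<psi> x\<bar> \<le> C * indicator (cball 0 R) x"
  obtains B where "B < \<infinity>"
    "\<And>v. norm v \<le> r \<Longrightarrow> (\<integral>\<^sup>+x. ennreal \<bar>\<psi> x * g (x + v)\<bar> \<partial>lborel) \<le> B"
proof
  let ?k = "\<lambda>x. ennreal \<bar>C\<bar> * ennreal (indicator (cball 0 (R + r)) x * \<bar>g x\<bar>)"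
  let ?I = "\<integral>\<^sup>+x. ennreal (indicator (cball 0 (R + r)) x * \<bar>g x\<bar>) \<partial>lborel"
  show "ennreal \<bar>C\<bar> * ?I < \<infinity>"
    using locally_integrable_nn_integral[OF g] by (simp add: ennreal_mult_less_top)
  fix v :: "real ^ 'n" assume v: "norm v \<le> r"
  have "(\<integral>\<^sup>+x. ennreal \<bar>\<psi> x * g (x + v)\<bar> \<partial>lborel) \<le>
      (\<integral>\<^sup>+x. ?k (x + v) \<partial>lborel)"
  proof (rule nn_integral_mono)
    fix x
    have "\<bar>\<psi> x\<bar> \<le> \<bar>C\<bar> * indicator (cball 0 (R + r)) (x + v)"
    proof (cases "x \<in> cball 0 R")
      case True
      then have "x + v \<in> cball 0 (R + r)"
        using norm_triangle_ineq[of x v] v by simp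
      then show ?thesis using \<psi>[of x] True by (simp add: indicator_def)
    next
      case False
      then show ?thesis using \<psi>[of x] by (simp add: indicator_def)
    qed
    then have "\<bar>\<psi> x * g (x + v)\<bar> \<le> \<bar>C\<bar> * indicator (cball 0 (R + r)) (x + v) * \<bar>g (x + v)\<bar>"
      by (simp add: abs_mult mult_right_mono)
    then show "ennreal \<bar>\<psi> x * g (x + v)\<bar> \<le>
        ?k (x + v)"
      by (simp add: ennreal_mult[symmetric] ennreal_leI mult.assoc)
  qed
  also have "\<dots> = ennreal \<bar>C\<bar> * ?I"
    by (subst nn_integral_translate[where f = ?k])
      (auto simp: nn_integral_cmult)
  finally show "(\<integral>\<^sup>+x. ennreal \<bar>\<psi> x * g (x + v)\<bar> \<partial>lborel) \<le> ennreal \<bar>C\<bar> * ?I" .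
qed

lemma integrable_shifted_product:
  fixes g :: "real ^ 'n::finite \<Rightarrow> real"
  assumes g: "locally_integrable g" and [measurable]: "g \<in> borel_measurable borel"
    and \<psi>: "\<And>x. \<bar>\<psi> x\<bar> \<le> C * indicator (cball 0 R) x"
    and [measurable]: "\<psi> \<in> borel_measurable borel"
  shows "integrable lborel (\<lambda>x. \<psi> x * g (x + v))"
proof -
  obtain B where "B < \<infinity>" "(\<integral>\<^sup>+x. ennreal \<bar>\<psi> x * g (x + v)\<bar> \<partial>lborel) \<le> B"
    using shifted_product_bound[OF g _ \<psi>, of "norm v"] by (metis assms(2) order_refl)
  then show ?thesis
    by (simp add: integrable_iff_bounded le_less_trans)
qed

lemma
  fixes g :: "real ^ 'n::finite \<Rightarrow> real" and h :: "real ^ 'n"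
  assumes \<mu>: "average_weight m \<mu>"
    and g: "locally_integrable g" and gm [measurable]: "g \<in> borel_measurable borel"
    and \<psi>: "\<And>x. \<bar>\<psi> x\<bar> \<le> C * indicator (cball 0 R) x"
    and \<psi>m [measurable]: "\<psi> \<in> borel_measurable borel"
  shows integrable_pair_shift_left:
      "integrable (\<mu> \<Otimes>\<^sub>M lborel) (\<lambda>(s, x). \<psi> x * g (x + s *\<^sub>R h))"
    and integrable_pair_shift_right:
      "integrable (\<mu> \<Otimes>\<^sub>M lborel) (\<lambda>(s, x). \<psi> (x - s *\<^sub>R h) * g x)"
proof -
  have [measurable_cong]: "sets \<mu> = sets borel" and p: "prob_space \<mu>"
    and AE: "AE s in \<mu>. 0 \<le> s \<and> s \<le> real m"
    using \<mu> by (auto simp: average_weight_def)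
  obtain B where B: "B < \<infinity>"
    "\<And>v. norm v \<le> m * norm h \<Longrightarrow> (\<integral>\<^sup>+x. ennreal \<bar>\<psi> x * g (x + v)\<bar> \<partial>lborel) \<le> B"
    by (rule shifted_product_bound[OF g gm \<psi>, of "m * norm h"]) blast
  have bound: "AE s in \<mu>. (\<integral>\<^sup>+x. ennreal \<bar>\<psi> x * g (x + s *\<^sub>R h)\<bar> \<partial>lborel) \<le> B"
    using AE by eventually_elim (auto intro!: B mult_right_mono)
  show "integrable (\<mu> \<Otimes>\<^sub>M lborel) (\<lambda>(s, x). \<psi> x * g (x + s *\<^sub>R h))"
    by (rule integrable_pair_if_sections_bounded[OF p sigma_finite_lborel _ _ B(1)])
      (use bound in simp_all)
  show "integrable (\<mu> \<Otimes>\<^sub>M lborel) (\<lambda>(s, x). \<psi> (x - s *\<^sub>R h) * g x)"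
  proof (rule integrable_pair_if_sections_bounded[OF p sigma_finite_lborel _ _ B(1)])
    have "(\<integral>\<^sup>+x. ennreal \<bar>\<psi> (x - s *\<^sub>R h) * g x\<bar> \<partial>lborel)
        = (\<integral>\<^sup>+x. ennreal \<bar>\<psi> x * g (x + s *\<^sub>R h)\<bar> \<partial>lborel)" for s
      by (subst nn_integral_translate[where c = "s *\<^sub>R h", symmetric]) simp_all
    then show "AE s in \<mu>. (\<integral>\<^sup>+y. ennreal \<bar>case (s, y) of (s, x) \<Rightarrow> \<psi> (x - s *\<^sub>R h) * g x\<bar> \<partial>lborel) \<le> B"
      using bound by simp
  qed simp
qed


text \<open>
  Both sides have the same integral against every test function \<open>\<phi>\<close>. On the right, Fubini's theorem and
  translation move the average to \<open>\<phi>\<close>, the weak derivatives become derivatives of \<open>\<phi>\<close> at the points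
  \<open>x - s h\<close>, and the average of these is the difference of \<open>\<phi>\<close> with step \<open>-h\<close>; the signs
  \<open>(-1)\<^sup>m\<close> from the integration by parts and from \<open>-h\<close> cancel. Translating back
  gives the difference of \<open>f\<close>.
\<close>

lemma forward_diff_eq_average_of_weak_derivatives:
  fixes f :: "real ^ 'n::finite \<Rightarrow> real" and h :: "real ^ 'n"
  assumes \<mu>: "average_weight m \<mu>"
    and f: "locally_integrable f" and fm [measurable]: "f \<in> borel_measurable borel"
    and G: "\<And>js. length js = m \<Longrightarrow> locally_integrable (G js)"
    and Gm: "\<And>js. length js = m \<Longrightarrow> G js \<in> borel_measurable borel"
    and weak: "\<And>js \<phi>. length js = m \<Longrightarrow> test_function \<phi> \<Longrightarrow>
      (\<integral>x. f x * partials js \<phi> x \<partial>lborel) = (-1) ^ m * (\<integral>x. G js x * \<phi> x \<partial>lborel)"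
  shows "AE x in lborel. forward_diff m (\<lambda>s. f (x + s *\<^sub>R h)) 0 =
    (\<integral>s. dir_form m (\<lambda>js. G js (x + s *\<^sub>R h)) h \<partial>\<mu>)"
proof -
  have [measurable_cong]: "sets \<mu> = sets borel" and p: "prob_space \<mu>"
    using \<mu> by (auto simp: average_weight_def)
  interpret \<mu>: prob_space \<mu> by fact
  interpret P: pair_sigma_finite \<mu> lborel ..
  define A where "A x = (\<integral>s. dir_form m (\<lambda>js. G js (x + s *\<^sub>R h)) h \<partial>\<mu>)" for x
  define D where "D x = forward_diff m (\<lambda>s. f (x + s *\<^sub>R h)) 0" for x
  note [measurable] = Gm
  have Am [measurable]: "A \<in> borel_measurable borel"
    unfolding A_def[abs_def] by measurable
  have Dm [measurable]: "D \<in> borel_measurable borel"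
    unfolding D_def[abs_def] forward_diff_def by measurable
  have D_expand: "\<psi> x * D x =
      (\<Sum>j=0..m. (-1) ^ j * real (m choose j) * (\<psi> x * f (x + (real m - real j) *\<^sub>R h)))" for \<psi> x
    unfolding D_def forward_diff_def sum_distrib_left by (rule sum.cong) (auto simp: algebra_simps)
  have expand: "\<psi> x * dir_form m (\<lambda>js. G js (x + s *\<^sub>R h)) h =
      (\<Sum>js | length js = m. prod_list (map (\<lambda>i. h $ i) js) * (\<psi> x * G js (x + s *\<^sub>R h)))" for \<psi> x s
    unfolding dir_form_def sum_distrib_left by (rule sum.cong) auto
  have D_int: "integrable lborel (\<lambda>x. \<psi> x * D x)"
    if "\<And>x. \<bar>\<psi> x\<bar> \<le> C * indicator (cball 0 R) x" "\<psi> \<in> borel_measurable borel" for \<psi> C R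
    unfolding D_expand
    by (intro Bochner_Integration.integrable_sum integrable_mult_right integrable_shifted_product[OF f fm that])
  have A_pair: "integrable (\<mu> \<Otimes>\<^sub>M lborel) (\<lambda>(s, x). \<psi> x * dir_form m (\<lambda>js. G js (x + s *\<^sub>R h)) h)"
    if "\<And>x. \<bar>\<psi> x\<bar> \<le> C * indicator (cball 0 R) x" "\<psi> \<in> borel_measurable borel" for \<psi> C R
  proof -
    have "integrable (\<mu> \<Otimes>\<^sub>M lborel) (\<lambda>z. \<Sum>js | length js = m. prod_list (map (\<lambda>i. h $ i) js) *
        (case z of (s, x) \<Rightarrow> \<psi> x * G js (x + s *\<^sub>R h)))"
      by (intro Bochner_Integration.integrable_sum integrable_mult_right
          integrable_pair_shift_left[OF \<mu> G Gm that]) auto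
    then show ?thesis
      by (simp add: expand case_prod_beta')
  qed
  have A_int: "integrable lborel (\<lambda>x. \<psi> x * A x)"
    and A_integral: "(\<integral>x. \<psi> x * A x \<partial>lborel) =
      (\<integral>s. (\<integral>x. \<psi> x * dir_form m (\<lambda>js. G js (x + s *\<^sub>R h)) h \<partial>lborel) \<partial>\<mu>)"
    if "\<And>x. \<bar>\<psi> x\<bar> \<le> C * indicator (cball 0 R) x" "\<psi> \<in> borel_measurable borel" for \<psi> C R
    using P.integrable_snd[OF A_pair[OF that]] P.Fubini_integral[OF A_pair[OF that]]
    by (simp_all add: A_def)
  have zero: "(\<integral>x. (D x - A x) * \<phi> x \<partial>lborel) = 0" if \<phi>: "test_function \<phi>" for \<phi>
  proof -
    obtain C R where \<phi>b: "\<And>x. \<bar>\<phi> x\<bar> \<le> C * indicator (cball 0 R) x"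
      using partials_bounded[OF \<phi>, of "[]"] by auto
    have \<phi>m [measurable]: "\<phi> \<in> borel_measurable borel"
      using borel_measurable_partials[OF \<phi>, of "[]"] by simp
    note \<phi>pm [measurable] = borel_measurable_partials[OF \<phi>]
    define F where "F s x = f x * dir_form m (\<lambda>js. partials js \<phi> (x - s *\<^sub>R h)) h" for s x
    have F_expand: "F s x = (\<Sum>js | length js = m. prod_list (map (\<lambda>i. h $ i) js) *
        (partials js \<phi> (x - s *\<^sub>R h) * f x))" for s x
      unfolding F_def dir_form_def sum_distrib_left by (rule sum.cong) auto
    have F_int: "integrable (\<mu> \<Otimes>\<^sub>M lborel) (\<lambda>(s, x). F s x)"
    proof -
      have "integrable (\<mu> \<Otimes>\<^sub>M lborel) (\<lambda>(s, x). partials js \<phi> (x - s *\<^sub>R h) * f x)" for js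
        by (rule partials_bounded[OF \<phi>, of js], rule integrable_pair_shift_right[OF \<mu> f fm _ \<phi>pm])
      then have "integrable (\<mu> \<Otimes>\<^sub>M lborel) (\<lambda>z. \<Sum>js | length js = m. prod_list (map (\<lambda>i. h $ i) js) *
          (case z of (s, x) \<Rightarrow> partials js \<phi> (x - s *\<^sub>R h) * f x))"
        by (intro Bochner_Integration.integrable_sum integrable_mult_right)
      then show ?thesis
        by (simp add: F_expand case_prod_beta')
    qed
    have slice: "(\<integral>x. \<phi> x * dir_form m (\<lambda>js. G js (x + s *\<^sub>R h)) h \<partial>lborel)
        = (-1) ^ m * (\<integral>x. F s x \<partial>lborel)" for s
    proof -
      have "(\<integral>x. \<phi> x * G js (x + s *\<^sub>R h) \<partial>lborel)
          = (-1) ^ m * (\<integral>x. partials js \<phi> (x - s *\<^sub>R h) * f x \<partial>lborel)"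
        if js: "length js = m" for js
      proof -
        have [measurable]: "G js \<in> borel_measurable borel" using Gm[OF js] .
        have "(\<integral>x. \<phi> x * G js (x + s *\<^sub>R h) \<partial>lborel) = (\<integral>x. G js x * \<phi> (x + - s *\<^sub>R h) \<partial>lborel)"
          by (subst integral_translate[where c = "s *\<^sub>R h", symmetric]) (simp_all add: mult.commute)
        also have "\<dots> = (-1) ^ m * (\<integral>x. f x * partials js (\<lambda>x. \<phi> (x + - s *\<^sub>R h)) x \<partial>lborel)"
          using weak[OF js test_function_translate[OF \<phi>, of "- s *\<^sub>R h"]]
          by (simp add: power_mult_distrib[symmetric] mult.assoc[symmetric])
        finally show ?thesis
          using partials_translate[OF \<phi>, of js "- s *\<^sub>R h"] by (simp add: mult.commute)
      qed
      moreover have "integrable lborel (\<lambda>x. \<phi> x * G js (x + s *\<^sub>R h))" if "length js = m" for js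
        by (rule integrable_shifted_product[OF G Gm \<phi>b \<phi>m]) (use that in auto)
      moreover have "integrable lborel (\<lambda>x. partials js \<phi> (x - s *\<^sub>R h) * f x)" for js
      proof (rule partials_bounded[OF test_function_translate[OF \<phi>, of "- s *\<^sub>R h"], of js])
        fix C R
        assume "\<And>x. \<bar>partials js (\<lambda>x. \<phi> (x + - s *\<^sub>R h)) x\<bar> \<le> C * indicator (cball 0 R) x"
        then show ?thesis
          using integrable_shifted_product[OF f fm, of "\<lambda>x. partials js \<phi> (x - s *\<^sub>R h)" C R 0]
            partials_translate[OF \<phi>, of js "- s *\<^sub>R h"] by simp
      qed
      ultimately show ?thesis
        by (simp add: expand F_expand Bochner_Integration.integral_sum sum_distrib_left)
          (simp add: mult.left_commute)
    qed
    have "(\<integral>x. \<phi> x * A x \<partial>lborel) = (\<integral>s. (-1) ^ m * (\<integral>x. F s x \<partial>lborel) \<partial>\<mu>)"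
      using A_integral[OF \<phi>b \<phi>m] by (simp add: slice)
    also have "\<dots> = (-1) ^ m * (\<integral>x. (\<integral>s. F s x \<partial>\<mu>) \<partial>lborel)"
      using P.Fubini_integral[OF F_int] by simp
    also have "\<dots> = (\<integral>x. f x * forward_diff m (\<lambda>s. \<phi> (x + s *\<^sub>R (- h))) 0 \<partial>lborel)"
      unfolding F_def forward_diff_test_function[OF \<mu> \<phi>] dir_form_minus
      by (subst Bochner_Integration.integral_mult_right_zero[symmetric]) (simp add: mult.left_commute)
    also have "\<dots> = (\<Sum>j=0..m. (-1) ^ j * real (m choose j) *
        (\<integral>x. f x * \<phi> (x - (real m - real j) *\<^sub>R h) \<partial>lborel))"
    proof -
      have "integrable lborel (\<lambda>x. f x * \<phi> (x - c *\<^sub>R h))" for c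
      proof (rule partials_bounded[OF test_function_translate[OF \<phi>, of "- c *\<^sub>R h"], of "[]"])
        fix C R
        assume "\<And>x. \<bar>partials [] (\<lambda>x. \<phi> (x + - c *\<^sub>R h)) x\<bar> \<le> C * indicator (cball 0 R) x"
        then show ?thesis
          using integrable_shifted_product[OF f fm, of "\<lambda>x. \<phi> (x - c *\<^sub>R h)" C R 0]
          by (simp add: mult.commute)
      qed
      then have "integrable lborel (\<lambda>x. f x * \<phi> (x + t *\<^sub>R - h))" for t
        by simp
      then show ?thesis
        by (simp add: forward_diff_def sum_distrib_left Bochner_Integration.integral_sum
            mult.left_commute[of "f _" "_ * _"])
    qed
    also have "\<dots> = (\<Sum>j=0..m. (-1) ^ j * real (m choose j) *
        (\<integral>x. \<phi> x * f (x + (real m - real j) *\<^sub>R h) \<partial>lborel))"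
    proof -
      have "(\<integral>x. f x * \<phi> (x - c *\<^sub>R h) \<partial>lborel) = (\<integral>x. \<phi> x * f (x + c *\<^sub>R h) \<partial>lborel)" for c
        by (subst integral_translate[where c = "c *\<^sub>R h", symmetric]) (simp_all add: mult.commute)
      then show ?thesis by simp
    qed
    also have "\<dots> = (\<integral>x. \<phi> x * D x \<partial>lborel)"
      unfolding D_expand
      by (subst Bochner_Integration.integral_sum)
        (auto intro!: integrable_shifted_product[OF f fm \<phi>b])
    finally have "(\<integral>x. \<phi> x * D x \<partial>lborel) - (\<integral>x. \<phi> x * A x \<partial>lborel) = 0" by simp
    then show ?thesis
      by (subst (asm) Bochner_Integration.integral_diff[OF D_int[OF \<phi>b \<phi>m] A_int[OF \<phi>b \<phi>m], symmetric])
        (simp add: algebra_simps)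
  qed
  have "AE x in lebesgue. D x - A x = 0"
  proof (rule AE_zero_if_test_integrals_zero)
    show "locally_integrable (\<lambda>x. D x - A x)"
      unfolding locally_integrable_def set_integrable_def
    proof (intro allI impI)
      fix C :: "(real ^ 'n) set" assume C: "compact C"
      obtain R where R: "C \<subseteq> cball 0 R"
        using bounded_subset_ballD[OF compact_imp_bounded[OF C], of 0] ball_subset_cball by blast
      have b: "\<bar>indicator C x :: real\<bar> \<le> 1 * indicator (cball 0 R) x" for x
        using R by (auto simp: indicator_def)
      have [measurable]: "C \<in> sets borel" using C by (simp add: compact_imp_closed)
      have "integrable lborel (\<lambda>x. indicator C x * D x - indicator C x * A x)"
        by (intro Bochner_Integration.integrable_diff D_int[OF b] A_int[OF b]) measurable
      then show "integrable lebesgue (\<lambda>x. indicator C x *\<^sub>R (D x - A x))"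
        by (subst integrable_completion) (auto simp: algebra_simps)
    qed
    show "(\<integral>x. (D x - A x) * \<phi> x \<partial>lebesgue) = 0" if \<phi>: "test_function \<phi>" for \<phi>
    proof -
      have [measurable]: "\<phi> \<in> borel_measurable borel"
        using borel_measurable_partials[OF \<phi>, of "[]"] by simp
      show ?thesis
        using zero[OF \<phi>] by (subst integral_completion) simp_all
    qed
  qed
  then show ?thesis
    by (simp add: AE_completion_iff A_def D_def)
qed

section \<open>Continuity of translations in \<open>L\<^sup>p\<close>\<close>

lemma powr_abs_add_le:
  fixes a b p :: real
  assumes "0 \<le> p"
  shows "\<bar>a + b\<bar> powr p \<le> 2 powr p * (\<bar>a\<bar> powr p + \<bar>b\<bar> powr p)"
proof -
  have "\<bar>a + b\<bar> powr p \<le> (2 * max \<bar>a\<bar> \<bar>b\<bar>) powr p"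
    using assms by (intro powr_mono2) auto
  also have "\<dots> = 2 powr p * max \<bar>a\<bar> \<bar>b\<bar> powr p"
    by (simp add: powr_mult)
  also have "max \<bar>a\<bar> \<bar>b\<bar> powr p \<le> \<bar>a\<bar> powr p + \<bar>b\<bar> powr p"
    by (auto simp: max_def)
  finally show ?thesis by (simp add: mult_left_mono)
qed

text \<open>
  The \<open>p\<close>-th power of the \<open>L\<^sup>p\<close> norm, as an extended real so that it makes sense for every measurable
  function.
\<close>

definition pth_moment :: "real \<Rightarrow> ('a::euclidean_space \<Rightarrow> real) \<Rightarrow> ennreal" where
  "pth_moment p g = (\<integral>\<^sup>+x. ennreal (\<bar>g x\<bar> powr p) \<partial>lborel)"

lemma pth_moment_add_le:
  assumes "0 \<le> p" and [measurable]: "g \<in> borel_measurable borel" "k \<in> borel_measurable borel"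
  shows "pth_moment p (\<lambda>x. g x + k x) \<le> ennreal (2 powr p) * (pth_moment p g + pth_moment p k)"
proof -
  have "pth_moment p (\<lambda>x. g x + k x) \<le>
      (\<integral>\<^sup>+x. ennreal (2 powr p) * (ennreal (\<bar>g x\<bar> powr p) + ennreal (\<bar>k x\<bar> powr p)) \<partial>lborel)"
    unfolding pth_moment_def
    by (intro nn_integral_mono)
      (auto simp: ennreal_plus[symmetric] ennreal_mult[symmetric] simp del: ennreal_plus
        intro!: ennreal_leI powr_abs_add_le assms)
  also have "\<dots> = ennreal (2 powr p) * (pth_moment p g + pth_moment p k)"
    unfolding pth_moment_def by (simp add: nn_integral_cmult nn_integral_add)
  finally show ?thesis .
qed

lemma pth_moment_cmult:
  assumes [measurable]: "g \<in> borel_measurable borel"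
  shows "pth_moment p (\<lambda>x. c * g x) = ennreal (\<bar>c\<bar> powr p) * pth_moment p g"
  unfolding pth_moment_def by (simp add: abs_mult powr_mult ennreal_mult nn_integral_cmult)

lemma pth_moment_translate:
  assumes [measurable]: "g \<in> borel_measurable borel"
  shows "pth_moment p (\<lambda>x. g (x + v)) = pth_moment p g"
  unfolding pth_moment_def
  by (rule nn_integral_translate[where f = "\<lambda>x. ennreal (\<bar>g x\<bar> powr p)"]) simp

definition Lp_continuous_translation :: "real \<Rightarrow> ('a::euclidean_space \<Rightarrow> real) \<Rightarrow> bool" where
  "Lp_continuous_translation p g \<longleftrightarrow>
     ((\<lambda>v. pth_moment p (\<lambda>x. g (x + v) - g x)) \<longlongrightarrow> 0) (nhds 0)"

lemma Lp_continuous_translation_add: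
  assumes "0 \<le> p" and [measurable]: "g \<in> borel_measurable borel" "k \<in> borel_measurable borel"
    and g: "Lp_continuous_translation p g" and k: "Lp_continuous_translation p k"
  shows "Lp_continuous_translation p (\<lambda>x. g x + k x)"
proof -
  have lim: "((\<lambda>v. ennreal (2 powr p) * (pth_moment p (\<lambda>x. g (x + v) - g x)
      + pth_moment p (\<lambda>x. k (x + v) - k x))) \<longlongrightarrow> ennreal (2 powr p) * (0 + 0)) (nhds 0)"
    using g k unfolding Lp_continuous_translation_def
    by (intro ennreal_tendsto_cmult tendsto_add) auto
  have le: "pth_moment p (\<lambda>x. (g (x + v) + k (x + v)) - (g x + k x)) \<le>
      ennreal (2 powr p) * (pth_moment p (\<lambda>x. g (x + v) - g x) + pth_moment p (\<lambda>x. k (x + v) - k x))" for v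
  proof -
    have eq: "(g (x + v) + k (x + v)) - (g x + k x) = (g (x + v) - g x) + (k (x + v) - k x)" for x
      by simp
    show ?thesis
      unfolding eq by (rule pth_moment_add_le[OF assms(1)]; simp)
  qed
  show ?thesis
    unfolding Lp_continuous_translation_def
  proof (rule tendsto_sandwich[OF always_eventually always_eventually tendsto_const])
    show "((\<lambda>v. ennreal (2 powr p) * (pth_moment p (\<lambda>x. g (x + v) - g x)
        + pth_moment p (\<lambda>x. k (x + v) - k x))) \<longlongrightarrow> 0) (nhds 0)"
      using lim by simp
  qed (simp_all add: le)
qed

lemma Lp_continuous_translation_cmult:
  assumes "0 \<le> p" and [measurable]: "g \<in> borel_measurable borel"
    and g: "Lp_continuous_translation p g"
  shows "Lp_continuous_translation p (\<lambda>x. c * g x)"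
proof -
  have "((\<lambda>v. ennreal (\<bar>c\<bar> powr p) * pth_moment p (\<lambda>x. g (x + v) - g x))
      \<longlongrightarrow> ennreal (\<bar>c\<bar> powr p) * 0) (nhds 0)"
    using g unfolding Lp_continuous_translation_def by (intro ennreal_tendsto_cmult) auto
  moreover have "pth_moment p (\<lambda>x. c * g (x + v) - c * g x) =
      ennreal (\<bar>c\<bar> powr p) * pth_moment p (\<lambda>x. g (x + v) - g x)" for v
    by (subst pth_moment_cmult[symmetric]) (simp_all add: right_diff_distrib)
  ultimately show ?thesis
    unfolding Lp_continuous_translation_def by simp
qed

lemma ennreal_pos_real_below:
  fixes a :: ennreal
  assumes "0 < a"
  obtains b :: real where "0 < b" "ennreal b < a"
proof -
  obtain c where c: "0 < c" "c < a"
    using dense[OF assms] by blast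
  then show thesis
    by (cases c rule: ennreal_cases) (auto intro: that)
qed

text \<open>
  Squeeze \<open>A\<close> between a compact set \<open>C\<close> and an open set \<open>T\<close> that differ by little. Small shifts of \<open>C\<close>
  stay in \<open>T\<close>, so where the indicator changes under the shift, one of the two points is in \<open>T - C\<close>.
\<close>

lemma Lp_continuous_translation_indicator:
  fixes A :: "'a::euclidean_space set"
  assumes A: "A \<in> sets borel" and "bounded A"
  shows "Lp_continuous_translation p (indicator A)"
proof -
  have "\<forall>\<^sub>F v in nhds 0. pth_moment p (\<lambda>x. indicator A (x + v) - indicator A x) < a"
    if "0 < a" for a
  proof -
    obtain e where e: "0 < e" "ennreal (4 * e) < a"
    proof -
      obtain b :: real where "0 < b" "ennreal b < a"
        using ennreal_pos_real_below[OF \<open>0 < a\<close>] .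
      then show thesis by (intro that[of "b / 4"]) auto
    qed
    obtain T where T: "open T" "A \<subseteq> T" "emeasure lborel (T - A) < ennreal e"
      using outer_regular_lborel[OF A e(1)] by blast
    obtain V where V: "open V" "- A \<subseteq> V" "emeasure lborel (V - (- A)) < ennreal e"
      using outer_regular_lborel[of "- A", OF _ e(1)] A by (metis borel_comp)
    define C where "C = - V"
    have C: "C \<subseteq> A" "closed C" using V by (auto simp: C_def)
    then have "compact C" using \<open>bounded A\<close> bounded_subset compact_eq_bounded_closed by blast
    then obtain d where d: "0 < d" "(\<Union>x\<in>C. ball x d) \<subseteq> T"
      using compact_subset_open_imp_ball_epsilon_subset[of C T] T C by blast
    have [measurable]: "T \<in> sets borel" "C \<in> sets borel" "A \<in> sets borel"
      using T C A by auto
    have TC: "emeasure lborel (T - C) \<le> ennreal (2 * e)"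
    proof -
      have "emeasure lborel (T - C) \<le> emeasure lborel ((T - A) \<union> (V - (- A)))"
        by (intro emeasure_mono) (use V T A in \<open>auto simp: C_def\<close>)
      also have "\<dots> \<le> emeasure lborel (T - A) + emeasure lborel (V - (- A))"
        using V T A by (intro emeasure_subadditive) auto
      also have "\<dots> \<le> ennreal e + ennreal e"
        using T(3) V(3) by (intro add_mono) auto
      also have "\<dots> = ennreal (2 * e)"
        using e by (simp flip: ennreal_plus)
      finally show ?thesis .
    qed
    have "pth_moment p (\<lambda>x. indicator A (x + v) - indicator A x) < a" if v: "norm v < d" for v
    proof -
      have inT: "y + v \<in> T" "y - v \<in> T" if "y \<in> C" for y
      proof -
        have "y + v \<in> ball y d" "y - v \<in> ball y d"
          using v by (simp_all add: dist_norm)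
        then show "y + v \<in> T" "y - v \<in> T" using that d(2) by blast+
      qed
      have "pth_moment p (\<lambda>x. indicator A (x + v) - indicator A x) \<le>
          (\<integral>\<^sup>+x. indicator (T - C) (x + v) + indicator (T - C) x \<partial>lborel)"
        unfolding pth_moment_def
      proof (rule nn_integral_mono)
        fix x
        show "ennreal (\<bar>indicator A (x + v) - indicator A x :: real\<bar> powr p)
            \<le> indicator (T - C) (x + v) + indicator (T - C) x"
        proof (cases "x \<in> A \<longleftrightarrow> x + v \<in> A")
          case True
          then show ?thesis by (auto simp: indicator_def)
        next
          case False
          have "x \<in> T - C \<or> x + v \<in> T - C"
            using False inT(1)[of x] inT(2)[of "x + v"] T(2) C(1) by auto
          then show ?thesis
            using False by (auto simp: indicator_def)
        qed
      qed
      also have "\<dots> = emeasure lborel (T - C) + emeasure lborel (T - C)"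
        by (subst nn_integral_add)
          (auto simp: nn_integral_translate[of "indicator (T - C)"])
      also have "\<dots> \<le> ennreal (2 * e) + ennreal (2 * e)"
        using TC by (intro add_mono)
      also have "\<dots> = ennreal (4 * e)"
        using e by (simp flip: ennreal_plus)
      finally show ?thesis using e by simp
    qed
    then show ?thesis
      using d(1) by (auto simp: eventually_nhds_metric dist_norm)
  qed
  then show ?thesis
    unfolding Lp_continuous_translation_def by (intro order_tendstoI) auto
qed

lemma Lp_continuous_translation_sum:
  assumes "0 \<le> p" "finite S"
    and "\<And>i. i \<in> S \<Longrightarrow> g i \<in> borel_measurable borel"
    and "\<And>i. i \<in> S \<Longrightarrow> Lp_continuous_translation p (g i)"
  shows "Lp_continuous_translation p (\<lambda>x. \<Sum>i\<in>S. g i x)"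
  using assms(2-)
proof (induction S rule: finite_induct)
  case empty
  show ?case by (simp add: Lp_continuous_translation_def pth_moment_def)
next
  case (insert i S)
  then show ?case
    by (simp add: Lp_continuous_translation_add[OF assms(1)])
qed

lemma Lp_continuous_translation_limit:
  assumes p: "0 \<le> p" and [measurable]: "g \<in> borel_measurable borel" "\<And>i. s i \<in> borel_measurable borel"
    and s: "\<And>i::nat. Lp_continuous_translation p (s i)"
    and lim: "(\<lambda>i. pth_moment p (\<lambda>x. s i x - g x)) \<longlonglongrightarrow> 0"
  shows "Lp_continuous_translation p g"
proof -
  let ?c = "ennreal (2 powr p)"
  have bound: "pth_moment p (\<lambda>x. g (x + v) - g x) \<le> (?c + ?c * ?c) * pth_moment p (\<lambda>x. s i x - g x)
      + ?c * ?c * pth_moment p (\<lambda>x. s i (x + v) - s i x)" for v i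
  proof -
    have neg: "pth_moment p (\<lambda>x. g (x + v) - s i (x + v)) = pth_moment p (\<lambda>x. s i x - g x)"
      by (subst pth_moment_translate[of "\<lambda>x. g x - s i x"])
        (simp_all add: pth_moment_def abs_minus_commute)
    \<comment> \<open>through \<open>s i\<close> at both points: the outer terms are errors of approximation, the middle one a shift of \<open>s i\<close>\<close>
    have "pth_moment p (\<lambda>x. g (x + v) - g x) =
        pth_moment p (\<lambda>x. (g (x + v) - s i (x + v)) + ((s i (x + v) - s i x) + (s i x - g x)))"
      by simp
    also have "\<dots> \<le> ?c * (pth_moment p (\<lambda>x. g (x + v) - s i (x + v)) +
        pth_moment p (\<lambda>x. (s i (x + v) - s i x) + (s i x - g x)))"
      by (rule pth_moment_add_le[OF p]) measurable
    also have "\<dots> \<le> ?c * (pth_moment p (\<lambda>x. s i x - g x) +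
        ?c * (pth_moment p (\<lambda>x. s i (x + v) - s i x) + pth_moment p (\<lambda>x. s i x - g x)))"
      unfolding neg by (intro mult_left_mono add_left_mono pth_moment_add_le[OF p]) auto
    finally show ?thesis by (simp add: algebra_simps)
  qed
  have "\<forall>\<^sub>F v in nhds 0. pth_moment p (\<lambda>x. g (x + v) - g x) < a" if "0 < a" for a
  proof -
    obtain b :: real where b: "0 < b" "ennreal b < a"
      using ennreal_pos_real_below[OF \<open>0 < a\<close>] .
    have "(\<lambda>i. (?c + ?c * ?c) * pth_moment p (\<lambda>x. s i x - g x)) \<longlonglongrightarrow> (?c + ?c * ?c) * 0"
      using lim by (intro ennreal_tendsto_cmult) (auto simp: ennreal_mult_less_top)
    then have "\<forall>\<^sub>F i in sequentially. (?c + ?c * ?c) * pth_moment p (\<lambda>x. s i x - g x) < ennreal (b / 2)"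
      using b by (intro order_tendstoD(2)[where y = 0]) auto
    then obtain i where i: "(?c + ?c * ?c) * pth_moment p (\<lambda>x. s i x - g x) < ennreal (b / 2)"
      by (auto simp: eventually_sequentially)
    have "((\<lambda>v. ?c * ?c * pth_moment p (\<lambda>x. s i (x + v) - s i x)) \<longlongrightarrow> ?c * ?c * 0) (nhds 0)"
      using s[of i] unfolding Lp_continuous_translation_def
      by (intro ennreal_tendsto_cmult) (auto simp: ennreal_mult_less_top)
    then have "\<forall>\<^sub>F v in nhds 0. ?c * ?c * pth_moment p (\<lambda>x. s i (x + v) - s i x) < ennreal (b / 2)"
      using b by (intro order_tendstoD(2)[where y = 0]) auto
    then show ?thesis
    proof eventually_elim
      case (elim v)
      have "pth_moment p (\<lambda>x. g (x + v) - g x) \<le> ennreal (b / 2) + ennreal (b / 2)"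
        using bound[of v i] i elim by (meson add_mono less_imp_le order_trans)
      also have "\<dots> < a" using b by (simp flip: ennreal_plus)
      finally show ?case .
    qed
  qed
  then show ?thesis
    unfolding Lp_continuous_translation_def by (intro order_tendstoI) auto
qed

text \<open>
  Indicators of bounded sets span the bounded simple functions with bounded support, and these approximate
  \<open>g\<close> in \<open>L\<^sup>p\<close>; continuity of translation passes to sums and to limits in \<open>L\<^sup>p\<close>.
\<close>

proposition translation_continuous_in_Lp:
  fixes g :: "'a::euclidean_space \<Rightarrow> real"
  assumes p: "0 < p" and gm [measurable]: "g \<in> borel_measurable borel" and fin: "pth_moment p g < \<infinity>"
  shows "Lp_continuous_translation p g"
proof -
  obtain F where F: "\<And>i. simple_function lborel (F i)" "\<And>x. (\<lambda>i. F i x) \<longlonglongrightarrow> g x"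
    "\<And>i x. dist (F i x) 0 \<le> 2 * dist (g x) 0"
    using borel_measurable_implies_sequence_metric[of g lborel 0] by auto
  \<comment> \<open>The cutoff makes the level sets bounded and keeps the domination by \<open>2 |g|\<close>.\<close>
  define s where "s i x = F i x * indicator (cball 0 (real i)) x" for i x
  have Fm [measurable]: "F i \<in> borel_measurable borel" for i
    using borel_measurable_simple_function[OF F(1)] by simp
  have sm [measurable]: "s i \<in> borel_measurable borel" for i
    unfolding s_def[abs_def] by measurable
  have "Lp_continuous_translation p (s i)" for i
  proof -
    have fin: "finite (range (F i))"
      using simple_functionD(1)[OF F(1)] by simp
    have eq: "s i = (\<lambda>x. \<Sum>y\<in>range (F i). y * indicator (F i -` {y} \<inter> cball 0 (real i)) x)"
    proof
      fix x
      have "(\<Sum>y\<in>range (F i). y * indicator (F i -` {y} \<inter> cball 0 (real i)) x) =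
          (\<Sum>y\<in>range (F i). if y = F i x then F i x * indicator (cball 0 (real i)) x else 0)"
        by (rule sum.cong) (auto simp: indicator_def)
      then show "s i x = (\<Sum>y\<in>range (F i). y * indicator (F i -` {y} \<inter> cball 0 (real i)) x)"
        using fin by (simp add: s_def)
    qed
    have [measurable]: "F i -` {y} \<inter> cball 0 (real i) \<in> sets borel" for y
      using measurable_sets[OF Fm, of "{y}" i] by auto
    show ?thesis
      unfolding eq using p
      by (intro Lp_continuous_translation_sum Lp_continuous_translation_cmult
          Lp_continuous_translation_indicator fin) (auto intro: bounded_subset[OF bounded_cball])
  qed
  moreover have "(\<lambda>i. pth_moment p (\<lambda>x. s i x - g x)) \<longlonglongrightarrow> 0"
  proof -
    have "(\<lambda>i. \<integral>\<^sup>+x. ennreal (\<bar>s i x - g x\<bar> powr p) \<partial>lborel) \<longlonglongrightarrow> (\<integral>\<^sup>+x. 0 \<partial>(lborel :: 'a measure))"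
    proof (rule nn_integral_dominated_convergence[where w = "\<lambda>x. ennreal (3 powr p) * ennreal (\<bar>g x\<bar> powr p)"])
      show "(\<integral>\<^sup>+x. ennreal (3 powr p) * ennreal (\<bar>g x\<bar> powr p) \<partial>lborel) < \<infinity>"
        using fin by (simp add: nn_integral_cmult pth_moment_def ennreal_mult_less_top)
      show "AE x in lborel. ennreal (\<bar>s i x - g x\<bar> powr p) \<le> ennreal (3 powr p) * ennreal (\<bar>g x\<bar> powr p)" for i
      proof (rule AE_I2)
        fix x
        have "\<bar>s i x - g x\<bar> \<le> 3 * \<bar>g x\<bar>"
          using F(3)[of i x] by (auto simp: s_def indicator_def)
        then have "\<bar>s i x - g x\<bar> powr p \<le> (3 * \<bar>g x\<bar>) powr p"
          using p by (intro powr_mono2) auto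
        then show "ennreal (\<bar>s i x - g x\<bar> powr p) \<le> ennreal (3 powr p) * ennreal (\<bar>g x\<bar> powr p)"
          by (simp add: powr_mult ennreal_mult[symmetric] ennreal_leI)
      qed
      show "AE x in lborel. (\<lambda>i. ennreal (\<bar>s i x - g x\<bar> powr p)) \<longlonglongrightarrow> 0"
      proof (rule AE_I2)
        fix x
        have "(\<lambda>i. s i x) \<longlonglongrightarrow> g x"
        proof (rule Lim_transform_eventually[OF F(2)])
          show "\<forall>\<^sub>F i in sequentially. F i x = s i x"
            using eventually_ge_at_top[of "nat \<lceil>norm x\<rceil>"]
            by eventually_elim (auto simp: s_def indicator_def dest: real_nat_ceiling_ge[THEN order_trans])
        qed
        then have "(\<lambda>i. \<bar>s i x - g x\<bar> powr p) \<longlonglongrightarrow> \<bar>g x - g x\<bar> powr p"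
          using p by (intro tendsto_powr' tendsto_intros) (auto intro: always_eventually)
        then have "(\<lambda>i. ennreal (\<bar>s i x - g x\<bar> powr p)) \<longlonglongrightarrow> ennreal 0"
          using p by (intro tendsto_ennrealI) simp
        then show "(\<lambda>i. ennreal (\<bar>s i x - g x\<bar> powr p)) \<longlonglongrightarrow> 0" by simp
      qed
    qed measurable
    then show ?thesis by (simp add: pth_moment_def)
  qed
  ultimately show ?thesis
    using p by (intro Lp_continuous_translation_limit[of p g s]) auto
qed

section \<open>The norm of a convex body and polar coordinates\<close>

text \<open>
  The convex hull of a ball in \<open>K\<close> and of its reflection contains a ball around \<open>0\<close>.
\<close>

lemma symmetric_convex_contains_ball:
  fixes K :: "'a::real_normed_vector set"
  assumes "convex K" "K = uminus ` K" "interior K \<noteq> {}"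
  obtains r where "0 < r" "ball 0 r \<subseteq> K"
proof -
  obtain a where "a \<in> interior K" using assms by blast
  then obtain r where r: "0 < r" "ball a r \<subseteq> K"
    using mem_interior by blast
  have "y \<in> K" if "y \<in> ball 0 r" for y
  proof -
    have "a + y \<in> K" "a - y \<in> K"
      using r(2) that by (auto simp: subset_iff dist_norm)
    then have "- (a - y) \<in> K" using assms(2) by blast
    then have "(1 / 2) *\<^sub>R (a + y) + (1 / 2) *\<^sub>R (- (a - y)) \<in> K"
      using convexD[OF \<open>convex K\<close> \<open>a + y \<in> K\<close>, of "- (a - y)" "1 / 2" "1 / 2"] by simp
    moreover have "(1 / 2) *\<^sub>R (a + y) + (1 / 2) *\<^sub>R (- (a - y)) = y"
    proof -
      have "(a + y) + (- (a - y)) = y + y" by simp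
      then have "(1 / 2) *\<^sub>R ((a + y) + (- (a - y))) = y"
        by (simp only: scaleR_half_double)
      then show ?thesis by (simp only: scaleR_add_right)
    qed
    ultimately show ?thesis by simp
  qed
  then show thesis using that r(1) by blast
qed

lemma norm_divide_less:
  assumes "norm x < r * l" "0 < l"
  shows "norm (x /\<^sub>R l) < r"
proof -
  have "norm (x /\<^sub>R l) = norm x / l"
    using assms(2) by (simp add: divide_inverse)
  then show ?thesis
    using assms by (simp add: pos_divide_less_eq)
qed

context
  fixes K :: "(real ^ 'n::finite) set"
  assumes bK: "bounded K" and cK: "convex K" and sK: "K = uminus ` K" and zK: "0 \<in> K"
    and iK: "interior K \<noteq> {}"
begin

lemma norm_of_body_le: "0 < l \<Longrightarrow> x /\<^sub>R l \<in> K \<Longrightarrow> norm_of_body K x \<le> l"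
  unfolding norm_of_body_def by (rule cInf_lower) (auto intro: bdd_belowI[of _ 0])

lemma body_scalars_nonempty: "\<exists>l. 0 < l \<and> x /\<^sub>R l \<in> K"
proof -
  obtain r where r: "0 < r" "ball 0 r \<subseteq> K"
    using symmetric_convex_contains_ball[OF cK sK iK] .
  \<comment> \<open>Adding 1 keeps the scalar positive for \<open>x = 0\<close>.\<close>
  define l where "l = 2 * (norm x + 1) / r"
  have l: "0 < l" "r * l = 2 * norm x + 2"
    using r(1) by (auto simp: l_def add_nonneg_pos)
  have "norm x < r * l"
    using l(2) norm_ge_zero[of x] by linarith
  then have "norm (x /\<^sub>R l) < r"
    using l(1) by (intro norm_divide_less)
  then have "x /\<^sub>R l \<in> K"
    using r(2) by auto
  then show ?thesis using l(1) by blast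
qed

lemma norm_of_body_nonneg: "0 \<le> norm_of_body K x"
  unfolding norm_of_body_def using body_scalars_nonempty[of x] by (intro cInf_greatest) auto

lemma mem_body_if_norm_of_body_less:
  assumes "norm_of_body K x < l"
  shows "x /\<^sub>R l \<in> K"
proof -
  obtain k where k: "0 < k" "x /\<^sub>R k \<in> K" "k < l"
    using cInf_lessD[of "{l. 0 < l \<and> x /\<^sub>R l \<in> K}" l] body_scalars_nonempty[of x] assms
    by (auto simp: norm_of_body_def)
  have "(k / l) *\<^sub>R (x /\<^sub>R k) + (1 - k / l) *\<^sub>R 0 \<in> K"
    using k by (intro convexD[OF cK] zK) auto
  then show ?thesis using k by (simp add: field_simps)
qed

lemma norm_of_body_scale:
  assumes t: "0 < t"
  shows "norm_of_body K (t *\<^sub>R x) = t * norm_of_body K x"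
proof -
  have le: "norm_of_body K (t *\<^sub>R x) \<le> t * norm_of_body K x" if t: "0 < t" for t x
  proof (rule field_le_epsilon)
    fix e :: real assume e: "0 < e"
    have "norm_of_body K (t *\<^sub>R x) \<le> t * (norm_of_body K x + e / t)"
    proof (rule norm_of_body_le)
      show "0 < t * (norm_of_body K x + e / t)"
        using t e norm_of_body_nonneg[of x] by (simp add: add_nonneg_pos)
      show "(t *\<^sub>R x) /\<^sub>R (t * (norm_of_body K x + e / t)) \<in> K"
      proof -
        have "inverse (t * l) * t = inverse l" for l
          using t by (cases "l = 0") (simp_all add: field_simps)
        then have "(t *\<^sub>R x) /\<^sub>R (t * (norm_of_body K x + e / t)) = x /\<^sub>R (norm_of_body K x + e / t)"
          by (simp only: scaleR_scaleR)
        also have "\<dots> \<in> K"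
          by (rule mem_body_if_norm_of_body_less) (use t e in simp)
        finally show ?thesis .
      qed
    qed
    then show "norm_of_body K (t *\<^sub>R x) \<le> t * norm_of_body K x + e"
      using t by (simp add: algebra_simps)
  qed
  have "norm_of_body K x \<le> 1 / t * norm_of_body K (t *\<^sub>R x)"
    using le[of "1 / t" "t *\<^sub>R x"] t by simp
  then show ?thesis
    using le[OF t, of x] t by (simp add: field_simps)
qed

lemma norm_of_body_triangle: "norm_of_body K (x + y) \<le> norm_of_body K x + norm_of_body K y"
proof (rule field_le_epsilon)
  fix e :: real assume e: "0 < e"
  define a where "a = norm_of_body K x + e / 2"
  define b where "b = norm_of_body K y + e / 2"
  have ab: "0 < a" "0 < b" "x /\<^sub>R a \<in> K" "y /\<^sub>R b \<in> K"
    using e norm_of_body_nonneg[of x] norm_of_body_nonneg[of y]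
      mem_body_if_norm_of_body_less[of x a] mem_body_if_norm_of_body_less[of y b]
    by (auto simp: a_def b_def)
  have "(a / (a + b)) *\<^sub>R (x /\<^sub>R a) + (b / (a + b)) *\<^sub>R (y /\<^sub>R b) \<in> K"
    using ab by (intro convexD[OF cK]) (auto simp: add_divide_distrib[symmetric])
  moreover have "a / (a + b) * inverse a = inverse (a + b)" "b / (a + b) * inverse b = inverse (a + b)"
    using ab by (simp_all add: field_simps)
  ultimately have "(x + y) /\<^sub>R (a + b) \<in> K"
    by (simp only: scaleR_scaleR scaleR_add_right)
  then have "norm_of_body K (x + y) \<le> a + b"
    using ab by (intro norm_of_body_le) auto
  then show "norm_of_body K (x + y) \<le> norm_of_body K x + norm_of_body K y + e"
    by (simp add: a_def b_def)
qed

lemma norm_of_body_minus: "norm_of_body K (- x) = norm_of_body K x"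
proof -
  have "(- x) /\<^sub>R l \<in> K \<longleftrightarrow> x /\<^sub>R l \<in> K" for l
    using sK by (metis (no_types, lifting) image_eqI minus_minus scaleR_minus_right)
  then show ?thesis by (simp add: norm_of_body_def)
qed

lemma norm_le_norm_of_body:
  obtains C where "0 < C" "\<And>x. norm x \<le> C * norm_of_body K x"
proof -
  obtain C where C: "0 < C" "\<And>x. x \<in> K \<Longrightarrow> norm x \<le> C"
    using bK bounded_pos by metis
  have "norm x \<le> C * norm_of_body K x" for x
  proof (rule field_le_epsilon)
    fix e :: real assume e: "0 < e"
    let ?l = "norm_of_body K x + e / C"
    have l: "norm_of_body K x < ?l" "0 < ?l"
      using C(1) e norm_of_body_nonneg[of x] by (auto simp: add_nonneg_pos)
    have "norm (x /\<^sub>R ?l) \<le> C"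
      by (intro C mem_body_if_norm_of_body_less l)
    then have "norm x \<le> C * ?l"
      using l(2) by (simp add: field_simps)
    then show "norm x \<le> C * norm_of_body K x + e"
      using C(1) by (simp add: algebra_simps)
  qed
  then show thesis using that C(1) by blast
qed

lemma continuous_norm_of_body: "continuous_on UNIV (norm_of_body K)"
proof -
  obtain r where r: "0 < r" "ball 0 r \<subseteq> K"
    using symmetric_convex_contains_ball[OF cK sK iK] .
  have bound: "norm_of_body K x \<le> 2 / r * norm x" for x
  proof (rule field_le_epsilon)
    fix e :: real assume e: "0 < e"
    let ?l = "2 / r * norm x + e"
    have l: "0 < ?l" using r(1) e by (simp add: add_nonneg_pos)
    have "r * ?l = 2 * norm x + r * e"
      using r(1) by (simp add: distrib_left)
    moreover have "0 < r * e" using r(1) e by simp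
    ultimately have "norm x < r * ?l"
      using norm_ge_zero[of x] by linarith
    then have "norm (x /\<^sub>R ?l) < r"
      using l by (intro norm_divide_less)
    then have "x /\<^sub>R ?l \<in> K"
      using r(2) by (auto simp: subset_iff)
    then show "norm_of_body K x \<le> ?l"
      using l by (rule norm_of_body_le[rotated])
  qed
  have lip: "\<bar>norm_of_body K x - norm_of_body K y\<bar> \<le> 2 / r * norm (x - y)" for x y
  proof -
    have "norm_of_body K x \<le> norm_of_body K (x - y) + norm_of_body K y"
      using norm_of_body_triangle[of "x - y" y] by simp
    moreover have "norm_of_body K y \<le> norm_of_body K (x - y) + norm_of_body K x"
      using norm_of_body_triangle[of "y - x" x] norm_of_body_minus[of "x - y"] by simp
    ultimately show ?thesis using bound[of "x - y"] by linarith
  qed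
  have "(2 / r)-lipschitz_on UNIV (norm_of_body K)"
    using r(1) lip by (intro lipschitz_onI) (auto simp: dist_norm)
  then show ?thesis
    by (rule lipschitz_on_continuous_on)
qed

lemma borel_measurable_norm_of_body: "norm_of_body K \<in> borel_measurable borel"
  by (rule borel_measurable_continuous_onI[OF continuous_norm_of_body])

lemma norm_of_body_le_1: "x \<in> K \<Longrightarrow> norm_of_body K x \<le> 1"
  using norm_of_body_le[of 1 x] by simp

lemma mem_body_if_norm_of_body_less_1: "norm_of_body K x < 1 \<Longrightarrow> x \<in> K"
  using mem_body_if_norm_of_body_less[of x 1] by simp

end

lemma nn_integral_scale:
  fixes F :: "'a::euclidean_space \<Rightarrow> ennreal"
  assumes [measurable]: "F \<in> borel_measurable borel" and r: "0 < r"
  shows "(\<integral>\<^sup>+x. F x \<partial>lborel) = ennreal (r ^ DIM('a)) * (\<integral>\<^sup>+x. F (r *\<^sub>R x) \<partial>lborel)"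
proof -
  have "(\<integral>\<^sup>+x. F x \<partial>lborel) =
      (\<integral>\<^sup>+x. F x \<partial>density (distr lborel borel (\<lambda>x. 0 + r *\<^sub>R x)) (\<lambda>_. ennreal (\<bar>r\<bar> ^ DIM('a))))"
    using lborel_affine[of r "0 :: 'a"] r by simp
  also have "\<dots> = (\<integral>\<^sup>+x. ennreal (\<bar>r\<bar> ^ DIM('a)) * F x \<partial>distr lborel borel (\<lambda>x. 0 + r *\<^sub>R x))"
    by (subst nn_integral_density) auto
  also have "\<dots> = ennreal (r ^ DIM('a)) * (\<integral>\<^sup>+x. F (r *\<^sub>R x) \<partial>lborel)"
    using r by (subst nn_integral_distr) (auto simp: nn_integral_cmult)
  finally show ?thesis .
qed

text \<open>
  Scaling alone determines the radial distribution. The image of \<open>h dx\<close> under \<open>N\<close> gives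
  \<open>{..r}\<close> the mass \<open>r\<^sup>n c\<close>, by scaling with \<open>r\<close>; the measure with density \<open>c n r\<^sup>n\<^sup>-\<^sup>1\<close> on the positive
  axis gives it the same mass.
\<close>

proposition nn_integral_polar:
  fixes N :: "'a::euclidean_space \<Rightarrow> real" and h :: "'a \<Rightarrow> ennreal" and g :: "real \<Rightarrow> ennreal"
  assumes Nm [measurable]: "N \<in> borel_measurable borel"
    and N0: "\<And>x. 0 \<le> N x" and Npos: "\<And>x. x \<noteq> 0 \<Longrightarrow> 0 < N x"
    and Nhom: "\<And>t x. 0 < t \<Longrightarrow> N (t *\<^sub>R x) = t * N x"
    and hm [measurable]: "h \<in> borel_measurable borel" and hhom: "\<And>t x. 0 < t \<Longrightarrow> h (t *\<^sub>R x) = h x"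
    and c: "c = (\<integral>\<^sup>+x. h x * indicator {..1} (N x) \<partial>lborel)" and fin: "c < \<infinity>"
    and gm [measurable]: "g \<in> borel_measurable borel"
  shows "(\<integral>\<^sup>+x. h x * g (N x) \<partial>lborel) =
    c * ennreal (real DIM('a)) * (\<integral>\<^sup>+r\<in>{0..}. ennreal (r ^ (DIM('a) - 1)) * g r \<partial>lborel)"
proof -
  let ?n = "DIM('a)"
  define w where "w r = c * ennreal (real ?n) * (ennreal (r ^ (?n - 1)) * indicator {0..} r)" for r :: real
  have wm [measurable]: "w \<in> borel_measurable borel"
    unfolding w_def[abs_def] by measurable
  define \<nu>1 where "\<nu>1 = distr (density lborel h) borel N"
  define \<nu>2 where "\<nu>2 = density lborel w"
  have e1: "emeasure \<nu>1 {..r} = (if 0 < r then ennreal (r ^ ?n) * c else 0)" for r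
  proof -
    have "emeasure \<nu>1 {..r} = (\<integral>\<^sup>+x. h x * indicator {..r} (N x) \<partial>lborel)"
      unfolding \<nu>1_def
      by (subst nn_integral_indicator[symmetric], simp, subst nn_integral_distr)
        (simp_all add: nn_integral_density)
    also have "\<dots> = (if 0 < r then ennreal (r ^ ?n) * c else 0)"
    proof (cases "0 < r")
      case True
      have "(\<integral>\<^sup>+x. h x * indicator {..r} (N x) \<partial>lborel) =
          ennreal (r ^ ?n) * (\<integral>\<^sup>+x. h (r *\<^sub>R x) * indicator {..r} (N (r *\<^sub>R x)) \<partial>lborel)"
        by (rule nn_integral_scale[OF _ True]) measurable
      also have "(\<integral>\<^sup>+x. h (r *\<^sub>R x) * indicator {..r} (N (r *\<^sub>R x)) \<partial>lborel) = c"
        unfolding c using True by (intro nn_integral_cong) (simp add: hhom Nhom indicator_def)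
      finally show ?thesis using True by simp
    next
      case False
      have "AE x in lborel. x \<noteq> (0 :: 'a)"
        by (rule AE_lborel_singleton)
      then have "AE x in lborel. h x * indicator {..r} (N x) = 0"
        by eventually_elim (use False Npos in \<open>force simp: indicator_def\<close>)
      then have "(\<integral>\<^sup>+x. h x * indicator {..r} (N x) \<partial>lborel) = (\<integral>\<^sup>+x. 0 \<partial>(lborel :: 'a measure))"
        by (rule nn_integral_cong_AE)
      then show ?thesis using False by simp
    qed
    finally show ?thesis .
  qed
  have e2: "emeasure \<nu>2 {..r} = (if 0 < r then ennreal (r ^ ?n) * c else 0)" for r
  proof -
    have "emeasure \<nu>2 {..r} = (\<integral>\<^sup>+s. c * (ennreal (real ?n * s ^ (?n - 1)) * indicator {0..r} s) \<partial>lborel)"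
      unfolding \<nu>2_def by (subst emeasure_density)
        (auto simp: w_def indicator_def ennreal_mult mult.assoc intro!: nn_integral_cong)
    also have "\<dots> = c * (\<integral>\<^sup>+s. ennreal (real ?n * s ^ (?n - 1)) * indicator {0..r} s \<partial>lborel)"
      by (rule nn_integral_cmult) measurable
    also have "\<dots> = (if 0 < r then ennreal (r ^ ?n) * c else 0)"
    proof (cases "0 < r")
      case True
      have "(\<integral>\<^sup>+s. ennreal (real ?n * s ^ (?n - 1)) * indicator {0..r} s \<partial>lborel) = r ^ ?n - 0 ^ ?n"
        by (rule nn_integral_FTC_Icc) (use True in \<open>auto intro!: derivative_eq_intros\<close>)
      then show ?thesis using True by (simp add: mult.commute zero_power)
    next
      case False
      have "AE s in lborel. s \<noteq> (0 :: real)"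
        by (rule AE_lborel_singleton)
      then have "AE s in lborel. ennreal (real ?n * s ^ (?n - 1)) * indicator {0..r} s = 0"
        by eventually_elim (use False in \<open>auto simp: indicator_def\<close>)
      then have "(\<integral>\<^sup>+s. ennreal (real ?n * s ^ (?n - 1)) * indicator {0..r} s \<partial>lborel) =
          (\<integral>\<^sup>+s. 0 \<partial>(lborel :: real measure))"
        by (rule nn_integral_cong_AE)
      then show ?thesis using False by simp
    qed
    finally show ?thesis .
  qed
  have "\<nu>1 = \<nu>2"
  proof (rule measure_eqI_generator_eq[where E = "range (\<lambda>r::real. {..r})" and \<Omega> = UNIV
        and A = "\<lambda>i. {..real i}"])
    show "Int_stable (range (\<lambda>r::real. {..r}))"
      by (auto simp: Int_stable_def)
    show "emeasure \<nu>1 X = emeasure \<nu>2 X" if "X \<in> range (\<lambda>r::real. {..r})" for X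
      using that by (auto simp: e1 e2)
    show "sets \<nu>1 = sigma_sets UNIV (range (\<lambda>r::real. {..r}))"
      "sets \<nu>2 = sigma_sets UNIV (range (\<lambda>r::real. {..r}))"
      by (simp_all add: \<nu>1_def \<nu>2_def borel_eq_atMost)
    show "(\<Union>i. {..real i}) = UNIV"
      using real_arch_simple by auto
    show "emeasure \<nu>1 {..real i} \<noteq> \<infinity>" for i
      using fin by (auto simp: e1 ennreal_mult_eq_top_iff)
  qed auto
  moreover have "(\<integral>\<^sup>+r. g r \<partial>\<nu>1) = (\<integral>\<^sup>+x. h x * g (N x) \<partial>lborel)"
    unfolding \<nu>1_def by (subst nn_integral_distr) (auto simp: nn_integral_density)
  moreover have "(\<integral>\<^sup>+r. g r \<partial>\<nu>2) =
      c * ennreal (real ?n) * (\<integral>\<^sup>+r\<in>{0..}. ennreal (r ^ (?n - 1)) * g r \<partial>lborel)"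
    unfolding \<nu>2_def
    by (subst nn_integral_density)
      (auto simp: w_def nn_integral_cmult[symmetric] mult_ac intro!: nn_integral_cong)
  ultimately show ?thesis by simp
qed


lemma nn_integral_powr_unit_interval:
  assumes "- 1 < a"
  shows "(\<integral>\<^sup>+r\<in>{0..1}. ennreal (r powr a) \<partial>lborel) = ennreal (1 / (a + 1))"
proof -
  have "((\<lambda>r. r powr a) has_integral (1 powr (a + 1) / (a + 1))) {0..1::real}"
    by (rule has_integral_powr_from_0) (use assms in auto)
  then have "(\<integral>\<^sup>+r. ennreal (indicator {0..1} r * r powr a) \<partial>lborel) = ennreal (1 / (a + 1))"
    by (subst nn_integral_has_integral_lebesgue) auto
  then show ?thesis
    by (simp add: ennreal_mult' ennreal_indicator mult.commute)
qed

lemma radial_unit_ball_finite: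
  fixes N :: "'a::euclidean_space \<Rightarrow> real"
  assumes N0: "\<And>x. 0 \<le> N x" and Nle: "\<And>x. norm x \<le> C * N x"
  shows "(\<integral>\<^sup>+x. indicator {..1} (N x) \<partial>lborel) < \<infinity>"
proof -
  have "(\<integral>\<^sup>+x. indicator {..1} (N x) \<partial>lborel) \<le> (\<integral>\<^sup>+x. indicator (cball (0 :: 'a) \<bar>C\<bar>) x \<partial>lborel)"
  proof (rule nn_integral_mono)
    fix x
    show "indicator {..1} (N x) \<le> (indicator (cball (0 :: 'a) \<bar>C\<bar>) x :: ennreal)"
    proof (cases "N x \<le> 1")
      case True
      have "norm x \<le> \<bar>C\<bar> * 1"
        using Nle[of x] True N0[of x] by (meson abs_ge_self abs_ge_zero mult_mono order_trans)
      then show ?thesis by (simp add: indicator_def)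
    qed (simp add: indicator_def)
  qed
  also have "\<dots> < \<infinity>"
    using emeasure_lborel_cball_finite[of "0 :: 'a" "\<bar>C\<bar>"] by simp
  finally show ?thesis .
qed

text \<open>
  After division by \<open>N\<^sup>q\<close> the function \<open>F\<close> is homogeneous of degree \<open>0\<close>, and the polar formula applies twice:
  to the weight \<open>g\<close>, and to \<open>r\<^sup>q\<close> on \<open>[0, 1]\<close>. The second integral is \<open>1 / (n + q)\<close>, which
  identifies the angular constant in terms of the integral of \<open>F\<close> over the unit ball.
\<close>

proposition nn_integral_homogeneous_radial:
  fixes N :: "'a::euclidean_space \<Rightarrow> real" and F :: "'a \<Rightarrow> ennreal" and g :: "real \<Rightarrow> ennreal"
  assumes Nm [measurable]: "N \<in> borel_measurable borel"
    and N0: "\<And>x. 0 \<le> N x" and Nle: "\<And>x. norm x \<le> C * N x"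
    and Nhom: "\<And>t x. 0 < t \<Longrightarrow> N (t *\<^sub>R x) = t * N x"
    and Fm [measurable]: "F \<in> borel_measurable borel"
    and Fhom: "\<And>t x. 0 < t \<Longrightarrow> F (t *\<^sub>R x) = ennreal (t powr q) * F x"
    and Fle: "\<And>x. F x \<le> B * ennreal (N x powr q)" and B: "B < \<infinity>" and q: "0 < q"
    and gm [measurable]: "g \<in> borel_measurable borel"
  shows "(\<integral>\<^sup>+x. F x * (ennreal (inverse (N x powr q)) * g (N x)) \<partial>lborel) =
    ennreal (real DIM('a) + q) * (\<integral>\<^sup>+x. F x * indicator {..1} (N x) \<partial>lborel) *
    (\<integral>\<^sup>+r\<in>{0..}. ennreal (r ^ (DIM('a) - 1)) * g r \<partial>lborel)"
proof -
  let ?n = "DIM('a)"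
  have Npos: "0 < N x" if "x \<noteq> 0" for x
    using Nle[of x] N0[of x] that by (cases "N x = 0") auto
  define h where "h x = F x * ennreal (inverse (N x powr q))" for x
  have hm [measurable]: "h \<in> borel_measurable borel"
    unfolding h_def[abs_def] by measurable
  have hhom: "h (t *\<^sub>R x) = h x" if t: "0 < t" for t x
  proof -
    have "ennreal (t powr q) * ennreal (inverse (t powr q * N x powr q)) = ennreal (inverse (N x powr q))"
      using t by (simp add: ennreal_mult[symmetric])
    then show ?thesis
      using t by (simp add: h_def Fhom Nhom powr_mult N0) (metis mult.assoc mult.commute)
  qed
  have h_le: "h x \<le> B" for x
  proof -
    have "h x \<le> B * (ennreal (N x powr q) * ennreal (inverse (N x powr q)))"
      using mult_right_mono[OF Fle[of x], of "ennreal (inverse (N x powr q))"]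
      by (simp add: h_def mult.assoc)
    also have "ennreal (N x powr q) * ennreal (inverse (N x powr q)) \<le> 1"
      by (cases "N x = 0") (auto simp: ennreal_mult[symmetric])
    finally show ?thesis by (simp add: mult_left_mono)
  qed
  define c where "c = (\<integral>\<^sup>+x. h x * indicator {..1} (N x) \<partial>lborel)"
  have fin: "c < \<infinity>"
  proof -
    have "c \<le> (\<integral>\<^sup>+x. B * indicator {..1} (N x) \<partial>lborel)"
      unfolding c_def by (intro nn_integral_mono mult_right_mono h_le) auto
    also have "\<dots> = B * (\<integral>\<^sup>+x. indicator {..1} (N x) \<partial>lborel)"
      by (rule nn_integral_cmult) measurable
    also have "\<dots> < \<infinity>"
      using B radial_unit_ball_finite[of N C, OF N0 Nle] by (simp add: ennreal_mult_less_top)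
    finally show ?thesis .
  qed
  have polar: "(\<integral>\<^sup>+x. h x * g (N x) \<partial>lborel) =
      c * ennreal (real ?n) * (\<integral>\<^sup>+r\<in>{0..}. ennreal (r ^ (?n - 1)) * g r \<partial>lborel)"
    if "g \<in> borel_measurable borel" for g
    by (rule nn_integral_polar[OF Nm N0 _ _ hm _ c_def fin that]) (simp_all add: Npos Nhom hhom)
  have "(\<integral>\<^sup>+x. F x * indicator {..1} (N x) \<partial>lborel) =
      (\<integral>\<^sup>+x. h x * (ennreal (N x powr q) * indicator {..1} (N x)) \<partial>lborel)"
  proof (rule nn_integral_cong)
    fix x
    have "F x = h x * ennreal (N x powr q)"
    proof (cases "N x = 0")
      case True
      then show ?thesis using Fle[of x] q by simp
    next
      case False
      then have "ennreal (inverse (N x powr q)) * ennreal (N x powr q) = 1"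
        by (simp add: ennreal_mult[symmetric])
      then show ?thesis by (simp add: h_def mult.assoc)
    qed
    then show "F x * indicator {..1} (N x) = h x * (ennreal (N x powr q) * indicator {..1} (N x))"
      by (simp add: mult.assoc)
  qed
  also have "\<dots> = c * ennreal (real ?n) *
      (\<integral>\<^sup>+r\<in>{0..}. ennreal (r ^ (?n - 1)) * (ennreal (r powr q) * indicator {..1} r) \<partial>lborel)"
    by (rule polar) measurable
  also have "(\<integral>\<^sup>+r\<in>{0..}. ennreal (r ^ (?n - 1)) * (ennreal (r powr q) * indicator {..1} r) \<partial>lborel) =
      (\<integral>\<^sup>+r\<in>{0..1}. ennreal (r powr (real ?n - 1 + q)) \<partial>lborel)"
  proof (rule nn_integral_cong_AE)
    have "AE r in lborel. r \<noteq> (0 :: real)"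
      by (rule AE_lborel_singleton)
    then show "AE r in lborel. ennreal (r ^ (?n - 1)) * (ennreal (r powr q) * indicator {..1} r) * indicator {0..} r
        = ennreal (r powr (real ?n - 1 + q)) * indicator {0..1} r"
    proof eventually_elim
      case (elim r)
      have "1 \<le> ?n" using DIM_positive[where 'a = 'a] by linarith
      then have "r ^ (?n - 1) * r powr q = r powr (real ?n - 1 + q)" if "0 < r"
        using that by (simp add: powr_add powr_realpow[symmetric] of_nat_diff)
      then show ?case
        using elim by (auto simp: indicator_def ennreal_mult[symmetric])
    qed
  qed
  also have "\<dots> = ennreal (1 / (real ?n + q))"
    using q DIM_positive[where 'a = 'a] by (subst nn_integral_powr_unit_interval) auto
  finally have ball: "(\<integral>\<^sup>+x. F x * indicator {..1} (N x) \<partial>lborel) =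
      c * ennreal (real ?n) * ennreal (1 / (real ?n + q))" .
  have "ennreal (real ?n + q) * ennreal (1 / (real ?n + q)) = 1"
    using q by (subst ennreal_mult[symmetric]) (auto simp: add_nonneg_eq_0_iff)
  then have "ennreal (real ?n + q) * (\<integral>\<^sup>+x. F x * indicator {..1} (N x) \<partial>lborel) = c * ennreal (real ?n)"
    unfolding ball by (metis mult.commute mult.left_commute mult_1_right)
  moreover have "(\<integral>\<^sup>+x. F x * (ennreal (inverse (N x powr q)) * g (N x)) \<partial>lborel) =
      c * ennreal (real ?n) * (\<integral>\<^sup>+r\<in>{0..}. ennreal (r ^ (?n - 1)) * g r \<partial>lborel)"
    using polar[OF gm] by (simp add: h_def mult.assoc)
  ultimately show ?thesis by (simp only:)
qed

section \<open>Distance between differences and derivatives in \<open>L\<^sup>p\<close>\<close>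

lemma convex_on_abs_powr:
  fixes p :: real
  assumes p: "1 \<le> p"
  shows "convex_on UNIV (\<lambda>x::real. \<bar>x\<bar> powr p)"
proof (rule convex_onI)
  fix t x y :: real assume t: "0 < t" "t < 1"
  have pos: "((1 - t) * u + t * v) powr p \<le> (1 - t) * u powr p + t * v powr p"
    if "0 \<le> u" "0 \<le> v" for u v
  proof (cases "u = 0 \<or> v = 0")
    case False
    then show ?thesis
      using convex_onD[OF powr_convex[OF p], of t u v] that t by simp
  next
    case True
    have shrink: "a powr p \<le> a" if "0 < a" "a < 1" for a :: real
      using powr_mono'[of 1 p a] p that by simp
    have "((1 - t) * u) powr p \<le> (1 - t) * u powr p" "(t * v) powr p \<le> t * v powr p"
      using shrink[of "1 - t"] shrink[of t] t that by (auto simp: powr_mult intro!: mult_right_mono)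
    then show ?thesis using True p by auto
  qed
  have "\<bar>(1 - t) * x + t * y\<bar> powr p \<le> ((1 - t) * \<bar>x\<bar> + t * \<bar>y\<bar>) powr p"
    using t p by (intro powr_mono2) (auto simp: abs_mult intro: order_trans[OF abs_triangle_ineq])
  also have "\<dots> \<le> (1 - t) * \<bar>x\<bar> powr p + t * \<bar>y\<bar> powr p"
    by (rule pos) auto
  finally show "\<bar>(1 - t) *\<^sub>R x + t *\<^sub>R y\<bar> powr p \<le> (1 - t) * \<bar>x\<bar> powr p + t * \<bar>y\<bar> powr p"
    by simp
qed simp

text \<open>
  Convexity, applied to \<open>x + y = (1 - t) (x / (1 - t)) + t (y / t)\<close>. The constant in front of the
  main term \<open>x\<close> is close to \<open>1\<close> for small \<open>t\<close>.
\<close>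

lemma powr_abs_add_le_weighted:
  fixes p t x y :: real
  assumes p: "1 \<le> p" and t: "0 < t" "t < 1"
  shows "\<bar>x + y\<bar> powr p \<le> (1 - t) powr (1 - p) * \<bar>x\<bar> powr p + t powr (1 - p) * \<bar>y\<bar> powr p"
proof -
  have scale: "s * \<bar>z / s\<bar> powr p = s powr (1 - p) * \<bar>z\<bar> powr p" if "0 < s" for s z :: real
    using that by (simp add: powr_divide powr_diff)
  have "\<bar>x + y\<bar> powr p = \<bar>(1 - t) *\<^sub>R (x / (1 - t)) + t *\<^sub>R (y / t)\<bar> powr p"
    using t by simp
  also have "\<dots> \<le> (1 - t) * \<bar>x / (1 - t)\<bar> powr p + t * \<bar>y / t\<bar> powr p"
    by (rule convex_onD[OF convex_on_abs_powr[OF p]]) (use t in auto)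
  finally show ?thesis using scale[of "1 - t" x] scale[of t y] t by simp
qed

text \<open>
  This plays the role of the triangle inequality in \<open>L\<^sup>p\<close>. Being additive in the \<open>p\<close>-th powers, it can be
  integrated once more against a weight.
\<close>

lemma pth_moment_add_le_weighted:
  assumes "1 < p" "1 < a"
  obtains b where "0 < b"
    "\<And>g k :: 'a::euclidean_space \<Rightarrow> real. g \<in> borel_measurable borel \<Longrightarrow> k \<in> borel_measurable borel \<Longrightarrow>
      pth_moment p (\<lambda>x. g x + k x) \<le> ennreal a * pth_moment p g + ennreal b * pth_moment p k"
proof -
  \<comment> \<open>chosen so that \<open>(1 - t) powr (1 - p) = a\<close>\<close>
  define t where "t = 1 - a powr (- 1 / (p - 1))"
  have "a powr (- 1 / (p - 1)) < a powr 0"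
    using assms by (intro powr_less_mono) (auto simp: divide_neg_pos)
  then have t: "0 < t" "t < 1"
    using assms by (auto simp: t_def)
  have "(1 - t) powr (1 - p) = a powr ((- 1 / (p - 1)) * (1 - p))"
    by (simp add: t_def powr_powr)
  also have "(- 1 / (p - 1)) * (1 - p) = 1"
    using assms by (simp add: field_simps)
  finally have a: "(1 - t) powr (1 - p) = a"
    using assms by simp
  show thesis
  proof (rule that[of "t powr (1 - p)"])
    show "0 < t powr (1 - p)" using t by simp
    fix g k :: "'a \<Rightarrow> real"
    assume [measurable]: "g \<in> borel_measurable borel" "k \<in> borel_measurable borel"
    have "pth_moment p (\<lambda>x. g x + k x) \<le> (\<integral>\<^sup>+x. ennreal a * ennreal (\<bar>g x\<bar> powr p)
        + ennreal (t powr (1 - p)) * ennreal (\<bar>k x\<bar> powr p) \<partial>lborel)"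
      unfolding pth_moment_def
    proof (rule nn_integral_mono)
      fix x
      show "ennreal (\<bar>g x + k x\<bar> powr p) \<le>
          ennreal a * ennreal (\<bar>g x\<bar> powr p) + ennreal (t powr (1 - p)) * ennreal (\<bar>k x\<bar> powr p)"
        using powr_abs_add_le_weighted[of p t "g x" "k x"] assms t
        by (simp add: a ennreal_mult[symmetric] ennreal_plus[symmetric] ennreal_leI del: ennreal_plus)
    qed
    also have "\<dots> = ennreal a * pth_moment p g + ennreal (t powr (1 - p)) * pth_moment p k"
      unfolding pth_moment_def by (simp add: nn_integral_add nn_integral_cmult)
    finally show "pth_moment p (\<lambda>x. g x + k x) \<le>
        ennreal a * pth_moment p g + ennreal (t powr (1 - p)) * pth_moment p k" .
  qed
qed

text \<open>
  If the right-hand side is finite, then \<open>X\<close> is integrable, since \<open>r \<le> 1 + r\<^sup>p\<close>; so Jensen's inequality for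
  convex functions applies exactly when there is something to prove.
\<close>

lemma jensen_abs_powr:
  assumes "prob_space \<mu>" and p: "1 \<le> p" and X [measurable]: "X \<in> borel_measurable \<mu>"
  shows "ennreal (\<bar>(\<integral>s. X s \<partial>\<mu>) - c\<bar> powr p) \<le> (\<integral>\<^sup>+s. ennreal (\<bar>X s - c\<bar> powr p) \<partial>\<mu>)"
proof (cases "(\<integral>\<^sup>+s. ennreal (\<bar>X s - c\<bar> powr p) \<partial>\<mu>) = \<infinity>")
  case False
  interpret prob_space \<mu> by fact
  have int: "integrable \<mu> (\<lambda>s. \<bar>X s - c\<bar> powr p)"
    using False by (simp add: integrable_iff_bounded less_top)
  have "integrable \<mu> (\<lambda>s. X s - c)"
  proof (rule Bochner_Integration.integrable_bound[where f = "\<lambda>s. 1 + \<bar>X s - c\<bar> powr p"])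
    show "integrable \<mu> (\<lambda>s. 1 + \<bar>X s - c\<bar> powr p)"
      using int by simp
    show "AE s in \<mu>. norm (X s - c) \<le> norm (1 + \<bar>X s - c\<bar> powr p)"
    proof (rule AE_I2)
      fix s
      have "r \<le> 1 + r powr p" if "0 \<le> r" for r :: real
      proof (cases "r \<le> 1")
        case True
        then show ?thesis using powr_ge_zero[of r p] by linarith
      next
        case False
        then show ?thesis using powr_mono[of 1 p r] p by simp
      qed
      then show "norm (X s - c) \<le> norm (1 + \<bar>X s - c\<bar> powr p)"
        by simp
    qed
  qed simp
  then have "\<bar>expectation (\<lambda>s. X s - c)\<bar> powr p \<le> expectation (\<lambda>s. \<bar>X s - c\<bar> powr p)"
    by (intro jensens_inequality[where I = UNIV] convex_on_abs_powr p int) auto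
  moreover have "expectation (\<lambda>s. X s - c) = expectation X - c"
  proof -
    have "integrable \<mu> (\<lambda>s. (X s - c) + c)"
      using \<open>integrable \<mu> (\<lambda>s. X s - c)\<close> by (intro Bochner_Integration.integrable_add) auto
    then show ?thesis by (simp add: prob_space)
  qed
  ultimately show ?thesis
    by (subst nn_integral_eq_integral[OF int]) (auto intro: ennreal_leI)
qed simp

lemma dir_form_diff: "dir_form m c h - dir_form m d h = dir_form m (\<lambda>js. c js - d js) h"
  by (simp add: dir_form_def sum_subtractf[symmetric] right_diff_distrib)

text \<open>
  Each of the monomials is at most \<open>|h|\<^sup>m\<close>, and the power of a finite sum is at most the power of the number of
  terms times the power of the largest one.
\<close>

lemma dir_form_powr_le:
  fixes h :: "real ^ 'n::finite"
  assumes p: "0 \<le> p"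
  shows "\<bar>dir_form m c h\<bar> powr p \<le>
    (norm h ^ m * real (card {js :: 'n list. length js = m})) powr p * (\<Sum>js | length js = m. \<bar>c js\<bar> powr p)"
proof -
  let ?J = "{js :: 'n list. length js = m}"
  have ne: "?J \<noteq> {}" using Ex_list_of_length[of m] by auto
  define M where "M = Max ((\<lambda>js. \<bar>c js\<bar>) ` ?J)"
  have M: "\<bar>c js\<bar> \<le> M" if "js \<in> ?J" for js
    unfolding M_def using that by (intro Max_ge) auto
  have "M \<in> (\<lambda>js. \<bar>c js\<bar>) ` ?J"
    unfolding M_def using ne by (intro Max_in) auto
  then obtain js0 where js0: "js0 \<in> ?J" "\<bar>c js0\<bar> = M"
    by blast
  have "\<bar>dir_form m c h\<bar> \<le> (\<Sum>js\<in>?J. norm h ^ m * M)"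
    unfolding dir_form_def
  proof (rule order_trans[OF sum_abs sum_mono])
    fix js assume js: "js \<in> ?J"
    show "\<bar>prod_list (map (\<lambda>i. h $ i) js) * c js\<bar> \<le> norm h ^ m * M"
      unfolding abs_mult using abs_prod_list_le[of h js] M[OF js] js by (intro mult_mono) auto
  qed
  then have "\<bar>dir_form m c h\<bar> \<le> norm h ^ m * real (card ?J) * \<bar>c js0\<bar>"
    by (simp add: js0 mult_ac)
  then have "\<bar>dir_form m c h\<bar> powr p \<le> (norm h ^ m * real (card ?J) * \<bar>c js0\<bar>) powr p"
    using p by (intro powr_mono2) auto
  also have "\<dots> = (norm h ^ m * real (card ?J)) powr p * \<bar>c js0\<bar> powr p"
    by (simp add: powr_mult)
  also have "\<dots> \<le> (norm h ^ m * real (card ?J)) powr p * (\<Sum>js\<in>?J. \<bar>c js\<bar> powr p)"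
    using js0 by (intro mult_left_mono member_le_sum) auto
  finally show ?thesis .
qed

lemma pth_moment_dir_form_le:
  fixes h :: "real ^ 'n::finite"
  assumes p: "0 \<le> p" and G: "\<And>js. length js = m \<Longrightarrow> G js \<in> borel_measurable borel"
  shows "pth_moment p (\<lambda>x. dir_form m (\<lambda>js. G js x) h) \<le>
    ennreal ((norm h ^ m * real (card {js :: 'n list. length js = m})) powr p) *
    (\<Sum>js | length js = m. pth_moment p (G js))"
proof -
  let ?c = "(norm h ^ m * real (card {js :: 'n list. length js = m})) powr p"
  have "pth_moment p (\<lambda>x. dir_form m (\<lambda>js. G js x) h) \<le>
      (\<integral>\<^sup>+x. ennreal ?c * (\<Sum>js | length js = m. ennreal (\<bar>G js x\<bar> powr p)) \<partial>lborel)"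
    unfolding pth_moment_def
    by (intro nn_integral_mono)
      (use dir_form_powr_le[OF p] in \<open>auto simp: ennreal_mult[symmetric] sum_nonneg intro!: ennreal_leI\<close>)
  also have "\<dots> = ennreal ?c * (\<integral>\<^sup>+x. (\<Sum>js | length js = m. ennreal (\<bar>G js x\<bar> powr p)) \<partial>lborel)"
    using G by (intro nn_integral_cmult borel_measurable_sum) auto
  also have "(\<integral>\<^sup>+x. (\<Sum>js | length js = m. ennreal (\<bar>G js x\<bar> powr p)) \<partial>lborel) =
      (\<Sum>js | length js = m. pth_moment p (G js))"
    unfolding pth_moment_def using G by (intro nn_integral_sum) auto
  finally show ?thesis .
qed

text \<open>
  The difference is an average of \<open>D\<^sup>m f(x + s h)(h, \<dots>, h) - D\<^sup>m f(x)(h, \<dots>, h)\<close> over \<open>0 \<le> s \<le> m\<close>; hence the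
  bound \<open>B\<close> is only asked for shifts of length at most \<open>m |h|\<close>.
\<close>

lemma pth_moment_forward_diff_minus_dir_form_le:
  fixes f :: "real ^ 'n::finite \<Rightarrow> real" and h :: "real ^ 'n"
  assumes p: "1 \<le> p"
    and f: "locally_integrable f" "f \<in> borel_measurable borel"
    and G: "\<And>js. length js = m \<Longrightarrow> locally_integrable (G js)"
    and Gm: "\<And>js. length js = m \<Longrightarrow> G js \<in> borel_measurable borel"
    and weak: "\<And>js \<phi>. length js = m \<Longrightarrow> test_function \<phi> \<Longrightarrow>
      (\<integral>x. f x * partials js \<phi> x \<partial>lborel) = (-1) ^ m * (\<integral>x. G js x * \<phi> x \<partial>lborel)"
    and B: "\<And>v. norm v \<le> real m * norm h \<Longrightarrow>
      (\<Sum>js | length js = m. pth_moment p (\<lambda>x. G js (x + v) - G js x)) \<le> B"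
  shows "pth_moment p (\<lambda>x. forward_diff m (\<lambda>s. f (x + s *\<^sub>R h)) 0 - dir_form m (\<lambda>js. G js x) h) \<le>
    ennreal ((norm h ^ m * real (card {js :: 'n list. length js = m})) powr p) * B"
proof -
  let ?c = "(norm h ^ m * real (card {js :: 'n list. length js = m})) powr p"
  obtain \<mu> where \<mu>: "average_weight m \<mu>" using average_weight_exists by blast
  have [measurable_cong]: "sets \<mu> = sets borel" and pr: "prob_space \<mu>"
    and AE: "AE s in \<mu>. 0 \<le> s \<and> s \<le> real m"
    using \<mu> by (auto simp: average_weight_def)
  interpret \<mu>: prob_space \<mu> by fact
  interpret P: pair_sigma_finite \<mu> lborel ..
  note [measurable] = Gm f(2)
  have average: "AE x in lborel. forward_diff m (\<lambda>s. f (x + s *\<^sub>R h)) 0 =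
      (\<integral>s. dir_form m (\<lambda>js. G js (x + s *\<^sub>R h)) h \<partial>\<mu>)"
    by (rule forward_diff_eq_average_of_weak_derivatives[OF \<mu> f]) (simp_all add: G Gm weak)
  have "pth_moment p (\<lambda>x. forward_diff m (\<lambda>s. f (x + s *\<^sub>R h)) 0 - dir_form m (\<lambda>js. G js x) h) \<le>
     (\<integral>\<^sup>+x. (\<integral>\<^sup>+s. ennreal (\<bar>dir_form m (\<lambda>js. G js (x + s *\<^sub>R h) - G js x) h\<bar> powr p) \<partial>\<mu>) \<partial>lborel)"
    unfolding pth_moment_def
  proof (rule nn_integral_mono_AE)
    show "AE x in lborel. ennreal (\<bar>forward_diff m (\<lambda>s. f (x + s *\<^sub>R h)) 0 - dir_form m (\<lambda>js. G js x) h\<bar> powr p)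
      \<le> (\<integral>\<^sup>+s. ennreal (\<bar>dir_form m (\<lambda>js. G js (x + s *\<^sub>R h) - G js x) h\<bar> powr p) \<partial>\<mu>)"
      using average
    proof eventually_elim
      case (elim x)
      have "(\<lambda>s. dir_form m (\<lambda>js. G js (x + s *\<^sub>R h)) h) \<in> borel_measurable \<mu>"
        by measurable
      from jensen_abs_powr[OF pr p this, of "dir_form m (\<lambda>js. G js x) h"]
      show ?case by (simp add: elim dir_form_diff)
    qed
  qed
  also have "\<dots> = (\<integral>\<^sup>+s. pth_moment p (\<lambda>x. dir_form m (\<lambda>js. G js (x + s *\<^sub>R h) - G js x) h) \<partial>\<mu>)"
    unfolding pth_moment_def by (rule P.Fubini') measurable
  also have "\<dots> \<le> (\<integral>\<^sup>+s. ennreal ?c * B \<partial>\<mu>)"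
  proof (rule nn_integral_mono_AE)
    show "AE s in \<mu>. pth_moment p (\<lambda>x. dir_form m (\<lambda>js. G js (x + s *\<^sub>R h) - G js x) h) \<le> ennreal ?c * B"
      using AE
    proof eventually_elim
      case (elim s)
      have "pth_moment p (\<lambda>x. dir_form m (\<lambda>js. G js (x + s *\<^sub>R h) - G js x) h) \<le>
          ennreal ?c * (\<Sum>js | length js = m. pth_moment p (\<lambda>x. G js (x + s *\<^sub>R h) - G js x))"
        by (rule pth_moment_dir_form_le) (use p in auto)
      also have "\<dots> \<le> ennreal ?c * B"
        using elim by (intro mult_left_mono B) (auto intro: mult_right_mono)
      finally show ?case .
    qed
  qed
  also have "\<dots> = ennreal ?c * B"
    by (simp add: \<mu>.emeasure_space_1)
  finally show ?thesis .
qed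

section \<open>Borel representatives of Sobolev functions\<close>

lemma integrable_times_test_function:
  fixes g \<phi> :: "real ^ 'n::finite \<Rightarrow> real"
  assumes g: "locally_integrable g" and \<phi>: "test_function \<phi>"
  shows "integrable lebesgue (\<lambda>x. g x * \<phi> x)"
proof -
  obtain C R where \<phi>b: "\<And>x. \<bar>\<phi> x\<bar> \<le> C * indicator (cball 0 R) x"
    using partials_bounded[OF \<phi>, of "[]"] by auto
  have \<phi>m: "\<phi> \<in> borel_measurable lebesgue"
    using borel_measurable_partials[OF \<phi>, of "[]"] by (intro measurable_completion) simp
  have gi: "integrable lebesgue (\<lambda>x. indicator (cball 0 R) x * g x)"
    using g unfolding locally_integrable_def set_integrable_def by simp
  have eq: "g x * \<phi> x = indicator (cball 0 R) x * g x * \<phi> x" for x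
    using \<phi>b[of x] by (cases "x \<in> cball 0 R") (auto simp: indicator_def)
  show ?thesis
    unfolding eq
  proof (rule Bochner_Integration.integrable_bound[where f = "\<lambda>x. C * (indicator (cball 0 R) x * g x)"])
    show "integrable lebesgue (\<lambda>x. C * (indicator (cball 0 R) x * g x))"
      using gi by (rule integrable_mult_right)
    show "(\<lambda>x. indicator (cball 0 R) x * g x * \<phi> x) \<in> borel_measurable lebesgue"
      by (rule borel_measurable_times[OF borel_measurable_integrable[OF gi] \<phi>m])
    show "AE x in lebesgue. norm (indicator (cball 0 R) x * g x * \<phi> x) \<le> norm (C * (indicator (cball 0 R) x * g x))"
    proof (rule AE_I2)
      fix x :: "real ^ 'n"
      have "C * indicator (cball 0 R) x \<le> \<bar>C\<bar>"
        by (auto simp: indicator_def)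
      then have "\<bar>\<phi> x\<bar> \<le> \<bar>C\<bar>"
        using \<phi>b[of x] by linarith
      then show "norm (indicator (cball 0 R) x * g x * \<phi> x) \<le> norm (C * (indicator (cball 0 R) x * g x))"
        by (simp add: abs_mult mult_right_mono mult_left_mono mult.commute)
    qed
  qed
qed

lemma has_weak_partials_unique:
  fixes f g k :: "real ^ 'n::finite \<Rightarrow> real"
  assumes g: "has_weak_partials js f g" and k: "has_weak_partials js f k"
  shows "AE x in lebesgue. g x = k x"
proof -
  have "AE x in lebesgue. g x - k x = 0"
  proof (rule AE_zero_if_test_integrals_zero)
    have "set_integrable lebesgue C (\<lambda>x. g x - k x)" if "compact C" for C
      using g k that by (intro set_integral_diff) (auto simp: has_weak_partials_def locally_integrable_def)
    then show "locally_integrable (\<lambda>x. g x - k x)"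
      by (simp add: locally_integrable_def)
    fix \<phi> :: "real ^ 'n \<Rightarrow> real" assume \<phi>: "test_function \<phi>"
    have "(-1) ^ length js * (\<integral>x. g x * \<phi> x \<partial>lebesgue) = (-1) ^ length js * (\<integral>x. k x * \<phi> x \<partial>lebesgue)"
      using g k \<phi> unfolding has_weak_partials_def by metis
    then have "(\<integral>x. g x * \<phi> x \<partial>lebesgue) = (\<integral>x. k x * \<phi> x \<partial>lebesgue)"
      by simp
    moreover have "integrable lebesgue (\<lambda>x. g x * \<phi> x)" "integrable lebesgue (\<lambda>x. k x * \<phi> x)"
      using g k \<phi> by (auto simp: has_weak_partials_def intro: integrable_times_test_function)
    ultimately show "(\<integral>x. (g x - k x) * \<phi> x \<partial>lebesgue) = 0"
      by (simp add: left_diff_distrib)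
  qed
  then show ?thesis by simp
qed

lemma locally_integrable_cong_AE:
  fixes f f0 :: "real ^ 'n::finite \<Rightarrow> real"
  assumes "locally_integrable f" "f0 \<in> borel_measurable borel" "AE x in lebesgue. f x = f0 x"
  shows "locally_integrable f0"
  unfolding locally_integrable_def set_integrable_def
proof (intro allI impI)
  fix C :: "(real ^ 'n) set" assume C: "compact C"
  have "C \<in> sets borel" using C by (simp add: compact_imp_closed)
  then have "(\<lambda>x. indicator C x *\<^sub>R f0 x) \<in> borel_measurable lebesgue"
    using assms(2) by (intro measurable_completion) simp
  moreover have "integrable lebesgue (\<lambda>x. indicator C x *\<^sub>R f x)"
    using assms(1) C by (simp add: locally_integrable_def set_integrable_def)
  moreover have "AE x in lebesgue. indicator C x *\<^sub>R f x = indicator C x *\<^sub>R f0 x"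
    using assms(3) by eventually_elim simp
  ultimately show "integrable lebesgue (\<lambda>x. indicator C x *\<^sub>R f0 x)"
    using integrable_cong_AE_imp by (metis (no_types, lifting) eventually_mono)
qed

text \<open>
  The weak derivative that \<^const>\<open>weak_partials\<close> picks is not known to be in \<open>L\<^sup>p\<close>; it is almost everywhere
  equal to one that is, by uniqueness.
\<close>

lemma Sobolev_borel_representatives:
  fixes f :: "real ^ 'n::finite \<Rightarrow> real"
  assumes f: "f \<in> Sobolev m p"
  obtains f0 G where "f0 \<in> borel_measurable borel" "locally_integrable f0" "AE x in lborel. f x = f0 x"
    "\<And>js. length js = m \<Longrightarrow> G js \<in> borel_measurable borel"
    "\<And>js. length js = m \<Longrightarrow> locally_integrable (G js)"
    "\<And>js. length js = m \<Longrightarrow> pth_moment p (G js) < \<infinity>"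
    "\<And>js. length js = m \<Longrightarrow> AE x in lborel. weak_partials js f x = G js x"
    "\<And>js \<phi>. length js = m \<Longrightarrow> test_function \<phi> \<Longrightarrow>
      (\<integral>x. f0 x * partials js \<phi> x \<partial>lborel) = (-1) ^ m * (\<integral>x. G js x * \<phi> x \<partial>lborel)"
proof -
  have fL: "f \<in> borel_measurable lebesgue"
    using f by (simp add: Sobolev_def Lp_def)
  obtain f0 where f0: "f0 \<in> borel_measurable lborel" "AE x in lborel. f x = f0 x"
    using completion_ex_borel_measurable_real[OF fL] by blast
  have f0L: "AE x in lebesgue. f x = f0 x"
    using f0(2) by (rule AE_completion)
  have "locally_integrable f"
    using f by (auto simp: Sobolev_def has_weak_partials_def dest!: spec[of _ "[]"])
  then have lf0: "locally_integrable f0"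
    using f0(1) f0L by (intro locally_integrable_cong_AE[of f f0]) auto
  define rep where "rep js G \<longleftrightarrow> G \<in> borel_measurable borel \<and> locally_integrable G \<and>
      pth_moment p G < \<infinity> \<and> (AE x in lborel. weak_partials js f x = G x) \<and>
      (\<forall>\<phi>. test_function \<phi> \<longrightarrow>
        (\<integral>x. f0 x * partials js \<phi> x \<partial>lborel) = (-1) ^ m * (\<integral>x. G x * \<phi> x \<partial>lborel))" for js G
  have "\<exists>G. rep js G"
    if js: "length js = m" for js
  proof -
    obtain g where g: "g \<in> Lp p" "has_weak_partials js f g"
      using f js by (auto simp: Sobolev_def)
    have gL: "g \<in> borel_measurable lebesgue"
      using g(1) by (simp add: Lp_def)
    obtain G where G: "G \<in> borel_measurable lborel" "AE x in lborel. g x = G x"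
      using completion_ex_borel_measurable_real[OF gL] by blast
    have GL: "AE x in lebesgue. g x = G x"
      using G(2) by (rule AE_completion)
    have [measurable]: "G \<in> borel_measurable borel" "f0 \<in> borel_measurable borel"
      using G(1) f0(1) by auto
    have "locally_integrable G"
      using g(2) GL G(1) by (intro locally_integrable_cong_AE[of g G]) (auto simp: has_weak_partials_def)
    moreover have "pth_moment p G < \<infinity>"
    proof -
      have "pth_moment p G = (\<integral>\<^sup>+x. ennreal (\<bar>g x\<bar> powr p) \<partial>lebesgue)"
        unfolding pth_moment_def nn_integral_completion
        using G(2) by (intro nn_integral_cong_AE) (auto elim!: eventually_mono)
      also have "\<dots> < \<infinity>"
        using g(1) by (simp add: Lp_def integrable_iff_bounded)
      finally show ?thesis .
    qed
    moreover have "AE x in lborel. weak_partials js f x = G x"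
    proof -
      have "has_weak_partials js f (weak_partials js f)"
        unfolding weak_partials_def by (rule someI[of "has_weak_partials js f", OF g(2)])
      then have "AE x in lebesgue. weak_partials js f x = g x"
        using g(2) by (rule has_weak_partials_unique)
      then have "AE x in lborel. weak_partials js f x = g x"
        by (simp add: AE_completion_iff)
      then show ?thesis
        using G(2) by eventually_elim simp
    qed
    moreover have "(\<integral>x. f0 x * partials js \<phi> x \<partial>lborel) = (-1) ^ m * (\<integral>x. G x * \<phi> x \<partial>lborel)"
      if \<phi>: "test_function \<phi>" for \<phi>
    proof -
      note [measurable] = borel_measurable_partials[OF \<phi>]
      have [measurable]: "\<phi> \<in> borel_measurable borel"
        using borel_measurable_partials[OF \<phi>, of "[]"] by simp
      have transfer: "(\<integral>x. u0 x * \<psi> x \<partial>lborel) = (\<integral>x. u x * \<psi> x \<partial>lebesgue)"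
        if "u \<in> borel_measurable lebesgue" "u0 \<in> borel_measurable borel" "\<psi> \<in> borel_measurable borel"
          "AE x in lebesgue. u x = u0 x" for u u0 \<psi> :: "real ^ 'n \<Rightarrow> real"
      proof -
        have m: "(\<lambda>x. u0 x * \<psi> x) \<in> borel_measurable lborel"
          using that by simp
        have \<psi>L: "\<psi> \<in> borel_measurable lebesgue"
          using that(3) by (intro measurable_completion) simp
        have "(\<integral>x. u0 x * \<psi> x \<partial>lborel) = (\<integral>x. u0 x * \<psi> x \<partial>lebesgue)"
          by (rule integral_completion[OF m, symmetric])
        also have "\<dots> = (\<integral>x. u x * \<psi> x \<partial>lebesgue)"
        proof (rule integral_cong_AE)
          show "(\<lambda>x. u0 x * \<psi> x) \<in> borel_measurable lebesgue"
            using m by (rule measurable_completion)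
          show "(\<lambda>x. u x * \<psi> x) \<in> borel_measurable lebesgue"
            by (rule borel_measurable_times[OF that(1) \<psi>L])
          show "AE x in lebesgue. u0 x * \<psi> x = u x * \<psi> x"
            using that(4) by eventually_elim simp
        qed
        finally show ?thesis .
      qed
      show ?thesis
        using g(2) \<phi> js transfer[OF fL _ _ f0L, of "partials js \<phi>"] transfer[OF gL _ _ GL, of \<phi>]
        by (simp add: has_weak_partials_def)
    qed
    ultimately show ?thesis
      unfolding rep_def by (intro exI[of _ G] conjI allI impI \<open>G \<in> borel_measurable borel\<close>)
  qed
  then have "\<exists>G. \<forall>js. length js = m \<longrightarrow> rep js (G js)"
    by (intro choice) blast
  then show thesis
    using that[of f0] f0 lf0 unfolding rep_def by auto
qed

section \<open>The double integral in terms of the increment\<close>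

lemma AE_lborel_affine:
  fixes t :: "'a::euclidean_space"
  assumes c: "c \<noteq> 0" and P: "AE x in lborel. P x"
  shows "AE x in lborel. P (t + c *\<^sub>R x)"
proof -
  obtain Z where Z: "Z \<in> null_sets lborel" "{x. \<not> P x} \<subseteq> Z"
    using P by (auto elim!: AE_E simp: null_sets_def)
  have [measurable]: "Z \<in> sets borel" using Z(1) by auto
  have "AE y in lborel. y \<notin> Z"
    using Z(1) by (rule AE_not_in)
  then have "AE y in density (distr lborel borel (\<lambda>x. t + c *\<^sub>R x)) (\<lambda>_. ennreal (\<bar>c\<bar> ^ DIM('a))). y \<notin> Z"
    by (simp only: lborel_affine[OF c, of t, symmetric])
  then have "AE y in distr lborel borel (\<lambda>x. t + c *\<^sub>R x). y \<notin> Z"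
    using c by (subst (asm) AE_density) auto
  then have "AE x in lborel. t + c *\<^sub>R x \<notin> Z"
    by (subst (asm) AE_distr_iff) auto
  then show ?thesis
    by eventually_elim (use Z(2) in blast)
qed

lemma nn_integral_radial:
  fixes N :: "'a::euclidean_space \<Rightarrow> real"
  assumes Nm: "N \<in> borel_measurable borel"
    and N0: "\<And>x. 0 \<le> N x" and Nle: "\<And>x. norm x \<le> C * N x"
    and Nhom: "\<And>t x. 0 < t \<Longrightarrow> N (t *\<^sub>R x) = t * N x"
  obtains \<kappa> where "\<kappa> < \<infinity>" "\<And>g. g \<in> borel_measurable borel \<Longrightarrow>
    (\<integral>\<^sup>+x. g (N x) \<partial>lborel) = \<kappa> * (\<integral>\<^sup>+r\<in>{0..}. ennreal (r ^ (DIM('a) - 1)) * g r \<partial>lborel)"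
proof -
  have Npos: "0 < N x" if "x \<noteq> 0" for x
    using Nle[of x] N0[of x] that by (cases "N x = 0") auto
  define c where "c = (\<integral>\<^sup>+x. 1 * indicator {..1} (N x) \<partial>lborel)"
  have fin: "c < \<infinity>"
    using radial_unit_ball_finite[of N C, OF N0 Nle] by (simp add: c_def)
  show thesis
  proof (rule that[of "c * ennreal (real DIM('a))"])
    show "c * ennreal (real DIM('a)) < \<infinity>"
      using fin by (simp add: ennreal_mult_less_top of_nat_less_top)
    show "(\<integral>\<^sup>+x. g (N x) \<partial>lborel) =
        c * ennreal (real DIM('a)) * (\<integral>\<^sup>+r\<in>{0..}. ennreal (r ^ (DIM('a) - 1)) * g r \<partial>lborel)"
      if "g \<in> borel_measurable borel" for g
      using nn_integral_polar[OF Nm N0 _ _ _ _ c_def fin that] by (simp add: Npos Nhom)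
  qed
qed

text \<open>
  Spheres of radii in a null set form a null set, by the polar formula.
\<close>

lemma AE_radial:
  fixes N :: "'a::euclidean_space \<Rightarrow> real"
  assumes Nm [measurable]: "N \<in> borel_measurable borel"
    and N0: "\<And>x. 0 \<le> N x" and Nle: "\<And>x. norm x \<le> C * N x"
    and Nhom: "\<And>t x. 0 < t \<Longrightarrow> N (t *\<^sub>R x) = t * N x"
    and P: "AE r in lborel. 0 \<le> r \<longrightarrow> P r"
  shows "AE x in lborel. P (N x)"
proof -
  obtain Z where Z: "Z \<in> null_sets lborel" "{r. \<not> (0 \<le> r \<longrightarrow> P r)} \<subseteq> Z"
    using P by (auto elim!: AE_E simp: null_sets_def)
  have [measurable]: "Z \<in> sets borel" using Z(1) by auto
  obtain \<kappa> where \<kappa>: "\<And>g. g \<in> borel_measurable borel \<Longrightarrow>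
    (\<integral>\<^sup>+x. g (N x) \<partial>lborel) = \<kappa> * (\<integral>\<^sup>+r\<in>{0..}. ennreal (r ^ (DIM('a) - 1)) * g r \<partial>lborel)"
    using nn_integral_radial[of N C, OF Nm N0 Nle Nhom] by metis
  have "(\<integral>\<^sup>+r\<in>{0..}. ennreal (r ^ (DIM('a) - 1)) * indicator Z r \<partial>lborel) = (\<integral>\<^sup>+r. 0 \<partial>(lborel :: real measure))"
  proof (rule nn_integral_cong_AE)
    show "AE r in lborel. ennreal (r ^ (DIM('a) - 1)) * indicator Z r * indicator {0..} r = 0"
      using AE_not_in[OF Z(1)] by eventually_elim simp
  qed
  then have "(\<integral>\<^sup>+x. indicator Z (N x) \<partial>lborel) = 0"
    by (subst \<kappa>) auto
  then have "AE x in lborel. indicator Z (N x) = (0 :: ennreal)"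
    by (subst (asm) nn_integral_0_iff_AE) auto
  then show ?thesis
    by eventually_elim (use Z(2) N0 in \<open>auto simp: indicator_eq_0_iff\<close>)
qed

lemma R_diff_eq_forward_diff:
  assumes "1 \<le> m"
  shows "R_diff m f x y = forward_diff m (\<lambda>s. f (y + s *\<^sub>R ((1 / real m) *\<^sub>R (x - y)))) 0"
proof -
  have "((real m - real j) / real m) *\<^sub>R x + (real j / real m) *\<^sub>R y =
      y + (0 + (real m - real j)) *\<^sub>R ((1 / real m) *\<^sub>R (x - y))" for j
  proof -
    have split: "real j / real m = 1 - (real m - real j) / real m"
      using assms by (simp add: diff_divide_distrib)
    have "a *\<^sub>R x + (1 - a) *\<^sub>R y = y + a *\<^sub>R (x - y)" for a
      by (simp add: algebra_simps)
    then show ?thesis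
      unfolding split by simp
  qed
  then show ?thesis
    unfolding R_diff_def forward_diff_def by simp
qed

text \<open>
  For \<open>j < m\<close> the evaluation point is a non-constant affine function of \<open>x\<close>; for \<open>j = m\<close> it is \<open>y\<close>, which
  is why equality at \<open>y\<close> is assumed.
\<close>

lemma R_diff_cong_AE:
  fixes f :: "real ^ 'n::finite \<Rightarrow> real"
  assumes "1 \<le> m" and eq: "AE x in lborel. f x = f0 x" and y: "f y = f0 y"
  shows "AE x in lborel. R_diff m f x y = R_diff m f0 x y"
proof -
  let ?z = "\<lambda>j x. ((real m - real j) / real m) *\<^sub>R x + (real j / real m) *\<^sub>R y"
  have "AE x in lborel. \<forall>j\<in>{0..m}.
      f (?z j x) =
      f0 (?z j x)"
  proof (rule AE_finite_allI)
    fix j assume j: "j \<in> {0..m}"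
    show "AE x in lborel. f (?z j x) =
      f0 (?z j x)"
    proof (cases "j = m")
      case True
      then show ?thesis using y assms(1) by simp
    next
      case False
      then have "(real m - real j) / real m \<noteq> 0"
        using j assms(1) by auto
      from AE_lborel_affine[OF this eq, of "(real j / real m) *\<^sub>R y"]
      show ?thesis by (simp add: add.commute)
    qed
  qed simp
  then show ?thesis
    by eventually_elim (auto simp: R_diff_def intro!: sum.cong)
qed

text \<open>
  The substitution \<open>w = x - y\<close> and Tonelli's theorem, after replacing \<open>f\<close> and the kernel by Borel
  functions.
\<close>

lemma nn_integral_R_diff_radial:
  fixes f f0 :: "real ^ 'n::finite \<Rightarrow> real" and N :: "real ^ 'n \<Rightarrow> real"
  assumes m: "1 \<le> m"
    and Nm [measurable]: "N \<in> borel_measurable borel"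
    and N0: "\<And>x. 0 \<le> N x" and Nle: "\<And>x. norm x \<le> C * N x"
    and Nhom: "\<And>t x. 0 < t \<Longrightarrow> N (t *\<^sub>R x) = t * N x"
    and f0 [measurable]: "f0 \<in> borel_measurable borel" and ff0: "AE x in lborel. f x = f0 x"
    and k0 [measurable]: "k0 \<in> borel_measurable borel" and kpos: "\<And>r. 0 \<le> k0 r"
    and kk0: "AE r in lborel. 0 \<le> r \<longrightarrow> k r = k0 r"
  shows "(\<integral>\<^sup>+y. (\<integral>\<^sup>+x. ennreal (\<bar>R_diff m f x y\<bar> powr p / N (x - y) powr q * k (N (x - y))) \<partial>lebesgue) \<partial>lebesgue)
    = (\<integral>\<^sup>+w. pth_moment p (\<lambda>y. forward_diff m (\<lambda>s. f0 (y + s *\<^sub>R ((1 / real m) *\<^sub>R w))) 0) *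
        (ennreal (inverse (N w powr q)) * ennreal (k0 (N w))) \<partial>lborel)" (is "?lhs = ?rhs")
proof -
  define \<Phi> where "\<Phi> y w = ennreal (\<bar>forward_diff m (\<lambda>s. f0 (y + s *\<^sub>R ((1 / real m) *\<^sub>R w))) 0\<bar> powr p) *
      (ennreal (inverse (N w powr q)) * ennreal (k0 (N w)))" for y w
  have \<Phi>m [measurable]: "(\<lambda>(y, w). \<Phi> y w) \<in> borel_measurable (borel \<Otimes>\<^sub>M borel)"
    unfolding \<Phi>_def forward_diff_def by measurable
  have kN: "AE x in lborel. k (N x) = k0 (N x)"
    by (rule AE_radial[of N C, OF Nm N0 Nle Nhom kk0])
  have "?lhs = (\<integral>\<^sup>+y. (\<integral>\<^sup>+x. ennreal (\<bar>R_diff m f x y\<bar> powr p / N (x - y) powr q * k (N (x - y))) \<partial>lborel) \<partial>lborel)"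
    by (simp add: nn_integral_completion)
  also have "\<dots> = (\<integral>\<^sup>+y. (\<integral>\<^sup>+x. \<Phi> y (x - y) \<partial>lborel) \<partial>lborel)"
  proof (rule nn_integral_cong_AE)
    show "AE y in lborel. (\<integral>\<^sup>+x. ennreal (\<bar>R_diff m f x y\<bar> powr p / N (x - y) powr q * k (N (x - y))) \<partial>lborel) =
        (\<integral>\<^sup>+x. \<Phi> y (x - y) \<partial>lborel)"
      using ff0
    proof eventually_elim
      case (elim y)
      have "AE x in lborel. k (N (- y + 1 *\<^sub>R x)) = k0 (N (- y + 1 *\<^sub>R x))"
        by (rule AE_lborel_affine[OF _ kN]) simp
      with R_diff_cong_AE[OF m ff0 elim]
      have "AE x in lborel. ennreal (\<bar>R_diff m f x y\<bar> powr p / N (x - y) powr q * k (N (x - y))) = \<Phi> y (x - y)"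
      proof eventually_elim
        case (elim x)
        then show ?case
          using kpos[of "N (x - y)"]
          by (simp add: \<Phi>_def R_diff_eq_forward_diff[OF m, of f0] ennreal_mult[symmetric] divide_inverse mult.assoc)
      qed
      then show ?case by (rule nn_integral_cong_AE)
    qed
  qed
  also have "\<dots> = (\<integral>\<^sup>+y. (\<integral>\<^sup>+w. \<Phi> y w \<partial>lborel) \<partial>lborel)"
  proof (rule nn_integral_cong)
    fix y
    show "(\<integral>\<^sup>+x. \<Phi> y (x - y) \<partial>lborel) = (\<integral>\<^sup>+w. \<Phi> y w \<partial>lborel)"
      using nn_integral_translate[of "\<Phi> y" "- y"] by simp
  qed
  also have "\<dots> = (\<integral>\<^sup>+w. (\<integral>\<^sup>+y. \<Phi> y w \<partial>lborel) \<partial>lborel)"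
    by (rule lborel_pair.Fubini') (simp add: lborel_prod[symmetric])
  also have "\<dots> = ?rhs"
  proof (rule nn_integral_cong)
    fix w
    show "(\<integral>\<^sup>+y. \<Phi> y w \<partial>lborel) = pth_moment p (\<lambda>y. forward_diff m (\<lambda>s. f0 (y + s *\<^sub>R ((1 / real m) *\<^sub>R w))) 0) *
        (ennreal (inverse (N w powr q)) * ennreal (k0 (N w)))"
      unfolding \<Phi>_def pth_moment_def forward_diff_def by (rule nn_integral_multc) measurable
  qed
  finally show ?thesis .
qed

lemma lebesgue_half_line_borel_representative:
  fixes k :: "real \<Rightarrow> real"
  assumes "k \<in> borel_measurable (lebesgue_on {0..})" and pos: "\<And>r. 0 \<le> r \<Longrightarrow> 0 \<le> k r"
  obtains k0 where "k0 \<in> borel_measurable borel" "\<And>r. 0 \<le> k0 r" "AE r in lborel. 0 \<le> r \<longrightarrow> k r = k0 r"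
proof -
  have "(\<lambda>r. if r \<in> {0..} then k r else 0) \<in> borel_measurable lebesgue"
    using assms(1) by (rule borel_measurable_if_I) simp
  then obtain k1 where k1: "k1 \<in> borel_measurable lborel"
      "AE r in lborel. (if r \<in> {0..} then k r else 0) = k1 r"
    using completion_ex_borel_measurable_real by blast
  show thesis
  proof (rule that[of "\<lambda>r. max 0 (k1 r)"])
    show "(\<lambda>r. max 0 (k1 r)) \<in> borel_measurable borel"
      using k1(1) by simp
    show "AE r in lborel. 0 \<le> r \<longrightarrow> k r = max 0 (k1 r)"
      using k1(2)
    proof eventually_elim
      case (elim r)
      then show ?case using pos[of r] by auto
    qed
  qed simp
qed

section \<open>Passage to the limit\<close>

text \<open>
  The constant \<open>b\<close> may blow up as \<open>a\<close> tends to \<open>1\<close>, but it is fixed when the error \<open>E\<close> goes to \<open>0\<close>.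
\<close>

lemma tendsto_if_mutually_dominated:
  fixes L E :: "'a \<Rightarrow> ennreal"
  assumes M: "M < \<infinity>" and E: "(E \<longlongrightarrow> 0) F"
    and dom: "\<And>a::real. 1 < a \<Longrightarrow> \<exists>b::real. \<forall>\<^sub>F \<epsilon> in F.
      L \<epsilon> \<le> ennreal a * M + ennreal b * E \<epsilon> \<and> M \<le> ennreal a * L \<epsilon> + ennreal b * E \<epsilon>"
  shows "(L \<longlongrightarrow> M) F"
proof -
  have step: "\<exists>a>1. ennreal a * x < y" if "x < y" for x y :: ennreal
  proof -
    have "((\<lambda>a. ennreal a * x) \<longlongrightarrow> ennreal 1 * x) (at_right 1)"
      using that by (intro tendsto_mult_ennreal tendsto_ennrealI tendsto_ident_at) (auto simp: less_top[symmetric])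
    then have "\<forall>\<^sub>F a in at_right 1. ennreal a * x < y"
      by (rule order_tendstoD(2)) (use that in simp)
    then obtain b :: real where b: "1 < b" "\<And>a. 1 < a \<Longrightarrow> a < b \<Longrightarrow> ennreal a * x < y"
      by (auto simp: eventually_at_right_field)
    then show ?thesis using b(2)[of "(1 + b) / 2"] by (intro exI[of _ "(1 + b) / 2"]) auto
  qed
  have small: "\<forall>\<^sub>F \<epsilon> in F. x + ennreal b * E \<epsilon> < y" if "x < y" for x y :: ennreal and b :: real
  proof -
    have "((\<lambda>\<epsilon>. x + ennreal b * E \<epsilon>) \<longlongrightarrow> x + ennreal b * 0) F"
      by (intro tendsto_add tendsto_const ennreal_tendsto_cmult E) simp
    then show ?thesis by (rule order_tendstoD(2)) (use that in simp)
  qed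
  show ?thesis
  proof (rule order_tendstoI)
    fix u assume "M < u"
    then obtain a where a: "1 < a" "ennreal a * M < u" using step by blast
    obtain b where "\<forall>\<^sub>F \<epsilon> in F. L \<epsilon> \<le> ennreal a * M + ennreal b * E \<epsilon> \<and> M \<le> ennreal a * L \<epsilon> + ennreal b * E \<epsilon>"
      using dom[OF a(1)] by blast
    then show "\<forall>\<^sub>F \<epsilon> in F. L \<epsilon> < u"
      using small[OF a(2), of b] by eventually_elim auto
  next
    fix l assume "l < M"
    then obtain a where a: "1 < a" "ennreal a * l < M" using step by blast
    obtain b where "\<forall>\<^sub>F \<epsilon> in F. L \<epsilon> \<le> ennreal a * M + ennreal b * E \<epsilon> \<and> M \<le> ennreal a * L \<epsilon> + ennreal b * E \<epsilon>"
      using dom[OF a(1)] by blast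
    then show "\<forall>\<^sub>F \<epsilon> in F. l < L \<epsilon>"
      using small[OF a(2), of b]
    proof eventually_elim
      case (elim \<epsilon>)
      show ?case
      proof (rule ccontr)
        assume "\<not> l < L \<epsilon>"
        then have "ennreal a * L \<epsilon> + ennreal b * E \<epsilon> \<le> ennreal a * l + ennreal b * E \<epsilon>"
          by (intro add_right_mono mult_left_mono) auto
        then show False using elim by (metis leD le_less_trans order.strict_trans1)
      qed
    qed
  qed
qed

lemma tendsto_zero_if_split_bound:
  fixes E :: "real \<Rightarrow> ennreal"
  assumes C: "C < \<infinity>"
    and bound: "\<And>\<tau>::real. 0 < \<tau> \<Longrightarrow> \<exists>T. (T \<longlongrightarrow> 0) F \<and> (\<forall>\<^sub>F \<epsilon> in F. E \<epsilon> \<le> C * (ennreal \<tau> + B * T \<epsilon>))"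
    and B: "B < \<infinity>"
  shows "(E \<longlongrightarrow> 0) F"
proof -
  have "\<forall>\<^sub>F \<epsilon> in F. E \<epsilon> < u" if u: "0 < u" for u
  proof -
    have "((\<lambda>\<tau>. C * ennreal \<tau>) \<longlongrightarrow> C * ennreal 0) (at_right 0)"
      using C by (intro ennreal_tendsto_cmult tendsto_ennrealI tendsto_ident_at) simp
    then have "\<forall>\<^sub>F \<tau> in at_right 0. C * ennreal \<tau> < u"
      by (rule order_tendstoD(2)) (use u in simp)
    then obtain b :: real where b: "0 < b" "\<And>\<tau>. 0 < \<tau> \<Longrightarrow> \<tau> < b \<Longrightarrow> C * ennreal \<tau> < u"
      by (auto simp: eventually_at_right_field)
    obtain T where T: "(T \<longlongrightarrow> 0) F" "\<forall>\<^sub>F \<epsilon> in F. E \<epsilon> \<le> C * (ennreal (b / 2) + B * T \<epsilon>)"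
      using bound[of "b / 2"] b(1) by auto
    have "((\<lambda>\<epsilon>. C * (ennreal (b / 2) + B * T \<epsilon>)) \<longlongrightarrow> C * (ennreal (b / 2) + B * 0)) F"
      using B C by (intro ennreal_tendsto_cmult tendsto_add tendsto_const T) auto
    then have "\<forall>\<^sub>F \<epsilon> in F. C * (ennreal (b / 2) + B * T \<epsilon>) < u"
      by (rule order_tendstoD(2)) (use b(1) b(2)[of "b / 2"] in simp)
    then show ?thesis using T(2) by eventually_elim auto
  qed
  then show ?thesis by (intro order_tendstoI) auto
qed

lemma pth_moment_uminus: "pth_moment p (\<lambda>x. - g x) = pth_moment p g"
  by (simp add: pth_moment_def)

text \<open>
  The body differs from the closed unit ball of its norm by a subset of the unit sphere, which is a null set.
\<close>

lemma weak_derivative_energy_eq: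
  fixes K :: "(real ^ 'n::finite) set" and N :: "real ^ 'n \<Rightarrow> real"
  assumes Nm [measurable]: "N \<in> borel_measurable borel"
    and N0: "\<And>x. 0 \<le> N x" and Nle: "\<And>x. norm x \<le> C * N x"
    and Nhom: "\<And>t x. 0 < t \<Longrightarrow> N (t *\<^sub>R x) = t * N x"
    and K: "\<And>x. N x < 1 \<Longrightarrow> x \<in> K" "\<And>x. x \<in> K \<Longrightarrow> N x \<le> 1"
    and Gm [measurable]: "\<And>js. length js = m \<Longrightarrow> G js \<in> borel_measurable borel"
    and G: "\<And>js. length js = m \<Longrightarrow> AE x in lborel. weak_partials js f x = G js x"
  shows "(\<integral>\<^sup>+x. (\<integral>\<^sup>+y\<in>K. ennreal (\<bar>weak_D m f x y\<bar> powr p) \<partial>lebesgue) \<partial>lebesgue) =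
    (\<integral>\<^sup>+y. pth_moment p (\<lambda>x. dir_form m (\<lambda>js. G js x) y) * indicator {..1} (N y) \<partial>lborel)"
proof -
  have "AE r in lborel. r \<noteq> (1 :: real)"
    by (rule AE_lborel_singleton)
  then have not_1: "AE r in lborel. 0 \<le> r \<longrightarrow> r \<noteq> (1 :: real)"
    by eventually_elim simp
  have "AE y in lborel. N y \<noteq> 1"
    by (rule AE_radial[of N C, OF Nm N0 Nle Nhom not_1])
  then have Kind: "AE y in lborel. indicator K y = (indicator {..1} (N y) :: ennreal)"
    by eventually_elim (use K in \<open>force simp: indicator_def\<close>)
  define \<Psi> where "\<Psi> x y = ennreal (\<bar>dir_form m (\<lambda>js. G js x) y\<bar> powr p) * indicator {..1} (N y)" for x y
  have [measurable]: "(\<lambda>(x, y). \<Psi> x y) \<in> borel_measurable (borel \<Otimes>\<^sub>M borel)"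
    unfolding \<Psi>_def by measurable
  have "(\<integral>\<^sup>+x. (\<integral>\<^sup>+y\<in>K. ennreal (\<bar>weak_D m f x y\<bar> powr p) \<partial>lebesgue) \<partial>lebesgue) =
      (\<integral>\<^sup>+x. (\<integral>\<^sup>+y. \<Psi> x y \<partial>lborel) \<partial>lborel)"
    unfolding nn_integral_completion
  proof (rule nn_integral_cong_AE)
    have "AE x in lborel. \<forall>js\<in>{js. length js = m}. weak_partials js f x = G js x"
      by (rule AE_finite_allI) (simp_all add: G)
    then show "AE x in lborel. (\<integral>\<^sup>+y\<in>K. ennreal (\<bar>weak_D m f x y\<bar> powr p) \<partial>lborel) = (\<integral>\<^sup>+y. \<Psi> x y \<partial>lborel)"
    proof eventually_elim
      case (elim x)
      have "weak_D m f x y = dir_form m (\<lambda>js. G js x) y" for y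
        unfolding weak_D_eq_dir_form dir_form_def using elim by (intro sum.cong) auto
      then show ?case
        by (intro nn_integral_cong_AE) (use Kind in \<open>auto simp: \<Psi>_def elim!: eventually_mono\<close>)
    qed
  qed
  also have "\<dots> = (\<integral>\<^sup>+y. (\<integral>\<^sup>+x. \<Psi> x y \<partial>lborel) \<partial>lborel)"
    by (rule lborel_pair.Fubini'[symmetric]) (simp add: lborel_prod[symmetric])
  also have "\<dots> = (\<integral>\<^sup>+y. pth_moment p (\<lambda>x. dir_form m (\<lambda>js. G js x) y) * indicator {..1} (N y) \<partial>lborel)"
    unfolding \<Psi>_def pth_moment_def by (intro nn_integral_cong nn_integral_multc) measurable
  finally show ?thesis .
qed

text \<open>
  Turns bounds by \<open>|w / m|\<^sup>m\<^sup>p\<close> into bounds by the power of another norm \<open>r\<close> of \<open>w\<close> that dominates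
  \<open>|w|\<close> up to the factor \<open>C\<close>; this power cancels against the kernel.
\<close>

lemma scaled_norm_powr_le:
  fixes w :: "'a::real_normed_vector"
  assumes m: "1 \<le> m" and p: "0 < p" and nonneg: "0 \<le> C" "0 \<le> r" "0 \<le> J" and w: "norm w \<le> C * r"
  shows "(norm ((1 / real m) *\<^sub>R w) ^ m * J) powr p \<le> ((C / real m) ^ m * J) powr p * r powr (real m * p)"
proof -
  have "norm ((1 / real m) *\<^sub>R w) \<le> C / real m * r"
    using w m by (simp add: divide_right_mono)
  then have "norm ((1 / real m) *\<^sub>R w) ^ m * J \<le> (C / real m * r) ^ m * J"
    using nonneg by (intro mult_right_mono power_mono) auto
  then have "(norm ((1 / real m) *\<^sub>R w) ^ m * J) powr p \<le> ((C / real m * r) ^ m * J) powr p"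
    using p nonneg by (intro powr_mono2) auto
  also have "(C / real m * r) ^ m * J = (C / real m) ^ m * J * r ^ m"
    by (simp only: power_mult_distrib mult_ac)
  also have "((C / real m) ^ m * J * r ^ m) powr p = ((C / real m) ^ m * J) powr p * (r ^ m) powr p"
    using nonneg by (simp add: powr_mult)
  also have "(r ^ m) powr p = r powr (real m * p)"
  proof (cases "r = 0")
    case True
    then show ?thesis using m by simp
  next
    case False
    then show ?thesis using nonneg by (simp add: powr_realpow[symmetric] powr_powr)
  qed
  finally show ?thesis .
qed

theorem theorem1p2:
  fixes m :: nat and p :: real
    and K :: "(real ^ 'n::finite) set"
    and \<rho> :: "real \<Rightarrow> real \<Rightarrow> real"
    and f :: "real ^ 'n \<Rightarrow> real"
  assumes "m \<ge> 1" and "1 < p"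
    and "bounded K" and "convex K" and "K = uminus ` K" and "0 \<in> K" and "interior K \<noteq> {}"
    and "\<And>\<epsilon>. 0 < \<epsilon> \<Longrightarrow> \<rho> \<epsilon> \<in> borel_measurable (lebesgue_on {0..})"
    and "\<And>\<epsilon> r. 0 < \<epsilon> \<Longrightarrow> 0 \<le> r \<Longrightarrow> 0 \<le> \<rho> \<epsilon> r"
    and "\<And>\<epsilon>. 0 < \<epsilon> \<Longrightarrow>
           (\<integral>\<^sup>+ r \<in> {0..}. ennreal (r ^ (CARD('n) - 1) * \<rho> \<epsilon> r) \<partial>lebesgue) = 1"
    and "\<And>\<delta>. 0 < \<delta> \<Longrightarrow>
           ((\<lambda>\<epsilon>. \<integral>\<^sup>+ r \<in> {\<delta>..}. ennreal (r ^ (CARD('n) - 1) * \<rho> \<epsilon> r) \<partial>lebesgue) \<longlongrightarrow> 0)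
             (at_right 0)"
    and "f \<in> Sobolev m p"
  shows "((\<lambda>\<epsilon>. \<integral>\<^sup>+ y. (\<integral>\<^sup>+ x.
              ennreal (\<bar>R_diff m f x y\<bar> powr p / norm_of_body K (x - y) powr (real m * p)
                * \<rho> \<epsilon> (norm_of_body K (x - y))) \<partial>lebesgue) \<partial>lebesgue)
          \<longlongrightarrow> ennreal ((real CARD('n) + real m * p) / real m powr (real m * p)) *
            (\<integral>\<^sup>+ x. (\<integral>\<^sup>+ y \<in> K. ennreal (\<bar>weak_D m f x y\<bar> powr p) \<partial>lebesgue) \<partial>lebesgue))
         (at_right 0)"
proof -
  note m = assms(1) and p = assms(2) and body = assms(3-7)
  note \<rho>m = assms(8) and \<rho>0 = assms(9) and mass = assms(10) and tail = assms(11) and fS = assms(12)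
  define N where "N = norm_of_body K"
  define q where "q = real m * p"
  have q: "0 < q" using m p by (simp add: q_def)
  obtain C where C: "0 < C" "\<And>x. norm x \<le> C * N x"
    using norm_le_norm_of_body[OF body] unfolding N_def by blast
  have Nm [measurable]: "N \<in> borel_measurable borel"
    unfolding N_def by (rule borel_measurable_norm_of_body[OF body])
  have N0: "0 \<le> N x" for x
    unfolding N_def by (rule norm_of_body_nonneg[OF body])
  have Nhom: "N (t *\<^sub>R x) = t * N x" if "0 < t" for t x
    unfolding N_def using that by (rule norm_of_body_scale[OF body])
  have NK: "x \<in> K" if "N x < 1" for x
    using that mem_body_if_norm_of_body_less_1[OF body] unfolding N_def by blast
  have KN: "N x \<le> 1" if "x \<in> K" for x
    using that norm_of_body_le_1[OF body] unfolding N_def by blast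

  obtain f0 G where f0 [measurable]: "f0 \<in> borel_measurable borel"
    and lf0: "locally_integrable f0" and ff0: "AE x in lborel. f x = f0 x"
    and Gm [measurable]: "\<And>js. length js = m \<Longrightarrow> G js \<in> borel_measurable borel"
    and lG: "\<And>js. length js = m \<Longrightarrow> locally_integrable (G js)"
    and Gp: "\<And>js. length js = m \<Longrightarrow> pth_moment p (G js) < \<infinity>"
    and Geq: "\<And>js. length js = m \<Longrightarrow> AE x in lborel. weak_partials js f x = G js x"
    and weak: "\<And>js \<phi>. length js = m \<Longrightarrow> test_function \<phi> \<Longrightarrow>
      (\<integral>x. f0 x * partials js \<phi> x \<partial>lborel) = (-1) ^ m * (\<integral>x. G js x * \<phi> x \<partial>lborel)"
    using Sobolev_borel_representatives[OF fS] by blast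

  have "\<exists>k0. k0 \<in> borel_measurable borel \<and> (\<forall>r. 0 \<le> k0 r) \<and>
      (AE r in lborel. 0 \<le> r \<longrightarrow> \<rho> \<epsilon> r = k0 r)" if "0 < \<epsilon>" for \<epsilon>
    using lebesgue_half_line_borel_representative[OF \<rho>m[OF that] \<rho>0[OF that]] by metis
  then obtain k where km: "\<And>\<epsilon>. 0 < \<epsilon> \<Longrightarrow> k \<epsilon> \<in> borel_measurable borel"
    and k0: "\<And>\<epsilon> r. 0 < \<epsilon> \<Longrightarrow> 0 \<le> k \<epsilon> r"
    and \<rho>k: "\<And>\<epsilon>. 0 < \<epsilon> \<Longrightarrow> AE r in lborel. 0 \<le> r \<longrightarrow> \<rho> \<epsilon> r = k \<epsilon> r"
    by metis

  \<comment> \<open>the radial mass of the kernel in a set of radii\<close>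
  define I where "I A \<epsilon> = (\<integral>\<^sup>+r\<in>A. ennreal (r ^ (CARD('n) - 1)) * ennreal (k \<epsilon> r) \<partial>lborel)" for A \<epsilon>
  have I_eq: "(\<integral>\<^sup>+ r \<in> A. ennreal (r ^ (CARD('n) - 1) * \<rho> \<epsilon> r) \<partial>lebesgue) = I A \<epsilon>"
    if "0 < \<epsilon>" "A \<subseteq> {0..}" for A \<epsilon>
    unfolding nn_integral_completion I_def
    by (rule nn_integral_cong_AE)
      (use \<rho>k[OF that(1)] that(2) in \<open>auto elim!: eventually_mono simp: indicator_def ennreal_mult'\<close>)
  have I1: "I {0..} \<epsilon> = 1" if "0 < \<epsilon>" for \<epsilon>
    using mass[OF that] I_eq[OF that, of "{0..}"] by simp
  have It: "((\<lambda>\<epsilon>. I {\<delta>..} \<epsilon>) \<longlongrightarrow> 0) (at_right 0)" if "0 < \<delta>" for \<delta>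
  proof (rule Lim_transform_eventually[OF tail[OF that]])
    show "\<forall>\<^sub>F \<epsilon> in at_right 0. (\<integral>\<^sup>+ r \<in> {\<delta>..}. ennreal (r ^ (CARD('n) - 1) * \<rho> \<epsilon> r) \<partial>lebesgue) = I {\<delta>..} \<epsilon>"
      using eventually_at_right_less[of 0]
      by eventually_elim (rule I_eq, use that in auto)
  qed

  \<comment> \<open>the difference with step \<open>w / m\<close> and the derivative in this direction\<close>
  define u where "u w y = forward_diff m (\<lambda>s. f0 (y + s *\<^sub>R ((1 / real m) *\<^sub>R w))) 0" for w y
  define v where "v w y = dir_form m (\<lambda>js. G js y) ((1 / real m) *\<^sub>R w)" for w y
  have [measurable]: "(\<lambda>(w, y). u w y) \<in> borel_measurable (borel \<Otimes>\<^sub>M borel)"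
    unfolding u_def forward_diff_def by measurable
  have [measurable]: "(\<lambda>(w, y). v w y) \<in> borel_measurable (borel \<Otimes>\<^sub>M borel)"
    unfolding v_def by measurable
  define D where "D w = pth_moment p (u w)" for w
  define H where "H w = pth_moment p (v w)" for w
  define E where "E w = pth_moment p (\<lambda>y. u w y - v w y)" for w
  have Dm [measurable]: "D \<in> borel_measurable borel"
    unfolding D_def[abs_def] pth_moment_def by measurable
  have Hm [measurable]: "H \<in> borel_measurable borel"
    unfolding H_def[abs_def] pth_moment_def by measurable
  have Em [measurable]: "E \<in> borel_measurable borel"
    unfolding E_def[abs_def] pth_moment_def by measurable
  define \<theta> where "\<theta> \<epsilon> w = ennreal (inverse (N w powr q)) * ennreal (k \<epsilon> (N w))" for \<epsilon> w
  have \<theta>m [measurable]: "\<theta> \<epsilon> \<in> borel_measurable borel" if "0 < \<epsilon>" for \<epsilon>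
    using km[OF that] unfolding \<theta>_def[abs_def] by measurable
  define L where "L \<epsilon> = (\<integral>\<^sup>+w. D w * \<theta> \<epsilon> w \<partial>lborel)" for \<epsilon>
  define Er where "Er \<epsilon> = (\<integral>\<^sup>+w. E w * \<theta> \<epsilon> w \<partial>lborel)" for \<epsilon>
  define M where "M = ennreal (real CARD('n) + q) * (\<integral>\<^sup>+w. H w * indicator {..1} (N w) \<partial>lborel)"

  have L_eq: "(\<integral>\<^sup>+ y. (\<integral>\<^sup>+ x. ennreal (\<bar>R_diff m f x y\<bar> powr p / norm_of_body K (x - y) powr (real m * p)
      * \<rho> \<epsilon> (norm_of_body K (x - y))) \<partial>lebesgue) \<partial>lebesgue) = L \<epsilon>" if "0 < \<epsilon>" for \<epsilon>
    using nn_integral_R_diff_radial[OF m Nm N0 C(2) Nhom f0 ff0 km[OF that] k0[OF that] \<rho>k[OF that], of p q]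
    unfolding L_def D_def u_def \<theta>_def N_def q_def by simp

  define J where "J = real (card {js :: 'n list. length js = m})"
  define c1 where "c1 = ((C / real m) ^ m * J) powr p"
  have c1: "(norm ((1 / real m) *\<^sub>R w) ^ m * J) powr p \<le> c1 * N w powr q" for w :: "real ^ 'n"
    unfolding c1_def q_def
    by (rule scaled_norm_powr_le) (use m p C N0 in \<open>auto simp: J_def\<close>)
  define S where "S = (\<Sum>js | length js = m. pth_moment p (G js))"
  have S: "S < \<infinity>"
    unfolding S_def using Gp by (simp add: less_top[symmetric])

  have H_le: "H w \<le> (ennreal c1 * S) * ennreal (N w powr q)" for w
  proof -
    have "H w \<le> ennreal ((norm ((1 / real m) *\<^sub>R w) ^ m * J) powr p) * S"
      unfolding H_def v_def S_def J_def using p by (intro pth_moment_dir_form_le Gm) auto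
    also have "\<dots> \<le> ennreal (c1 * N w powr q) * S"
      by (intro mult_right_mono ennreal_leI c1) auto
    finally show ?thesis
      by (simp add: ennreal_mult c1_def mult_ac)
  qed
  have H_hom: "H (t *\<^sub>R w) = ennreal (t powr q) * H w" if "0 < t" for t w
  proof -
    have "v (t *\<^sub>R w) = (\<lambda>y. t ^ m * v w y)"
    proof
      fix y
      have "(1 / real m) *\<^sub>R (t *\<^sub>R w) = t *\<^sub>R ((1 / real m) *\<^sub>R w)" by simp
      then show "v (t *\<^sub>R w) y = t ^ m * v w y"
        unfolding v_def by (simp only: dir_form_scale)
    qed
    moreover have "\<bar>t ^ m\<bar> powr p = t powr q"
      using that by (simp add: q_def powr_realpow[symmetric] powr_powr)
    moreover have "v w \<in> borel_measurable borel"
      by measurable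
    ultimately show ?thesis
      unfolding H_def by (simp only: pth_moment_cmult)
  qed
  \<comment> \<open>The main term is the same for all \<open>\<epsilon>\<close>, since the kernel has mass 1.\<close>
  have M_eq: "M = (\<integral>\<^sup>+w. H w * \<theta> \<epsilon> w \<partial>lborel)" if "0 < \<epsilon>" for \<epsilon>
  proof -
    have [measurable]: "k \<epsilon> \<in> borel_measurable borel" using km[OF that] .
    have "(\<integral>\<^sup>+w. H w * (ennreal (inverse (N w powr q)) * ennreal (k \<epsilon> (N w))) \<partial>lborel) =
      ennreal (real DIM(real ^ 'n) + q) * (\<integral>\<^sup>+w. H w * indicator {..1} (N w) \<partial>lborel) *
      (\<integral>\<^sup>+r\<in>{0..}. ennreal (r ^ (DIM(real ^ 'n) - 1)) * ennreal (k \<epsilon> r) \<partial>lborel)"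
      by (rule nn_integral_homogeneous_radial[OF Nm N0 C(2) _ Hm _ H_le _ q])
        (simp_all add: Nhom H_hom ennreal_mult_less_top S[simplified])
    then show ?thesis
      using I1[OF that] by (simp add: M_def \<theta>_def I_def del: ennreal_plus)
  qed
  have M_fin: "M < \<infinity>"
  proof -
    have "(\<integral>\<^sup>+w. H w * indicator {..1} (N w) \<partial>lborel) \<le> (\<integral>\<^sup>+w. ennreal c1 * S * indicator {..1} (N w) \<partial>lborel)"
    proof (rule nn_integral_mono)
      fix w
      show "H w * indicator {..1} (N w) \<le> ennreal c1 * S * indicator {..1} (N w)"
      proof (cases "N w \<le> 1")
        case True
        then have "N w powr q \<le> 1 powr q"
          using N0[of w] q by (intro powr_mono2) auto
        then have "ennreal c1 * S * ennreal (N w powr q) \<le> ennreal c1 * S * 1"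
          by (intro mult_left_mono) auto
        then show ?thesis
          using True order_trans[OF H_le[of w]] by simp
      qed simp
    qed
    also have "\<dots> = ennreal c1 * S * (\<integral>\<^sup>+w. indicator {..1} (N w) \<partial>lborel)"
      by (rule nn_integral_cmult) measurable
    also have "\<dots> < \<infinity>"
      using S radial_unit_ball_finite[of N C, OF N0 C(2)] by (simp add: ennreal_mult_less_top)
    finally show ?thesis
      by (simp add: M_def ennreal_mult_less_top)
  qed
  let ?W = "\<integral>\<^sup>+ x. (\<integral>\<^sup>+ y \<in> K. ennreal (\<bar>weak_D m f x y\<bar> powr p) \<partial>lebesgue) \<partial>lebesgue"
  have M_target: "ennreal ((real CARD('n) + real m * p) / real m powr (real m * p)) *
      ?W = M"
  proof -
    have "(\<integral>\<^sup>+w. H w * indicator {..1} (N w) \<partial>lborel) = (\<integral>\<^sup>+w. ennreal ((1 / real m) powr q) *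
        (pth_moment p (\<lambda>x. dir_form m (\<lambda>js. G js x) w) * indicator {..1} (N w)) \<partial>lborel)"
    proof (rule nn_integral_cong)
      fix w
      have "H w = ennreal ((1 / real m) powr q) * H (real m *\<^sub>R w)"
        using H_hom[of "1 / real m" "real m *\<^sub>R w"] m by simp
      then have "H w = ennreal ((1 / real m) powr q) * pth_moment p (\<lambda>x. dir_form m (\<lambda>js. G js x) w)"
        using m by (simp add: H_def v_def[abs_def])
      then show "H w * indicator {..1} (N w) = ennreal ((1 / real m) powr q) *
        (pth_moment p (\<lambda>x. dir_form m (\<lambda>js. G js x) w) * indicator {..1} (N w))"
        by (simp add: mult.assoc)
    qed
    also have "\<dots> = ennreal ((1 / real m) powr q) *
        (\<integral>\<^sup>+w. pth_moment p (\<lambda>x. dir_form m (\<lambda>js. G js x) w) * indicator {..1} (N w) \<partial>lborel)"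
      unfolding pth_moment_def by (rule nn_integral_cmult) measurable
    also have "(\<integral>\<^sup>+w. pth_moment p (\<lambda>x. dir_form m (\<lambda>js. G js x) w) * indicator {..1} (N w) \<partial>lborel) =
        ?W"
      by (rule weak_derivative_energy_eq[OF Nm N0 C(2) _ _ _ Gm Geq, symmetric])
        (simp_all add: Nhom NK KN)
    finally have "M = ennreal (real CARD('n) + q) * ennreal ((1 / real m) powr q) *
        ?W"
      unfolding M_def by (simp only: mult.assoc)
    also have "ennreal (real CARD('n) + q) * ennreal ((1 / real m) powr q) =
        ennreal ((real CARD('n) + real m * p) / real m powr (real m * p))"
      using q by (subst ennreal_mult[symmetric]) (auto simp: q_def powr_divide)
    finally show ?thesis by simp
  qed

  have Er_lim: "(Er \<longlongrightarrow> 0) (at_right 0)"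
  proof -
    obtain \<kappa> where \<kappa>: "\<kappa> < \<infinity>" "\<And>g. g \<in> borel_measurable borel \<Longrightarrow>
        (\<integral>\<^sup>+x. g (N x) \<partial>lborel) = \<kappa> * (\<integral>\<^sup>+r\<in>{0..}. ennreal (r ^ (DIM(real ^ 'n) - 1)) * g r \<partial>lborel)"
      using nn_integral_radial[of N C, OF Nm N0 C(2) Nhom] by metis
    define B where "B = (\<Sum>js :: 'n list | length js = m. ennreal (2 powr p) * (pth_moment p (G js) + pth_moment p (G js)))"
    have B: "B < \<infinity>"
      unfolding B_def using Gp by (simp add: less_top[symmetric] ennreal_mult_eq_top_iff)
    \<comment> \<open>the modulus of continuity of the weak derivatives, bounded and vanishing at 0\<close>
    define \<omega> where "\<omega> z = (\<Sum>js | length js = m. pth_moment p (\<lambda>x. G js (x + z) - G js x))" for z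
    have \<omega>B: "\<omega> z \<le> B" for z
      unfolding \<omega>_def B_def
    proof (rule sum_mono)
      fix js :: "'n list" assume "js \<in> {js. length js = m}"
      then have [measurable]: "G js \<in> borel_measurable borel" using Gm by simp
      have "pth_moment p (\<lambda>x. G js (x + z) + - G js x) \<le>
          ennreal (2 powr p) * (pth_moment p (\<lambda>x. G js (x + z)) + pth_moment p (\<lambda>x. - G js x))"
        using p by (intro pth_moment_add_le) auto
      then show "pth_moment p (\<lambda>x. G js (x + z) - G js x) \<le>
          ennreal (2 powr p) * (pth_moment p (G js) + pth_moment p (G js))"
        by (simp add: pth_moment_translate pth_moment_uminus)
    qed
    have "(\<omega> \<longlongrightarrow> (\<Sum>js :: 'n list | length js = m. 0)) (nhds 0)"
      unfolding \<omega>_def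
    proof (rule tendsto_sum)
      fix js :: "'n list" assume js: "js \<in> {js. length js = m}"
      have "Lp_continuous_translation p (G js)"
        using p js by (intro translation_continuous_in_Lp Gm Gp) auto
      then show "((\<lambda>z. pth_moment p (\<lambda>x. G js (x + z) - G js x)) \<longlongrightarrow> 0) (nhds 0)"
        by (simp add: Lp_continuous_translation_def)
    qed
    then have \<omega>0: "(\<omega> \<longlongrightarrow> 0) (nhds 0)" by simp
    have E_le: "E w \<le> ennreal (c1 * N w powr q) * b" if "\<And>z. norm z \<le> C * N w \<Longrightarrow> \<omega> z \<le> b" for w b
    proof -
      have "E w \<le> ennreal ((norm ((1 / real m) *\<^sub>R w) ^ m * J) powr p) * b"
        unfolding E_def u_def v_def J_def
      proof (rule pth_moment_forward_diff_minus_dir_form_le)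
        fix z :: "real ^ 'n" assume "norm z \<le> real m * norm ((1 / real m) *\<^sub>R w)"
        then have "norm z \<le> C * N w" using m C(2)[of w] by simp
        then show "(\<Sum>js | length js = m. pth_moment p (\<lambda>x. G js (x + z) - G js x)) \<le> b"
          using that unfolding \<omega>_def by blast
      qed (use p lf0 lG Gm weak in auto)
      also have "\<dots> \<le> ennreal (c1 * N w powr q) * b"
        by (intro mult_right_mono ennreal_leI c1) auto
      finally show ?thesis .
    qed
    show ?thesis
    proof (rule tendsto_zero_if_split_bound[where C = "ennreal c1 * \<kappa>" and B = B])
      show "ennreal c1 * \<kappa> < \<infinity>" using \<kappa>(1) by (simp add: ennreal_mult_less_top)
      show "B < \<infinity>" by fact
      fix \<tau> :: real assume \<tau>: "0 < \<tau>"
      have "\<forall>\<^sub>F z in nhds 0. \<omega> z < ennreal \<tau>"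
        using \<omega>0 by (rule order_tendstoD(2)) (use \<tau> in simp)
      then obtain d where d: "0 < d" "\<And>z. norm z < d \<Longrightarrow> \<omega> z < ennreal \<tau>"
        by (auto simp: eventually_nhds_metric)
      \<comment> \<open>For \<open>N w < \<delta>\<close> all shifts that occur in \<open>E w\<close> are shorter than \<open>C (N w) < d\<close>.\<close>
      define \<delta> where "\<delta> = d / C"
      have \<delta>: "0 < \<delta>" using d C by (simp add: \<delta>_def)
      have "Er \<epsilon> \<le> ennreal c1 * \<kappa> * (ennreal \<tau> + B * I {\<delta>..} \<epsilon>)" if \<epsilon>: "0 < \<epsilon>" for \<epsilon>
      proof -
        have [measurable]: "k \<epsilon> \<in> borel_measurable borel" using km[OF \<epsilon>] .
        define g where "g r = ennreal c1 * ((ennreal \<tau> + B * indicator {\<delta>..} r) * ennreal (k \<epsilon> r))" for r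
        have gm: "g \<in> borel_measurable borel"
          unfolding g_def[abs_def] by measurable
        have "Er \<epsilon> \<le> (\<integral>\<^sup>+w. g (N w) \<partial>lborel)"
          unfolding Er_def
        proof (rule nn_integral_mono)
          fix w
          have E1: "E w \<le> ennreal (c1 * N w powr q) * (ennreal \<tau> + B * indicator {\<delta>..} (N w))"
          proof (rule E_le)
            fix z :: "real ^ 'n" assume z: "norm z \<le> C * N w"
            show "\<omega> z \<le> ennreal \<tau> + B * indicator {\<delta>..} (N w)"
            proof (cases "\<delta> \<le> N w")
              case True
              then show ?thesis using \<omega>B[of z] by (simp add: add_increasing)
            next
              case False
              then have "C * N w < d" using C(1) by (simp add: \<delta>_def field_simps)
              then show ?thesis using d(2)[of z] z False by simp
            qed
          qed
          have "ennreal (c1 * N w powr q) * ennreal (inverse (N w powr q)) \<le> ennreal c1"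
            by (cases "N w = 0") (auto simp: ennreal_mult[symmetric] c1_def mult.assoc)
          then have "(ennreal (c1 * N w powr q) * ennreal (inverse (N w powr q))) *
              ((ennreal \<tau> + B * indicator {\<delta>..} (N w)) * ennreal (k \<epsilon> (N w))) \<le> g (N w)"
            unfolding g_def by (rule mult_right_mono) simp
          moreover have "E w * \<theta> \<epsilon> w \<le> ennreal (c1 * N w powr q) * (ennreal \<tau> + B * indicator {\<delta>..} (N w)) * \<theta> \<epsilon> w"
            by (rule mult_right_mono[OF E1]) simp
          ultimately show "E w * \<theta> \<epsilon> w \<le> g (N w)"
            unfolding \<theta>_def by (simp add: mult_ac)
        qed
        also have "\<dots> = \<kappa> * (\<integral>\<^sup>+r\<in>{0..}. ennreal (r ^ (CARD('n) - 1)) * g r \<partial>lborel)"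
          using \<kappa>(2)[OF gm] by simp
        also have "(\<integral>\<^sup>+r\<in>{0..}. ennreal (r ^ (CARD('n) - 1)) * g r \<partial>lborel) =
            ennreal c1 * (\<integral>\<^sup>+r. ennreal \<tau> * (ennreal (r ^ (CARD('n) - 1)) * ennreal (k \<epsilon> r) * indicator {0..} r) +
              B * (ennreal (r ^ (CARD('n) - 1)) * ennreal (k \<epsilon> r) * indicator {\<delta>..} r) \<partial>lborel)"
            (is "_ = ennreal c1 * ?T")
          unfolding g_def using \<delta>
          by (subst nn_integral_cmult[symmetric])
            (auto intro!: nn_integral_cong simp: indicator_def distrib_left distrib_right mult_ac)
        also have "?T = ennreal \<tau> * I {0..} \<epsilon> + B * I {\<delta>..} \<epsilon>"
          unfolding I_def by (subst nn_integral_add) (simp_all add: nn_integral_cmult)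
        finally show ?thesis
          using I1[OF \<epsilon>] by (simp add: mult_ac)
      qed
      then show "\<exists>T. (T \<longlongrightarrow> 0) (at_right 0) \<and>
          (\<forall>\<^sub>F \<epsilon> in at_right 0. Er \<epsilon> \<le> ennreal c1 * \<kappa> * (ennreal \<tau> + B * T \<epsilon>))"
        by (intro exI[of _ "I {\<delta>..}"] conjI It[OF \<delta>] eventually_mono[OF eventually_at_right_less[of 0]])
    qed
  qed

  have "(L \<longlongrightarrow> M) (at_right 0)"
  proof (rule tendsto_if_mutually_dominated[OF M_fin Er_lim])
    fix a :: real assume a: "1 < a"
    obtain b where b: "0 < b"
      "\<And>g h :: real ^ 'n \<Rightarrow> real. g \<in> borel_measurable borel \<Longrightarrow> h \<in> borel_measurable borel \<Longrightarrow>
        pth_moment p (\<lambda>x. g x + h x) \<le> ennreal a * pth_moment p g + ennreal b * pth_moment p h"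
      using pth_moment_add_le_weighted[OF p a, where 'a = "real ^ 'n"] by metis
    have D_le: "D w \<le> ennreal a * H w + ennreal b * E w" for w
      using b(2)[of "v w" "\<lambda>y. u w y - v w y"] by (simp add: D_def H_def E_def)
    have H_le: "H w \<le> ennreal a * D w + ennreal b * E w" for w
      \<comment> \<open>the same inequality with the two functions exchanged\<close>
      using b(2)[of "u w" "\<lambda>y. - (u w y - v w y)"] pth_moment_uminus[of p "\<lambda>y. u w y - v w y"]
      by (simp add: D_def H_def E_def)
    have integrate: "(\<integral>\<^sup>+w. X w * \<theta> \<epsilon> w \<partial>lborel) \<le> ennreal a * (\<integral>\<^sup>+w. Y w * \<theta> \<epsilon> w \<partial>lborel) + ennreal b * Er \<epsilon>"
      if "0 < \<epsilon>" "\<And>w. X w \<le> ennreal a * Y w + ennreal b * E w" "Y \<in> borel_measurable borel" for X Y \<epsilon>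
    proof -
      note [measurable] = \<theta>m[OF that(1)] that(3)
      have "(\<integral>\<^sup>+w. X w * \<theta> \<epsilon> w \<partial>lborel) \<le> (\<integral>\<^sup>+w. ennreal a * (Y w * \<theta> \<epsilon> w) + ennreal b * (E w * \<theta> \<epsilon> w) \<partial>lborel)"
      proof (rule nn_integral_mono)
        fix w
        show "X w * \<theta> \<epsilon> w \<le> ennreal a * (Y w * \<theta> \<epsilon> w) + ennreal b * (E w * \<theta> \<epsilon> w)"
          using mult_right_mono[OF that(2)[of w], of "\<theta> \<epsilon> w"] by (simp add: distrib_right mult.assoc)
      qed
      also have "\<dots> = ennreal a * (\<integral>\<^sup>+w. Y w * \<theta> \<epsilon> w \<partial>lborel) + ennreal b * Er \<epsilon>"
        unfolding Er_def by (simp add: nn_integral_add nn_integral_cmult)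
      finally show ?thesis .
    qed
    have "L \<epsilon> \<le> ennreal a * M + ennreal b * Er \<epsilon> \<and> M \<le> ennreal a * L \<epsilon> + ennreal b * Er \<epsilon>" if "0 < \<epsilon>" for \<epsilon>
      using integrate[OF that D_le Hm] integrate[OF that H_le Dm] M_eq[OF that] by (simp add: L_def)
    then show "\<exists>b. \<forall>\<^sub>F \<epsilon> in at_right 0. L \<epsilon> \<le> ennreal a * M + ennreal b * Er \<epsilon> \<and> M \<le> ennreal a * L \<epsilon> + ennreal b * Er \<epsilon>"
      by (intro exI[of _ b] eventually_mono[OF eventually_at_right_less[of 0]])
  qed
  moreover have "\<forall>\<^sub>F \<epsilon> in at_right 0. L \<epsilon> = (\<integral>\<^sup>+ y. (\<integral>\<^sup>+ x. ennreal (\<bar>R_diff m f x y\<bar> powr p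
      / norm_of_body K (x - y) powr (real m * p) * \<rho> \<epsilon> (norm_of_body K (x - y))) \<partial>lebesgue) \<partial>lebesgue)"
    using eventually_at_right_less[of 0] by eventually_elim (rule L_eq[symmetric])
  ultimately show ?thesis
    unfolding M_target by (rule Lim_transform_eventually)
qed

end
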